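(* Let $k\in\mathbb{N}\setminus\{0\}$ and let $\Omega\subseteq\mathbb{R}^2$ be an open set that is multiply connected of order $k$. Then \[ \sup_{u\in C^\infty_0(\Omega)}\left\{\int_\Omega\big(\exp(4\pi u^2)-1\big)\,dx : \int_\Omega|\nabla u|^2\,dx=1\right\}<+\infty\qquad\Longleftrightarrow\qquad r_\Omega<+\infty . \] Moreover, if $r_\Omega<+\infty$, we have \[ \lim_{q\nearrow\infty}q\,\lambda_{2,q}(\Omega)=8\pi e . \]
   Context: For an open set $\Omega\subseteq\mathbb{R}^2$, the inradius is $r_\Omega=\sup\{r>0 : \text{there exists a disk } B_r(x_0)\subseteq\Omega\}$, and for $2\le q<\infty$ \[ \lambda_{2,q}(\Omega)=\inf_{u\in C^\infty_0(\Omega)\setminus\{0\}}\frac{\|\nabla u\|_{L^2(\Omega)}^2}{\|u\|_{L^q(\Omega)}^2}. \] Let $(\mathbb{R}^2)^*$ be the one-point compactification of $\mathbb{R}^2$. An open connected set $\Omega\subseteq\mathbb{R}^2$ is multiply connected of order $k$ if its complement in $(\mathbb{R}^2)^*$ has exactly $k$ connected components. *)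

theory Defs
  imports "HOL-Analysis.Analysis"
begin

definition inradius :: "(real ^ 2) set \<Rightarrow> ennreal" where
  "inradius \<Omega> = Sup {ennreal r | r. r > 0 \<and> (\<exists>x\<^sub>0. ball x\<^sub>0 r \<subseteq> \<Omega>)}"

definition gradient :: "(real ^ 2 \<Rightarrow> real) \<Rightarrow> real ^ 2 \<Rightarrow> real ^ 2" where
  "gradient u x = (THE D. GDERIV u x :> D)"

(* C^n on the whole plane: u is differentiable and all its directional derivatives are C^(n-1). *)
primrec C_n :: "nat \<Rightarrow> (real ^ 2 \<Rightarrow> real) \<Rightarrow> bool" where
  "C_n 0 u \<longleftrightarrow> continuous_on UNIV u"
| "C_n (Suc n) u \<longleftrightarrow> (\<forall>x. u differentiable at x) \<and>
     (\<forall>v. C_n n (\<lambda>x. frechet_derivative u (at x) v))"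

(* Functions on Omega are represented by their extension by zero to the plane. *)
definition C0_infinity :: "(real ^ 2) set \<Rightarrow> (real ^ 2 \<Rightarrow> real) set" where
  "C0_infinity \<Omega> = {u. (\<forall>n. C_n n u) \<and>
     compact (closure (support_on UNIV u)) \<and> closure (support_on UNIV u) \<subseteq> \<Omega>}"

(* Used only for functions that are continuous with compact support, where the
   Bochner integral below is not affected by its default value 0. *)
definition Lp_norm :: "real \<Rightarrow> (real ^ 2) set \<Rightarrow> (real ^ 2 \<Rightarrow> 'b::real_normed_vector) \<Rightarrow> real" where
  "Lp_norm p \<Omega> f = (LINT x:\<Omega>|lborel. norm (f x) powr p) powr (1 / p)"

definition lambda_2 :: "real \<Rightarrow> (real ^ 2) set \<Rightarrow> ereal" where
  "lambda_2 q \<Omega> =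
     (INF u\<in>C0_infinity \<Omega> - {\<lambda>x. 0}.
        ereal ((Lp_norm 2 \<Omega> (gradient u))\<^sup>2 / (Lp_norm q \<Omega> u)\<^sup>2))"

(* The complement is taken in the one-point compactification, whose points are Some x for x in
   the plane, and None for the point at infinity. *)
definition multiply_connected :: "nat \<Rightarrow> (real ^ 2) set \<Rightarrow> bool" where
  "multiply_connected k \<Omega> \<longleftrightarrow> open \<Omega> \<and> connected \<Omega> \<and>
     (let X = Alexandroff_compactification (euclidean :: (real ^ 2) topology);
          \<C> = connected_components_of (subtopology X (topspace X - Some ` \<Omega>))
      in finite \<C> \<and> card \<C> = k)"

end

theory Submission
  imports Defs "HOL-Real_Asymp.Real_Asymp"
begin

text \<open>Suppose that the inradius is finite. The finitely many components of the complement that avoid infinity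
  lie in a fixed disk, so every point of the plane has within bounded distance a complement point \<open>p\<close> in the
  component of infinity, and then every circle about \<open>p\<close> meets the complement. Integrating along these
  circles gives a Poincare inequality on disks, and hence on the whole domain.

  The critical exponential is handled by potentials rather than by symmetrization: \<open>|u|\<close> is at most
  \<open>1 / (2 * pi)\<close> times the Riesz potential of \<open>|grad u|\<close>, for which the estimate of O'Neil and the
  one-dimensional lemma of Adams and Garsia give the sharp exponent on sets of measure one. A cut at the level
  above which \<open>u\<close> lives on such a set removes the restriction on the measure. If the inradius is infinite, cones on large
  disks make the integral unbounded.

  For the limit, the exponential bound together with \<open>s\<^sup>p \<le> e (p / e)\<^sup>p (e\<^sup>s - 1)\<close> gives the lower bound,
  and truncated logarithms concentrating at scale \<open>exp (- q / 4)\<close> the upper bound.\<close>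

section \<open>Polar coordinates in the plane\<close>

text \<open>The constant 4 pi leaves no room. The kernel 1 / |x| rearranges to sqrt (pi / r), so for
  unit energy Cauchy-Schwarz bounds the potential at rearranged position t by about sqrt (pi ln (1 /
  t)). The exponential of its square divided by pi is then 1 / t, which just fails to be integrable.
  Hence one must measure by how much equality is missed, and every later loss has to be a bounded
  addition to the exponent. This shapes the Poincare inequality: both sides are truncated at the
  same level, so that the height t of a cut is paid for by the energy below t, which is exactly what
  is missing above it. Truncations are not smooth; estimates for them come from a smooth function
  crossing two levels along a ray or an arc.

  In the limit both bounds have the same optimum. The maximum of s^p exp (- s) is at s = p = q / 2.
  A logarithm of height s and energy about 4 pi s, on a disk of area about exp (- s), has quotient
  about 4 pi exp (2 s / q) / s, smallest at s = q / 2. Both values are 8 pi e / q.\<close>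

definition polar_map :: "real ^ 2 \<Rightarrow> real ^ 2" where
  "polar_map p = (p$1 * cos (p$2)) *\<^sub>R axis 1 1 + (p$1 * sin (p$2)) *\<^sub>R axis 2 1"

definition polar_domain :: "(real ^ 2) set" where
  "polar_domain = {p. 0 < p$1 \<and> 0 < p$2 \<and> p$2 < 2 * pi}"

lemma polar_map_nth [simp]: "polar_map p $ 1 = p$1 * cos (p$2)" "polar_map p $ 2 = p$1 * sin (p$2)"
  by (simp_all add: polar_map_def axis_def)

lemma vec2_eq_iff: "x = y \<longleftrightarrow> x$1 = y$1 \<and> x$2 = (y$2 :: real)" for x y :: "real ^ 2"
  by (simp add: vec_eq_iff forall_2)

lemma polar_map_derivative:
  "(polar_map has_derivative (\<lambda>h. (h$1 * cos (p$2) - p$1 * sin (p$2) * h$2) *\<^sub>R axis 1 1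
      + (h$1 * sin (p$2) + p$1 * cos (p$2) * h$2) *\<^sub>R axis 2 1)) (at p within S)"
proof -
  note [derivative_intros] = bounded_linear.has_derivative[OF bounded_linear_vec_nth]
  show ?thesis
    unfolding polar_map_def
    by (auto intro!: derivative_eq_intros ext simp: algebra_simps)
qed

lemma polar_map_inj: "inj_on polar_map polar_domain"
proof (rule inj_onI)
  fix p q assume p: "p \<in> polar_domain" and q: "q \<in> polar_domain" and eq: "polar_map p = polar_map q"
  have 1: "p$1 * cos (p$2) = q$1 * cos (q$2)" "p$1 * sin (p$2) = q$1 * sin (q$2)"
    using arg_cong[OF eq, of "\<lambda>v. v$1"] arg_cong[OF eq, of "\<lambda>v. v$2"] by simp_all
  have sq: "(r * cos t)^2 + (r * sin t)^2 = r^2" for r t :: real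
    by (simp add: power_mult_distrib flip: distrib_left)
  have "(p$1)^2 = (q$1)^2"
    using sq[of "p$1" "p$2"] sq[of "q$1" "q$2"] 1 by simp
  then have r: "p$1 = q$1" using p q by (simp add: polar_domain_def power2_eq_iff_nonneg)
  then have "sin (p$2) = sin (q$2) \<and> cos (p$2) = cos (q$2)"
    using 1 p by (simp add: polar_domain_def)
  then obtain n :: int where n: "p$2 = q$2 + 2 * pi * n"
    unfolding sin_cos_eq_iff by auto
  have "\<bar>2 * pi * n\<bar> < 2 * pi" using n p q by (auto simp: polar_domain_def)
  then have "n = 0" by (auto simp: abs_mult)
  then show "p = q" using n r by (simp add: vec2_eq_iff)
qed

lemma polar_map_image: "{y. y$2 \<noteq> 0} \<subseteq> polar_map ` polar_domain"
proof
  fix y :: "real ^ 2" assume "y \<in> {y. y$2 \<noteq> 0}"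
  then have y: "y$2 \<noteq> 0" by simp
  define r where "r = sqrt ((y$1)^2 + (y$2)^2)"
  have pos: "(y$1)^2 + (y$2)^2 > 0" using y by (intro add_nonneg_pos) auto
  have r: "r > 0" "r^2 = (y$1)^2 + (y$2)^2" using pos by (auto simp: r_def simp del: sum_power2_gt_zero_iff)
  have "(y$1 / r)^2 + (y$2 / r)^2 = 1"
    using pos unfolding power_divide add_divide_distrib[symmetric] r(2)[symmetric] by simp
  then obtain t where t: "0 \<le> t" "t < 2*pi" "y$1 / r = cos t" "y$2 / r = sin t"
    using sincos_total_2pi by metis
  have "t \<noteq> 0" using t y r by auto
  then have "vector [r, t] \<in> polar_domain" using t r by (simp add: polar_domain_def)
  moreover have "polar_map (vector [r, t]) = y"
    using r by (simp add: vec2_eq_iff flip: t(3,4))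
  ultimately show "y \<in> polar_map ` polar_domain" by (metis image_eqI)
qed

lemma polar_map_measurable [measurable]: "polar_map \<in> borel_measurable borel"
  by (intro borel_measurable_continuous_onI has_derivative_continuous_on[OF polar_map_derivative])

lemma open_polar_domain: "open polar_domain"
  unfolding polar_domain_def
  by (intro open_Collect_conj open_Collect_less continuous_intros)

lemma polar_domain_sets [measurable]: "polar_domain \<in> sets borel"
  using open_polar_domain by simp

lemma norm_polar_map: "p \<in> polar_domain \<Longrightarrow> norm (polar_map p) = p$1"
  by (simp add: norm_vec_def L2_set_def sum_2 polar_domain_def power_mult_distrib flip: distrib_left)

text \<open>Testing on boxes suffices; there the preimage is bounded and the change of variables
  formula for injective differentiable maps applies, with Jacobian determinant r. As an identity of
  measures it serves all nonnegative Borel functions, without integrability conditions.\<close>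

lemma lborel_polar:
  "distr (density lborel (\<lambda>p. ennreal (p$1) * indicator polar_domain p)) borel polar_map = lborel"
proof (rule sym, rule lborel_eqI)
  let ?M = "distr (density lborel (\<lambda>p. ennreal (p$1) * indicator polar_domain p)) borel polar_map"
  fix l u :: "real ^ 2"
  assume "\<And>b. b \<in> Basis \<Longrightarrow> l \<bullet> b \<le> u \<bullet> b"
  then have lu: "(\<Prod>b\<in>Basis. (u - l) \<bullet> b) = measure lborel (box l u)"
    by (simp add: measure_lborel_box)
  define A where "A = polar_domain \<inter> polar_map -` box l u"
  have A [measurable]: "A \<in> sets borel"
    unfolding A_def using measurable_sets[OF polar_map_measurable, of "box l u"] by simp
  obtain K where K: "\<And>y. y \<in> box l u \<Longrightarrow> norm y \<le> K"
    using bounded_box bounded_iff by metis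
  have Abd: "A \<subseteq> {p. p$1 \<in> {0..K} \<and> p$2 \<in> {0..2*pi}}"
    using K by (force simp: A_def polar_domain_def norm_polar_map dest!: norm_polar_map)
  have Afin: "emeasure lborel A < \<infinity>"
  proof -
    have "bounded A"
      by (rule bounded_subset[OF bounded_cbox[of "vector [0,0]" "vector [K,2*pi]"]])
         (use Abd in \<open>auto simp: mem_box_cart forall_2\<close>)
    then show ?thesis using A emeasure_bounded_finite by auto
  qed
  have det: "\<bar>det (matrix (\<lambda>h. (h$1 * cos (p$2) - p$1 * sin (p$2) * h$2) *\<^sub>R axis 1 1
      + (h$1 * sin (p$2) + p$1 * cos (p$2) * h$2) *\<^sub>R (axis 2 1 :: real ^ 2)))\<bar> = p$1"
    if "p \<in> A" for p
  proof -
    have "p$1 * (cos (p$2) * cos (p$2)) + p$1 * (sin (p$2) * sin (p$2)) = p$1"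
      by (simp flip: distrib_left power2_eq_square)
    then show ?thesis using that
      by (simp add: det_2 matrix_def axis_def A_def polar_domain_def power2_eq_square algebra_simps)
  qed
  have int: "set_integrable lborel A (\<lambda>p. p$1)"
    unfolding set_integrable_def
    by (rule integrableI_bounded_set_indicator[where B = K])
       (use Afin Abd in \<open>auto intro!: AE_I2\<close>)
  have int': "(\<lambda>p. p$1) integrable_on A" "integral A (\<lambda>p. p$1) = (LINT p:A|lborel. p$1)"
    using set_borel_integral_eq_integral[OF int] by auto
  have "emeasure (?M) (box l u)
      = emeasure (density lborel (\<lambda>p. ennreal (p$1) * indicator polar_domain p)) (polar_map -` box l u)"
    by (subst emeasure_distr) auto
  also have "\<dots> = (\<integral>\<^sup>+p. ennreal (p$1) * indicator polar_domain p * indicator (polar_map -` box l u) p \<partial>lborel)"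
    using measurable_sets[OF polar_map_measurable, of "box l u"] by (subst emeasure_density) auto
  also have "\<dots> = (\<integral>\<^sup>+p. ennreal (indicator A p *\<^sub>R p$1) \<partial>lborel)"
    by (intro nn_integral_cong) (auto simp: A_def indicator_def)
  also have "\<dots> = ennreal (LINT p:A|lborel. p$1)"
    unfolding set_lebesgue_integral_def
    by (rule nn_integral_eq_integral)
       (use int in \<open>auto simp: set_integrable_def A_def polar_domain_def indicator_def\<close>)
  also have "(LINT p:A|lborel. p$1) = measure lebesgue (polar_map ` A)"
  proof -
    have "measure lebesgue (polar_map ` A) = integral A (\<lambda>p. \<bar>det (matrix (\<lambda>h. (h$1 * cos (p$2) - p$1 * sin (p$2) * h$2) *\<^sub>R axis 1 1
      + (h$1 * sin (p$2) + p$1 * cos (p$2) * h$2) *\<^sub>R (axis 2 1 :: real ^ 2)))\<bar>)"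
      by (rule measure_differentiable_image_eq)
         (use int'(1) in \<open>auto intro!: polar_map_derivative inj_on_subset[OF polar_map_inj]
             simp: A_def[symmetric] det cong: integrable_cong, auto simp: A_def\<close>)
    also have "\<dots> = integral A (\<lambda>p. p$1)"
      by (rule integral_cong) (simp add: det)
    finally show ?thesis using int' by simp
  qed
  also have "measure lebesgue (polar_map ` A) = measure lebesgue (box l u)"
  proof -
    have eq: "polar_map ` A = box l u \<inter> polar_map ` polar_domain" by (auto simp: A_def)
    \<comment> \<open>The open angle interval leaves out only a ray contained in this line.\<close>
    have neg: "negligible {y::real^2. y$2 = 0}"
      using negligible_hyperplane[of "axis 2 1 :: real ^ 2" 0] by (simp add: inner_axis' axis_eq_0_iff)
    show ?thesis
      by (rule measure_negligible_symdiff[symmetric] measure_negligible_symdiff)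
         (use polar_map_image in \<open>auto intro!: negligible_subset[OF neg] simp: eq\<close>)
  qed
  also have "measure lebesgue (box l u) = measure lborel (box l u)" by simp
  finally show "emeasure (?M) (box l u)
      = ennreal (\<Prod>b\<in>Basis. (u - l) \<bullet> b)"
    using lu by simp
qed simp

text \<open>Lebesgue measure on \<open>real ^ 2\<close> is not literally a product; this
  identification lets Tonelli separate radius and angle.\<close>

lemma lborel_vec2:
  "distr (lborel \<Otimes>\<^sub>M lborel) borel (\<lambda>(a, b). a *\<^sub>R axis 1 1 + b *\<^sub>R axis 2 1 :: real ^ 2) = lborel"
proof (rule sym, rule lborel_eqI)
  let ?M = "distr (lborel \<Otimes>\<^sub>M lborel) borel (\<lambda>(a, b). a *\<^sub>R axis 1 1 + b *\<^sub>R axis 2 1 :: real ^ 2)"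
  fix l u :: "real ^ 2"
  assume le: "\<And>b. b \<in> Basis \<Longrightarrow> l \<bullet> b \<le> u \<bullet> b"
  have b: "(Basis :: (real^2) set) = {axis 1 1, axis 2 1}"
    by (auto simp: Basis_vec_def UNIV_2)
  have ne: "axis 1 1 \<noteq> (axis 2 1 :: real^2)" by (simp add: axis_eq_axis)
  have le': "l$1 \<le> u$1" "l$2 \<le> u$2" using le[of "axis 1 1"] le[of "axis 2 1"] by (simp_all add: b inner_axis)
  have "emeasure (?M) (box l u)
     = emeasure (lborel \<Otimes>\<^sub>M lborel) ({l$1<..<u$1} \<times> {l$2<..<u$2} :: (real \<times> real) set)"
    by (subst emeasure_distr)
       (auto intro!: arg_cong2[where f=emeasure] simp: space_pair_measure mem_box_cart forall_2 axis_def)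
  also have "\<dots> = ennreal (u$1 - l$1) * ennreal (u$2 - l$2)"
    using le' by (subst lborel.emeasure_pair_measure_Times) auto
  also have "\<dots> = ennreal (\<Prod>b\<in>Basis. (u - l) \<bullet> b)"
    unfolding b using ne le' by (simp add: inner_axis ennreal_mult)
  finally show "emeasure (?M) (box l u)
     = ennreal (\<Prod>b\<in>Basis. (u - l) \<bullet> b)" .
qed simp

definition cis_vec :: "real \<Rightarrow> real ^ 2" where
  "cis_vec t = cos t *\<^sub>R axis 1 1 + sin t *\<^sub>R axis 2 1"

lemma continuous_cis_vec: "continuous_on S cis_vec"
  unfolding cis_vec_def by (intro continuous_intros)

lemma cis_vec_measurable [measurable]: "cis_vec \<in> borel_measurable borel"
  by (intro borel_measurable_continuous_onI continuous_cis_vec)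

lemma norm_cis_vec [simp]: "norm (cis_vec t) = 1"
  by (simp add: norm_vec_def L2_set_def sum_2 cis_vec_def axis_def)

text \<open>Centred at any \<open>x\<close> by translation invariance. The first order of
  integration, along rays, serves the Riesz potential and the logarithmic test functions; the
  second, over circles, serves the Poincare inequality.\<close>

lemma nn_integral_polar:
  fixes f :: "real ^ 2 \<Rightarrow> ennreal"
  assumes [measurable]: "f \<in> borel_measurable borel"
  shows "(\<integral>\<^sup>+y. f y \<partial>lborel)
    = (\<integral>\<^sup>+t. (\<integral>\<^sup>+r\<in>{0<..}. ennreal r * f (x + r *\<^sub>R cis_vec t) \<partial>lborel) * indicator {0<..<2*pi} t \<partial>lborel)"
    and "(\<integral>\<^sup>+y. f y \<partial>lborel)
    = (\<integral>\<^sup>+r. ennreal r * (\<integral>\<^sup>+t\<in>{0<..<2*pi}. f (x + r *\<^sub>R cis_vec t) \<partial>lborel) * indicator {0<..} r \<partial>lborel)"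
proof -
  let ?v = "\<lambda>(a, b). a *\<^sub>R axis 1 1 + b *\<^sub>R axis 2 1 :: real ^ 2"
  let ?F = "\<lambda>p. ennreal (p$1) * indicator polar_domain p * f (x + polar_map p)"
  have [measurable]: "(\<lambda>p::real^2. p$i) \<in> borel_measurable borel" for i
    by (intro borel_measurable_continuous_onI continuous_intros)
  have "(\<integral>\<^sup>+y. f y \<partial>lborel) = (\<integral>\<^sup>+y. f (x + y) \<partial>lborel)"
    by (subst lborel_distr_plus[symmetric, of x]) (simp add: nn_integral_distr)
  also have "\<dots> = (\<integral>\<^sup>+p. ?F p \<partial>lborel)"
    by (subst lborel_polar[symmetric])
       (simp add: nn_integral_distr nn_integral_density mult.assoc)
  also have "\<dots> = (\<integral>\<^sup>+z. ?F (?v z) \<partial>(lborel \<Otimes>\<^sub>M lborel))"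
    by (subst lborel_vec2[symmetric]) (simp add: nn_integral_distr)
  finally have *: "(\<integral>\<^sup>+y. f y \<partial>lborel) = (\<integral>\<^sup>+z. ?F (?v z) \<partial>(lborel \<Otimes>\<^sub>M lborel))" .
  have F: "?F (?v (r, t)) = ennreal r * f (x + r *\<^sub>R cis_vec t) * indicator {0<..} r * indicator {0<..<2*pi} t" for r t
    by (auto simp: indicator_def polar_domain_def axis_def polar_map_def cis_vec_def algebra_simps)
  have "(\<integral>\<^sup>+z. ?F (?v z) \<partial>(lborel \<Otimes>\<^sub>M lborel)) = (\<integral>\<^sup>+t. \<integral>\<^sup>+r. ?F (?v (r, t)) \<partial>lborel \<partial>lborel)"
    by (subst lborel_pair.nn_integral_snd[symmetric]) auto
  with * show "(\<integral>\<^sup>+y. f y \<partial>lborel)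
    = (\<integral>\<^sup>+t. (\<integral>\<^sup>+r\<in>{0<..}. ennreal r * f (x + r *\<^sub>R cis_vec t) \<partial>lborel) * indicator {0<..<2*pi} t \<partial>lborel)"
    unfolding F by (simp add: nn_integral_multc)
  have "(\<integral>\<^sup>+z. ?F (?v z) \<partial>(lborel \<Otimes>\<^sub>M lborel)) = (\<integral>\<^sup>+r. \<integral>\<^sup>+t. ?F (?v (r, t)) \<partial>lborel \<partial>lborel)"
    by (subst lborel.nn_integral_fst[symmetric]) auto
  with * show "(\<integral>\<^sup>+y. f y \<partial>lborel)
    = (\<integral>\<^sup>+r. ennreal r * (\<integral>\<^sup>+t\<in>{0<..<2*pi}. f (x + r *\<^sub>R cis_vec t) \<partial>lborel) * indicator {0<..} r \<partial>lborel)"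
    unfolding F by (simp add: nn_integral_cmult[symmetric] nn_integral_multc[symmetric] mult_ac)
qed

section \<open>Bounding a function by the Riesz potential of its gradient\<close>

lemma nn_integral_abs_derivative_ge:
  fixes h h' :: "real \<Rightarrow> real"
  assumes "c \<le> d" and der: "\<And>x. (h has_real_derivative h' x) (at x)" and cont: "continuous_on UNIV h'"
  shows "ennreal \<bar>h d - h c\<bar> \<le> (\<integral>\<^sup>+x\<in>{c..d}. ennreal \<bar>h' x\<bar> \<partial>lborel)"
proof -
  have int: "integrable lborel (\<lambda>x. indicator {c..d} x *\<^sub>R h' x)"
    by (rule borel_integrable_compact) (auto intro: continuous_on_subset[OF cont])
  have "h d - h c = (\<integral>x. indicator {c..d} x *\<^sub>R h' x \<partial>lborel)"
  proof (rule integral_FTC_atLeastAtMost[symmetric])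
    show "(h has_vector_derivative h' x) (at x within {c..d})" for x
      using der[of x] by (simp add: has_real_derivative_iff_has_vector_derivative has_vector_derivative_at_within)
  qed (use assms in \<open>auto intro: continuous_on_subset[OF cont]\<close>)
  then have "ennreal \<bar>h d - h c\<bar> = ennreal (norm (\<integral>x. indicator {c..d} x *\<^sub>R h' x \<partial>lborel))" by simp
  also have "\<dots> \<le> (\<integral>\<^sup>+x. norm (indicator {c..d} x *\<^sub>R h' x) \<partial>lborel)"
    by (rule integral_norm_bound_ennreal[OF int])
  also have "\<dots> = (\<integral>\<^sup>+x\<in>{c..d}. ennreal \<bar>h' x\<bar> \<partial>lborel)"
    by (intro nn_integral_cong) (auto simp: indicator_def)
  finally show ?thesis .
qed

text \<open>Replaces the fundamental theorem of calculus for the truncation of |h| between two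
  levels, which need not be differentiable. From the last visit to level \<open>t1\<close> before
  the first visit to level \<open>t2\<close>, the values of |h| lie strictly between, so only this
  part of the derivative is charged.\<close>

lemma level_crossing:
  fixes h h' :: "real \<Rightarrow> real"
  assumes "a \<le> b" and der: "\<And>x. (h has_real_derivative h' x) (at x)" and cont: "continuous_on UNIV h'"
    and t: "t1 < t2" and ha: "\<bar>h a\<bar> \<le> t1" and hb: "t2 \<le> \<bar>h b\<bar>"
  shows "ennreal (t2 - t1) \<le> (\<integral>\<^sup>+x. ennreal \<bar>h' x\<bar> * indicator {x\<in>{a..b}. t1 < \<bar>h x\<bar> \<and> \<bar>h x\<bar> < t2} x \<partial>lborel)"
proof -
  let ?D = "\<lambda>x. indicator {x\<in>{a..b}. t1 < \<bar>h x\<bar> \<and> \<bar>h x\<bar> < t2} x"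
  have hc: "continuous_on S h" for S
    using DERIV_isCont[OF der] by (simp add: continuous_at_imp_continuous_on)
  have "compact ({a..b} \<inter> {x. t2 \<le> \<bar>h x\<bar>})"
    by (intro compact_Int_closed closed_Collect_le continuous_intros hc) auto
  moreover have "{a..b} \<inter> {x. t2 \<le> \<bar>h x\<bar>} \<noteq> {}" using assms by force
  ultimately obtain d where "d \<in> {a..b} \<inter> {x. t2 \<le> \<bar>h x\<bar>}"
    and "\<forall>x\<in>{a..b} \<inter> {x. t2 \<le> \<bar>h x\<bar>}. d \<le> x"
    using compact_attains_inf by blast
  then have d: "d \<in> {a..b}" "t2 \<le> \<bar>h d\<bar>"
    and dmin: "\<And>x. x \<in> {a..b} \<Longrightarrow> t2 \<le> \<bar>h x\<bar> \<Longrightarrow> d \<le> x"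
    by auto
  have "compact ({a..d} \<inter> {x. \<bar>h x\<bar> \<le> t1})"
    by (intro compact_Int_closed closed_Collect_le continuous_intros hc) auto
  moreover have "{a..d} \<inter> {x. \<bar>h x\<bar> \<le> t1} \<noteq> {}" using assms d by force
  ultimately obtain c where "c \<in> {a..d} \<inter> {x. \<bar>h x\<bar> \<le> t1}"
    and "\<forall>x\<in>{a..d} \<inter> {x. \<bar>h x\<bar> \<le> t1}. x \<le> c"
    using compact_attains_sup by blast
  then have c: "c \<in> {a..d}" "\<bar>h c\<bar> \<le> t1"
    and cmax: "\<And>x. x \<in> {a..d} \<Longrightarrow> \<bar>h x\<bar> \<le> t1 \<Longrightarrow> x \<le> c"
    by auto
  have "ennreal (t2 - t1) \<le> ennreal \<bar>h d - h c\<bar>"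
    using c d by (intro ennreal_leI) linarith
  also have "\<dots> \<le> (\<integral>\<^sup>+x\<in>{c..d}. ennreal \<bar>h' x\<bar> \<partial>lborel)"
    using c by (intro nn_integral_abs_derivative_ge der cont) auto
  also have "\<dots> \<le> (\<integral>\<^sup>+x. ennreal \<bar>h' x\<bar> * ?D x \<partial>lborel)"
  proof (rule nn_integral_mono_AE)
    have ind: "x \<in> {a..b} \<and> t1 < \<bar>h x\<bar> \<and> \<bar>h x\<bar> < t2" if "x \<noteq> c" "x \<noteq> d" "x \<in> {c..d}" for x
      using that c d cmax[of x] dmin[of x] by (cases "\<bar>h x\<bar> \<le> t1"; cases "t2 \<le> \<bar>h x\<bar>") simp_all
    show "AE x in lborel. ennreal \<bar>h' x\<bar> * indicator {c..d} x
      \<le> ennreal \<bar>h' x\<bar> * ?D x"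
      using AE_lborel_singleton[of c] AE_lborel_singleton[of d]
      proof eventually_elim
        case (elim x)
        then show ?case using ind[of x] by (cases "x \<in> {c..d}") simp_all
      qed
  qed
  finally show ?thesis .
qed

lemma level_crossing_reverse:
  fixes h h' :: "real \<Rightarrow> real"
  assumes "a \<le> b" and der: "\<And>x. (h has_real_derivative h' x) (at x)" and cont: "continuous_on UNIV h'"
    and t: "t1 < t2" and ha: "\<bar>h b\<bar> \<le> t1" and hb: "t2 \<le> \<bar>h a\<bar>"
  shows "ennreal (t2 - t1) \<le> (\<integral>\<^sup>+x. ennreal \<bar>h' x\<bar> * indicator {x\<in>{a..b}. t1 < \<bar>h x\<bar> \<and> \<bar>h x\<bar> < t2} x \<partial>lborel)"
proof -
  have hc: "continuous_on UNIV h"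
    using DERIV_isCont[OF der] by (simp add: continuous_at_imp_continuous_on)
  have [measurable]: "h \<in> borel_measurable borel" "h' \<in> borel_measurable borel"
    using hc cont by (auto intro: borel_measurable_continuous_onI)
  have "ennreal (t2 - t1) \<le> (\<integral>\<^sup>+x. ennreal \<bar>- h' (- x)\<bar> * indicator {x\<in>{-b..-a}. t1 < \<bar>h (- x)\<bar> \<and> \<bar>h (- x)\<bar> < t2} x \<partial>lborel)"
  proof (rule level_crossing)
    show "((\<lambda>x. h (- x)) has_real_derivative - h' (- x)) (at x)" for x
      using DERIV_mirror[of h "h' (- x)" x] der[of "-x"] by simp
    show "continuous_on UNIV (\<lambda>x. - h' (- x))"
      by (intro continuous_intros continuous_on_compose2[OF cont]) auto
  qed (use assms in auto)
  also have "\<dots> = (\<integral>\<^sup>+x. ennreal \<bar>h' x\<bar> * indicator {x\<in>{a..b}. t1 < \<bar>h x\<bar> \<and> \<bar>h x\<bar> < t2} x \<partial>lborel)"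
    by (subst nn_integral_real_affine[where c = "-1" and t = 0 and f = "\<lambda>x. ennreal \<bar>h' x\<bar> * indicator {x\<in>{a..b}. t1 < \<bar>h x\<bar> \<and> \<bar>h x\<bar> < t2} x"])
       (auto intro!: nn_integral_cong simp: indicator_def)
  finally show ?thesis .
qed

lemma gradient_borel_measurable:
  fixes u :: "real ^ 2 \<Rightarrow> real" and g :: "real ^ 2 \<Rightarrow> real ^ 2"
  assumes der: "\<And>x. (u has_derivative (\<lambda>h. g x \<bullet> h)) (at x)" and cont: "continuous_on UNIV g"
  shows "u \<in> borel_measurable borel" "g \<in> borel_measurable borel"
proof -
  have "continuous_on UNIV u"
    using has_derivative_continuous_on[of UNIV u "\<lambda>x h. g x \<bullet> h"] der by simp
  then show "u \<in> borel_measurable borel" "g \<in> borel_measurable borel"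
    using cont by (auto intro: borel_measurable_continuous_onI)
qed

text \<open>Along every ray from \<open>x\<close> the values of |u| descend from |u x| to 0 and so
  cross all levels between \<open>t\<close> and |u x|. Writing dr as (1 / r) r dr and integrating
  over the angle turns the ray integrals into an integral over the plane. Only the gradient above
  the level \<open>t\<close> enters, which makes the bound usable after a cut.\<close>

lemma riesz_potential_bound:
  fixes u :: "real ^ 2 \<Rightarrow> real" and g :: "real ^ 2 \<Rightarrow> real ^ 2"
  assumes der: "\<And>x. (u has_derivative (\<lambda>h. g x \<bullet> h)) (at x)"
    and cont: "continuous_on UNIV g" and bd: "bounded {x. u x \<noteq> 0}" and t: "0 \<le> t"
  shows "ennreal (2 * pi * (\<bar>u x\<bar> - t))
    \<le> (\<integral>\<^sup>+y. ennreal (norm (g y)) * indicator {y. t < \<bar>u y\<bar>} y * ennreal (1 / norm (y - x)) \<partial>lborel)"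
proof (cases "t < \<bar>u x\<bar>")
  case False
  then have "2 * pi * (\<bar>u x\<bar> - t) \<le> 0" by (simp add: mult_nonneg_nonpos)
  then show ?thesis by (simp add: ennreal_neg)
next
  case True
  note [measurable] = gradient_borel_measurable[OF der cont]
  let ?f = "\<lambda>y. ennreal (norm (g y)) * indicator {y. t < \<bar>u y\<bar>} y * ennreal (1 / norm (y - x))"
  have ray: "ennreal (\<bar>u x\<bar> - t) \<le> (\<integral>\<^sup>+r\<in>{0<..}. ennreal r * ?f (x + r *\<^sub>R cis_vec \<theta>) \<partial>lborel)" for \<theta>
  proof -
    obtain K where K: "\<And>y. u y \<noteq> 0 \<Longrightarrow> norm y \<le> K" using bd by (auto simp: bounded_iff)
    define R where "R = \<bar>K\<bar> + norm x + 1"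
    have "norm (x + R *\<^sub>R cis_vec \<theta>) \<ge> norm (R *\<^sub>R cis_vec \<theta>) - norm x"
      using norm_triangle_ineq2[of "R *\<^sub>R cis_vec \<theta>" "-x"] by (simp add: add.commute)
    then have "norm (x + R *\<^sub>R cis_vec \<theta>) > K" by (simp add: R_def)
    with K[of "x + R *\<^sub>R cis_vec \<theta>"] have uR: "u (x + R *\<^sub>R cis_vec \<theta>) = 0"
      by (meson not_le)
    let ?h = "\<lambda>r. u (x + r *\<^sub>R cis_vec \<theta>)" and ?h' = "\<lambda>r. g (x + r *\<^sub>R cis_vec \<theta>) \<bullet> cis_vec \<theta>"
    have "ennreal (\<bar>u x\<bar> - t) \<le> (\<integral>\<^sup>+r. ennreal \<bar>?h' r\<bar> * indicator {r\<in>{0..R}. t < \<bar>?h r\<bar> \<and> \<bar>?h r\<bar> < \<bar>u x\<bar>} r \<partial>lborel)"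
    proof (rule level_crossing_reverse)
      show "(?h has_real_derivative ?h' r) (at r)" for r
      proof -
        have "((\<lambda>r. x + r *\<^sub>R cis_vec \<theta>) has_derivative (\<lambda>s. s *\<^sub>R cis_vec \<theta>)) (at r)"
          by (auto intro!: derivative_eq_intros)
        from has_derivative_compose[OF this der] show ?thesis
          by (simp add: has_field_derivative_def mult_commute_abs)
      qed
      have "continuous_on UNIV (\<lambda>r. g (x + r *\<^sub>R cis_vec \<theta>))"
        by (rule continuous_on_compose2[OF cont]) (auto intro!: continuous_intros)
      then show "continuous_on UNIV ?h'"
        by (intro continuous_on_inner continuous_on_const)
    qed (use True uR t in \<open>auto simp: R_def\<close>)
    also have "\<dots> \<le> (\<integral>\<^sup>+r\<in>{0<..}. ennreal r * ?f (x + r *\<^sub>R cis_vec \<theta>) \<partial>lborel)"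
    proof (rule nn_integral_mono_AE)
      have *: "ennreal \<bar>?h' r\<bar> * indicator {r\<in>{0..R}. t < \<bar>?h r\<bar> \<and> \<bar>?h r\<bar> < \<bar>u x\<bar>} r
        \<le> ennreal r * ?f (x + r *\<^sub>R cis_vec \<theta>) * indicator {0<..} r" if "r \<noteq> 0" for r
      proof (cases "r > 0 \<and> t < \<bar>?h r\<bar>")
        case True
        have "\<bar>?h' r\<bar> \<le> norm (g (x + r *\<^sub>R cis_vec \<theta>))"
          using Cauchy_Schwarz_ineq2[of "g (x + r *\<^sub>R cis_vec \<theta>)" "cis_vec \<theta>"] by simp
        moreover have "ennreal r * (ennreal c * ennreal (1 / r)) = ennreal c" if "c \<ge> 0" for c
          using True that by (simp flip: ennreal_mult)
        ultimately show ?thesis using True by (auto simp: indicator_def ennreal_leI)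
      qed (use that in \<open>auto simp: indicator_def\<close>)
      show "AE r in lborel. ennreal \<bar>?h' r\<bar> * indicator {r\<in>{0..R}. t < \<bar>?h r\<bar> \<and> \<bar>?h r\<bar> < \<bar>u x\<bar>} r
        \<le> ennreal r * ?f (x + r *\<^sub>R cis_vec \<theta>) * indicator {0<..} r"
        using AE_lborel_singleton[of 0] by eventually_elim (rule *)
    qed
    finally show ?thesis .
  qed
  have "ennreal (2 * pi * (\<bar>u x\<bar> - t)) = (\<integral>\<^sup>+\<theta>\<in>{0<..<2*pi}. ennreal (\<bar>u x\<bar> - t) \<partial>lborel)"
    using True by (subst nn_integral_cmult_indicator) (auto simp: ennreal_mult[symmetric] mult.commute)
  also have "\<dots> \<le> (\<integral>\<^sup>+\<theta>. (\<integral>\<^sup>+r\<in>{0<..}. ennreal r * ?f (x + r *\<^sub>R cis_vec \<theta>) \<partial>lborel) * indicator {0<..<2*pi} \<theta> \<partial>lborel)"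
    by (intro nn_integral_mono mult_right_mono ray) auto
  also have "\<dots> = (\<integral>\<^sup>+y. ?f y \<partial>lborel)"
    by (rule nn_integral_polar(1)[symmetric]) measurable
  finally show ?thesis .
qed

text \<open>Subtracting the constant \<open>1 / R\<close> with \<open>pi * R^2 = |E|\<close> reduces the estimate to the disk of radius \<open>R\<close>.\<close>

lemma nn_integral_riesz_kernel_le:
  fixes E :: "(real ^ 2) set"
  assumes E [measurable]: "E \<in> sets borel" and fin: "emeasure lborel E < \<infinity>"
  shows "(\<integral>\<^sup>+y. indicator E y * ennreal (1 / norm (y - x)) \<partial>lborel) \<le> ennreal (2 * sqrt (pi * measure lborel E))"
proof (cases "measure lborel E = 0")
  case True
  then have "emeasure lborel E = 0" using fin by (simp add: emeasure_eq_ennreal_measure)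
  then have "AE y in lborel. y \<notin> E" using E by (intro AE_not_in) (auto simp: null_sets_def)
  then have "AE y in lborel. indicator E y * ennreal (1 / norm (y - x)) = 0"
    by eventually_elim simp
  then have "(\<integral>\<^sup>+y. indicator E y * ennreal (1 / norm (y - x)) \<partial>lborel) = 0"
    by (subst nn_integral_0_iff_AE) auto
  then show ?thesis by simp
next
  case False
  define m where "m = measure lborel E"
  have m: "m > 0" "emeasure lborel E = ennreal m"
    using False fin by (auto simp: m_def zero_less_measure_iff emeasure_eq_ennreal_measure)
  define R where "R = sqrt (m / pi)"
  have R: "R > 0" "pi * R^2 = m" using m by (auto simp: R_def)
  have sq: "sqrt (pi * m) = pi * R"
    using R by (simp add: power2_eq_square real_sqrt_mult flip: R(2))
  have "(\<integral>\<^sup>+y. indicator E y * ennreal (1 / norm (y - x)) \<partial>lborel)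
    \<le> (\<integral>\<^sup>+y. ennreal (1 / R) * indicator E y + ennreal (1 / norm (y - x) - 1 / R) \<partial>lborel)"
  proof (rule nn_integral_mono)
    fix y
    have "ennreal (1 / norm (y - x)) = ennreal (1 / R + (1 / norm (y - x) - 1 / R))" by simp
    also have "\<dots> \<le> ennreal (1 / R) + ennreal (1 / norm (y - x) - 1 / R)"
      using R by (cases "1 / norm (y - x) - 1 / R \<ge> 0")
        (simp_all add: ennreal_plus[symmetric] ennreal_neg ennreal_leI del: ennreal_plus)
    finally show "indicator E y * ennreal (1 / norm (y - x))
      \<le> ennreal (1 / R) * indicator E y + ennreal (1 / norm (y - x) - 1 / R)"
      by (auto simp: indicator_def)
  qed
  also have "\<dots> = ennreal (1 / R) * ennreal m + (\<integral>\<^sup>+y. ennreal (1 / norm (y - x) - 1 / R) \<partial>lborel)"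
    by (subst nn_integral_add) (auto simp: nn_integral_cmult m)
  also have "(\<integral>\<^sup>+y. ennreal (1 / norm (y - x) - 1 / R) \<partial>lborel) = (\<integral>\<^sup>+\<theta>. (\<integral>\<^sup>+r\<in>{0<..}. ennreal r * ennreal (1 / norm ((x + r *\<^sub>R cis_vec \<theta>) - x) - 1 / R) \<partial>lborel) * indicator {0<..<2*pi} \<theta> \<partial>lborel)"
    by (rule nn_integral_polar(1)) measurable
  also have "\<dots> = (\<integral>\<^sup>+\<theta>\<in>{0<..<2*pi}. ennreal (R / 2) \<partial>lborel)"
  proof -
    have "(\<integral>\<^sup>+r\<in>{0<..}. ennreal r * ennreal (1 / norm ((x + r *\<^sub>R cis_vec \<theta>) - x) - 1 / R) \<partial>lborel)
      = (\<integral>\<^sup>+r\<in>{0..R}. ennreal (1 - r / R) \<partial>lborel)" for \<theta>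
    proof (rule nn_integral_cong_AE)
      have *: "ennreal r * ennreal (1 / norm ((x + r *\<^sub>R cis_vec \<theta>) - x) - 1 / R) * indicator {0<..} r
        = ennreal (1 - r / R) * indicator {0..R} r" if "r \<noteq> 0" for r
      proof (cases "r > 0")
        case True
        have "ennreal r * ennreal (1 / r - 1 / R) = ennreal (1 - r / R)"
          using True by (subst ennreal_mult'[symmetric]) (auto simp: algebra_simps)
        moreover have "1 - r / R \<le> 0" if "\<not> r \<le> R" using that R by simp
        ultimately show ?thesis using True by (auto simp: indicator_def ennreal_neg)
      qed (use that in \<open>auto simp: indicator_def\<close>)
      show "AE r in lborel. ennreal r * ennreal (1 / norm ((x + r *\<^sub>R cis_vec \<theta>) - x) - 1 / R) * indicator {0<..} r
        = ennreal (1 - r / R) * indicator {0..R} r"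
        using AE_lborel_singleton[of 0] by eventually_elim (rule *)
    qed
    also have "(\<integral>\<^sup>+r\<in>{0..R}. ennreal (1 - r / R) \<partial>lborel) = ennreal ((R - R^2 / (2 * R)) - (0 - 0^2 / (2 * R)))"
      by (rule nn_integral_FTC_Icc[where F = "\<lambda>r. r - r^2 / (2 * R)"])
         (use R in \<open>auto intro!: derivative_eq_intros simp: field_simps\<close>)
    also have "(R - R^2 / (2 * R)) - (0 - 0^2 / (2 * R)) = R / 2"
      using R by (simp add: field_simps power2_eq_square)
    finally show ?thesis by simp
  qed
  also have "\<dots> = ennreal (R / 2) * ennreal (2 * pi)"
    by (subst nn_integral_cmult_indicator) auto
  also have "ennreal (1 / R) * ennreal m + ennreal (R / 2) * ennreal (2 * pi) = ennreal (m / R + pi * R)"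
    using R m by (simp add: ennreal_mult[symmetric] ennreal_plus[symmetric] mult.commute del: ennreal_plus)
  also have "m / R + pi * R = 2 * sqrt (pi * m)"
    unfolding sq using R by (simp add: power2_eq_square flip: R(2))
  finally show ?thesis by (simp add: m_def)
qed

section \<open>The one-dimensional lemma of Adams and Garsia\<close>

text \<open>The kernel of O'Neil's inequality without its factor sqrt pi: 1 / |x| has rearrangement
  sqrt (pi / r), whose average over (0, t) is 2 sqrt (pi / t).\<close>

definition adams_kernel :: "real \<Rightarrow> real \<Rightarrow> real" where
  "adams_kernel t r = (if r < t then 2 / sqrt t else 1 / sqrt r)"

lemma adams_kernel_measurable [measurable]:
  "(\<lambda>(t, r). adams_kernel t r) \<in> borel_measurable (borel \<Otimes>\<^sub>M borel)"
  unfolding adams_kernel_def by measurable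

lemma nn_integral_Cauchy_Schwarz_le:
  fixes k \<phi> :: "'a \<Rightarrow> ennreal"
  assumes [measurable]: "k \<in> borel_measurable M" "\<phi> \<in> borel_measurable M"
    and a: "0 \<le> a" and b: "0 \<le> b" and k: "(\<integral>\<^sup>+x. (k x)^2 \<partial>M) \<le> ennreal a" and \<phi>: "(\<integral>\<^sup>+x. (\<phi> x)^2 \<partial>M) \<le> ennreal b"
  shows "(\<integral>\<^sup>+x. k x * \<phi> x \<partial>M) \<le> ennreal (sqrt a * sqrt b)"
proof -
  define X where "X = (\<integral>\<^sup>+x. k x * \<phi> x \<partial>M)"
  have "X^2 \<le> (\<integral>\<^sup>+x. (k x)^2 \<partial>M) * (\<integral>\<^sup>+x. (\<phi> x)^2 \<partial>M)"
    unfolding X_def by (rule Cauchy_Schwarz_nn_integral) fact+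
  also have "\<dots> \<le> ennreal a * ennreal b" using k \<phi> by (rule mult_mono) simp_all
  also have "\<dots> = ennreal (a * b)" using a b by (rule ennreal_mult[symmetric])
  finally have le: "X^2 \<le> ennreal (a * b)" .
  have "X \<le> ennreal (sqrt (a * b))"
  proof (cases X)
    case (real r)
    have "ennreal (r^2) \<le> ennreal (a * b)" using le ennreal_power[OF real(1), of 2] unfolding real(2) by metis
    then have "r^2 \<le> a * b" using a b by (subst (asm) ennreal_le_iff) simp_all
    then have "r \<le> sqrt (a * b)" by (rule real_le_rsqrt)
    then show ?thesis unfolding real by (rule ennreal_leI)
  next
    case top
    then show ?thesis using le by (simp add: top_unique)
  qed
  then show ?thesis by (simp add: X_def real_sqrt_mult)
qed

text \<open>To be read with \<open>s\<close> = ln (1 / t), \<open>L\<close>^2 the energy on (0, t),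
  \<open>f\<close> the potential at t and \<open>l\<close> a bound for its defect. Cauchy-Schwarz in
  the plane gives f^2 \<le> 4 + s, and the Lagrange identity gives the loss: a small defect forces
  (L, sqrt (1 - L^2)) to be nearly parallel to (2, sqrt s), so \<open>L\<close> is at most of order
  1 / sqrt s.\<close>

lemma garsia_energy_bound:
  fixes L s f l :: real
  assumes L: "0 \<le> L" "L \<le> 1" and s: "0 \<le> s" and f: "0 \<le> f" "f \<le> 2 * L + sqrt s * sqrt (1 - L^2)"
    and l: "s - f^2 \<le> l"
  shows "- 4 \<le> l" "s * L^2 \<le> 4 * (l + 8)"
proof -
  define x c where "x = sqrt s" and "c = sqrt (1 - L^2)"
  have x: "0 \<le> x" "x^2 = s" using s by (auto simp: x_def)
  have "L^2 \<le> 1" using L by (simp add: power_le_one)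
  then have c: "0 \<le> c" "c^2 = 1 - L^2" "c \<le> 1" by (auto simp: c_def)
  have f2: "f^2 \<le> (2 * L + x * c)^2" using f by (intro power_mono) (auto simp: x_def c_def)
  have "(2 * L + x * c)^2 + (2 * c - x * L)^2 = (4 + x^2) * (L^2 + c^2)"
    by (simp add: power2_eq_square algebra_simps)
  then have eq: "(2 * L + x * c)^2 + (2 * c - x * L)^2 = 4 + s" using c x by simp
  then have "(2 * L + x * c)^2 \<le> 4 + s"
    using zero_le_power2[of "2 * c - x * L"] by linarith
  with f2 l show l4: "- 4 \<le> l" by linarith
  have "(2 * c - x * L)^2 \<le> 4 + l" using eq f2 l by linarith
  then have "\<bar>2 * c - x * L\<bar> \<le> sqrt (4 + l)" by (simp add: real_le_rsqrt)
  then have "x * L \<le> 2 + sqrt (4 + l)" using c by linarith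
  then have "(x * L)^2 \<le> (2 + sqrt (4 + l))^2" using x L by (intro power_mono) auto
  also have "\<dots> \<le> 2 * 2^2 + 2 * (sqrt (4 + l))^2"
    using sum_squares_bound[of 2 "sqrt (4 + l)"] by (simp add: power2_sum)
  also have "\<dots> \<le> 4 * (l + 8)" using l4 by simp
  finally show "s * L^2 \<le> 4 * (l + 8)" using x by (simp add: power_mult_distrib)
qed

text \<open>Here \<open>s0\<close> and \<open>s\<close> are the logarithmic positions of two points
  of small defect, and \<open>L\<close>^2 is the energy below the outer one, already at most 4 A /
  s0. The stretch from \<open>s0\<close> to \<open>s\<close> therefore adds too little to f^2: the
  cross term is only linear in sqrt (s - s0), and the square takes at most half of s - s0 up to a
  constant.\<close>

lemma garsia_gap_bound:
  fixes s s0 f A L Lt :: real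
  assumes A: "4 \<le> A" and s: "s0 \<le> s" "16 * A \<le> s0" and L: "0 \<le> Lt" "Lt \<le> L" "s0 * L^2 \<le> 4 * A"
    and f: "0 \<le> f" "f \<le> 2 * Lt + sqrt (s - s0) * L + sqrt s0" and l: "s - f^2 \<le> A - 8"
  shows "s - s0 \<le> 84 * A"
proof -
  define d y where "d = sqrt (s - s0)" and "y = sqrt s0"
  have d: "0 \<le> d" "d^2 = s - s0" using s by (auto simp: d_def)
  have y: "0 < y" "y^2 = s0" using s A by (auto simp: y_def)
  define a where "a = sqrt A"
  have a: "2 \<le> a" "a^2 = A" using A by (auto simp: a_def real_le_rsqrt)
  have "(y * L)^2 \<le> (2 * a)^2" using L y a by (simp add: power_mult_distrib)
  then have yL: "y * L \<le> 2 * a" by (rule power2_le_imp_le) (use a in auto)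
  have "(4 * a)^2 \<le> y^2" using s y a by (simp add: power_mult_distrib)
  then have y4: "4 * a \<le> y" by (rule power2_le_imp_le) (use y in auto)
  define b where "b = (d + 2) * L"
  have L0: "0 \<le> L" using L by simp
  have b0: "0 \<le> b" using d L0 by (simp add: b_def)
  have "f \<le> b + y" using f L by (simp add: b_def d_def y_def algebra_simps)
  then have "f^2 \<le> (b + y)^2" using f by (intro power_mono) auto
  also have "\<dots> = y^2 + 2 * (y * b) + b^2" by (simp add: power2_sum algebra_simps)
  finally have f2: "f^2 \<le> s0 + 2 * (y * b) + b^2" using y by simp
  have yb: "y * b \<le> (d + 2) * (2 * a)"
    using mult_left_mono[OF yL, of "d + 2"] d by (simp add: b_def algebra_simps)
  have "4 * a * b \<le> y * b" using y4 b0 by (rule mult_right_mono)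
  with yb have "4 * a * b \<le> (d + 2) * (2 * a)" by linarith
  then have "a * (2 * b) \<le> a * (d + 2)" by (simp add: algebra_simps)
  then have "2 * b \<le> d + 2" using a by simp
  then have "b \<le> d / 2 + 1" by simp
  then have "b^2 \<le> (d / 2 + 1)^2" using b0 by (rule power_mono)
  also have "\<dots> \<le> d^2 / 2 + 2"
    using zero_le_power2[of "d / 2 - 1"] by (simp add: power2_eq_square algebra_simps)
  finally have b2: "b^2 \<le> d^2 / 2 + 2" .
  have "d^2 \<le> A - 8 + 2 * ((d + 2) * (2 * a)) + (d^2 / 2 + 2)"
    using l f2 yb b2 d by linarith
  then have "d^2 / 2 \<le> A + 4 * (d * a) + 8 * a" by (simp add: algebra_simps)
  moreover have "4 * (d * a) \<le> d^2 / 4 + 16 * a^2"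
    using zero_le_power2[of "d / 2 - 4 * a"] by (simp add: power2_eq_square algebra_simps)
  moreover have "2 * a \<le> a^2" using a(1) by (simp add: power2_eq_square)
  \<comment> \<open>The sum A + 16 a^2 + 8 a is at most 21 A, because 8 a \<le> 4 a^2 = 4 A.\<close>
  ultimately have "d^2 / 4 \<le> 21 * A" using a by linarith
  then show ?thesis using d by simp
qed

section \<open>Potentials on the unit interval with energy at most one\<close>

definition adams_potential :: "(real \<Rightarrow> ennreal) \<Rightarrow> real \<Rightarrow> ennreal" where
  "adams_potential \<phi> t = (\<integral>\<^sup>+r\<in>{0<..<1}. ennreal (adams_kernel t r) * \<phi> r \<partial>lborel)"

definition partial_energy :: "(real \<Rightarrow> ennreal) \<Rightarrow> real \<Rightarrow> real" where
  "partial_energy \<phi> t = enn2real (\<integral>\<^sup>+r\<in>{0<..<t}. (\<phi> r)^2 \<partial>lborel)"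

text \<open>The exponential of the squared potential is exp (- defect) / t, so the defect is all
  that separates the integrand from the non-integrable 1 / t.\<close>

definition garsia_defect :: "(real \<Rightarrow> ennreal) \<Rightarrow> real \<Rightarrow> real" where
  "garsia_defect \<phi> t = ln (1 / t) - (enn2real (adams_potential \<phi> t))^2"

context
  fixes \<phi> :: "real \<Rightarrow> ennreal"
  assumes \<phi>_measurable [measurable]: "\<phi> \<in> borel_measurable borel"
    and \<phi>_energy: "(\<integral>\<^sup>+r\<in>{0<..<1}. (\<phi> r)^2 \<partial>lborel) \<le> 1"
begin

lemma adams_potential_measurable [measurable]: "adams_potential \<phi> \<in> borel_measurable borel"
  unfolding adams_potential_def by measurable

lemma partial_energy:
  assumes "t \<le> 1"
  shows "(\<integral>\<^sup>+r\<in>{0<..<t}. (\<phi> r)^2 \<partial>lborel) = ennreal (partial_energy \<phi> t)"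
    and "0 \<le> partial_energy \<phi> t" "partial_energy \<phi> t \<le> 1"
proof -
  let ?I = "\<lambda>t. \<integral>\<^sup>+r. (\<phi> r)^2 * indicator {0<..<t} r \<partial>lborel"
  have "(?I t) \<le> (\<integral>\<^sup>+r\<in>{0<..<1}. (\<phi> r)^2 \<partial>lborel)"
    by (intro nn_integral_mono) (use assms in \<open>auto simp: indicator_def\<close>)
  also note \<phi>_energy
  finally have le: "(?I t) \<le> 1" .
  then show eq: "(?I t) = ennreal (partial_energy \<phi> t)"
    using le_less_trans[OF le, of \<infinity>] unfolding partial_energy_def by simp
  show "0 \<le> partial_energy \<phi> t" by (simp add: partial_energy_def)
  then show "partial_energy \<phi> t \<le> 1" using le eq by simp
qed

lemma partial_energy_mono: "s \<le> t \<Longrightarrow> t \<le> 1 \<Longrightarrow> partial_energy \<phi> s \<le> partial_energy \<phi> t"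
proof -
  assume st: "s \<le> t" "t \<le> 1"
  have "(\<integral>\<^sup>+r\<in>{0<..<s}. (\<phi> r)^2 \<partial>lborel) \<le> (\<integral>\<^sup>+r\<in>{0<..<t}. (\<phi> r)^2 \<partial>lborel)"
    by (intro nn_integral_mono) (use st in \<open>auto simp: indicator_def\<close>)
  then show ?thesis using st partial_energy[of s] partial_energy[of t] by simp
qed

lemma partial_energy_diff:
  assumes "0 < s" "s \<le> t" "t \<le> 1"
  shows "(\<integral>\<^sup>+r\<in>{s..<t}. (\<phi> r)^2 \<partial>lborel) = ennreal (partial_energy \<phi> t - partial_energy \<phi> s)"
proof -
  have "ennreal (partial_energy \<phi> t) = (\<integral>\<^sup>+r. (\<phi> r)^2 * indicator {0<..<s} r + (\<phi> r)^2 * indicator {s..<t} r \<partial>lborel)"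
    using assms by (subst partial_energy(1)[symmetric]) (auto intro!: nn_integral_cong simp: indicator_def)
  also have "\<dots> = ennreal (partial_energy \<phi> s) + (\<integral>\<^sup>+r\<in>{s..<t}. (\<phi> r)^2 \<partial>lborel)"
    using assms by (subst nn_integral_add) (auto simp: partial_energy(1))
  finally have eq: "ennreal (partial_energy \<phi> t) = ennreal (partial_energy \<phi> s) + (\<integral>\<^sup>+r\<in>{s..<t}. (\<phi> r)^2 \<partial>lborel)" .
  then have "(\<integral>\<^sup>+r\<in>{s..<t}. (\<phi> r)^2 \<partial>lborel) = ennreal (partial_energy \<phi> t) - ennreal (partial_energy \<phi> s)"
    by simp
  also have "\<dots> = ennreal (partial_energy \<phi> t - partial_energy \<phi> s)"
    using assms partial_energy(2)[of s] by (simp add: ennreal_minus)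
  finally show ?thesis .
qed

lemma nn_integral_inverse:
  fixes a b :: real
  assumes "0 < a" "a \<le> b"
  shows "(\<integral>\<^sup>+r\<in>{a..b}. ennreal (1 / r) \<partial>lborel) = ennreal (ln (b / a))"
proof -
  have "(\<integral>\<^sup>+r\<in>{a..b}. ennreal (1 / r) \<partial>lborel) = ennreal (ln b - ln a)"
    by (rule nn_integral_FTC_Icc) (use assms in \<open>auto intro!: derivative_eq_intros\<close>)
  then show ?thesis using assms by (simp add: ln_div)
qed

lemma outer_potential_le:
  assumes "0 < s" "s \<le> t" "t \<le> 1"
  shows "(\<integral>\<^sup>+r\<in>{s..<t}. ennreal (1 / sqrt r) * \<phi> r \<partial>lborel)
    \<le> ennreal (sqrt (ln (t / s)) * sqrt (partial_energy \<phi> t - partial_energy \<phi> s))"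
proof -
  have "(\<integral>\<^sup>+r. (ennreal (1 / sqrt r) * indicator {s..<t} r) * (\<phi> r * indicator {s..<t} r) \<partial>lborel)
    \<le> ennreal (sqrt (ln (t / s)) * sqrt (partial_energy \<phi> t - partial_energy \<phi> s))"
  proof (rule nn_integral_Cauchy_Schwarz_le)
    have "(\<integral>\<^sup>+r. (ennreal (1 / sqrt r) * indicator {s..<t} r)^2 \<partial>lborel) \<le> (\<integral>\<^sup>+r\<in>{s..t}. ennreal (1 / r) \<partial>lborel)"
      using assms by (intro nn_integral_mono) (auto simp: indicator_def ennreal_power power_divide)
    then show "(\<integral>\<^sup>+r. (ennreal (1 / sqrt r) * indicator {s..<t} r)^2 \<partial>lborel) \<le> ennreal (ln (t / s))"
      using assms by (simp add: nn_integral_inverse)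
    have "(\<integral>\<^sup>+r. (\<phi> r * indicator {s..<t} r)^2 \<partial>lborel) = (\<integral>\<^sup>+r\<in>{s..<t}. (\<phi> r)^2 \<partial>lborel)"
      by (intro nn_integral_cong) (auto simp: indicator_def)
    then show "(\<integral>\<^sup>+r. (\<phi> r * indicator {s..<t} r)^2 \<partial>lborel) \<le> ennreal (partial_energy \<phi> t - partial_energy \<phi> s)"
      using partial_energy_diff[OF assms] by simp
  qed (use assms partial_energy_mono in auto)
  then show ?thesis by (auto elim!: order_trans[rotated] intro!: nn_integral_mono simp: indicator_def)
qed

lemma inner_potential_le:
  assumes "0 < t" "t \<le> 1"
  shows "(\<integral>\<^sup>+r\<in>{0<..<t}. ennreal (2 / sqrt t) * \<phi> r \<partial>lborel) \<le> ennreal (2 * sqrt (partial_energy \<phi> t))"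
proof -
  have "(\<integral>\<^sup>+r. (ennreal (2 / sqrt t) * indicator {0<..<t} r) * (\<phi> r * indicator {0<..<t} r) \<partial>lborel)
    \<le> ennreal (sqrt 4 * sqrt (partial_energy \<phi> t))"
  proof (rule nn_integral_Cauchy_Schwarz_le)
    have "(\<integral>\<^sup>+r. (ennreal (2 / sqrt t) * indicator {0<..<t} r)^2 \<partial>lborel) = (\<integral>\<^sup>+r\<in>{0<..<t}. ennreal (4 / t) \<partial>lborel)"
      using assms by (intro nn_integral_cong) (auto simp: indicator_def ennreal_power power_divide)
    also have "\<dots> = ennreal (4 / t) * ennreal t" using assms by (subst nn_integral_cmult_indicator) auto
    also have "\<dots> = ennreal 4" using assms by (subst ennreal_mult[symmetric]) auto
    finally show "(\<integral>\<^sup>+r. (ennreal (2 / sqrt t) * indicator {0<..<t} r)^2 \<partial>lborel) \<le> ennreal 4" by simp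
    have "(\<integral>\<^sup>+r. (\<phi> r * indicator {0<..<t} r)^2 \<partial>lborel) = (\<integral>\<^sup>+r\<in>{0<..<t}. (\<phi> r)^2 \<partial>lborel)"
      by (intro nn_integral_cong) (auto simp: indicator_def)
    then show "(\<integral>\<^sup>+r. (\<phi> r * indicator {0<..<t} r)^2 \<partial>lborel) \<le> ennreal (partial_energy \<phi> t)"
      using partial_energy(1)[OF assms(2)] by simp
  qed (use partial_energy[OF assms(2)] in auto)
  then show ?thesis by (auto elim!: order_trans[rotated] intro!: nn_integral_mono simp: indicator_def)
qed

lemma adams_potential_split:
  assumes "0 < t" "t \<le> s" "s \<le> 1"
  shows "adams_potential \<phi> t = (\<integral>\<^sup>+r\<in>{0<..<t}. ennreal (2 / sqrt t) * \<phi> r \<partial>lborel)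
    + (\<integral>\<^sup>+r\<in>{t..<s}. ennreal (1 / sqrt r) * \<phi> r \<partial>lborel)
    + (\<integral>\<^sup>+r\<in>{s..<1}. ennreal (1 / sqrt r) * \<phi> r \<partial>lborel)"
proof -
  have "adams_potential \<phi> t = (\<integral>\<^sup>+r. ennreal (2 / sqrt t) * \<phi> r * indicator {0<..<t} r
    + (ennreal (1 / sqrt r) * \<phi> r * indicator {t..<s} r + ennreal (1 / sqrt r) * \<phi> r * indicator {s..<1} r) \<partial>lborel)"
    unfolding adams_potential_def
    by (intro nn_integral_cong) (use assms in \<open>auto simp: indicator_def adams_kernel_def\<close>)
  then show ?thesis by (simp add: nn_integral_add add.assoc)
qed

text \<open>Cauchy-Schwarz separately on (0, t), [t, s) and [s, 1), where the squared kernel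
  integrates to 4, ln (s / t) and ln (1 / s). The case \<open>s\<close> = \<open>t\<close> feeds the
  energy bound, the case of two points the gap bound.\<close>

lemma adams_potential_le:
  assumes "0 < t" "t \<le> s" "s \<le> 1"
  shows "adams_potential \<phi> t \<le> ennreal (2 * sqrt (partial_energy \<phi> t) + sqrt (ln (s / t)) * sqrt (partial_energy \<phi> s - partial_energy \<phi> t)
    + sqrt (ln (1 / s)) * sqrt (1 - partial_energy \<phi> s))"
proof -
  note E = partial_energy_mono[of t s] partial_energy(2,3)[of t] partial_energy(2,3)[of s] partial_energy(2,3)[of 1]
  have "adams_potential \<phi> t \<le> ennreal (2 * sqrt (partial_energy \<phi> t)) + ennreal (sqrt (ln (s / t)) * sqrt (partial_energy \<phi> s - partial_energy \<phi> t))
    + ennreal (sqrt (ln (1 / s)) * sqrt (partial_energy \<phi> 1 - partial_energy \<phi> s))"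
    unfolding adams_potential_split[OF assms]
    by (intro add_mono inner_potential_le outer_potential_le) (use assms in auto)
  also have "\<dots> = ennreal (2 * sqrt (partial_energy \<phi> t) + sqrt (ln (s / t)) * sqrt (partial_energy \<phi> s - partial_energy \<phi> t)
    + sqrt (ln (1 / s)) * sqrt (partial_energy \<phi> 1 - partial_energy \<phi> s))"
    using assms E partial_energy_mono[of s 1] by (simp add: ennreal_plus[symmetric] del: ennreal_plus)
  also have "\<dots> \<le> ennreal (2 * sqrt (partial_energy \<phi> t) + sqrt (ln (s / t)) * sqrt (partial_energy \<phi> s - partial_energy \<phi> t)
    + sqrt (ln (1 / s)) * sqrt (1 - partial_energy \<phi> s))"
    using assms E by (intro ennreal_leI add_left_mono mult_left_mono) auto
  finally show ?thesis .
qed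

lemma adams_potential_finite: "0 < t \<Longrightarrow> t \<le> 1 \<Longrightarrow> adams_potential \<phi> t < \<infinity>"
  using adams_potential_le[of t t] by (simp add: le_less_trans)

lemma garsia_defect_energy:
  assumes t: "0 < t" "t < 1" and l: "garsia_defect \<phi> t \<le> l"
  shows "- 4 \<le> l" "ln (1 / t) * partial_energy \<phi> t \<le> 4 * (l + 8)"
proof -
  note E = partial_energy(2,3)[of t]
  have "enn2real (adams_potential \<phi> t) \<le> 2 * sqrt (partial_energy \<phi> t) + sqrt (ln (1 / t)) * sqrt (1 - (sqrt (partial_energy \<phi> t))^2)"
    using adams_potential_le[of t t] E t by (intro enn2real_leI) auto
  from garsia_energy_bound[OF _ _ _ _ this, of l] show "- 4 \<le> l" "ln (1 / t) * partial_energy \<phi> t \<le> 4 * (l + 8)"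
    using E t l by (auto simp: garsia_defect_def)
qed

lemma garsia_defect_gap:
  assumes t: "0 < t" "t \<le> s" "s < 1" and l: "garsia_defect \<phi> t \<le> l" "garsia_defect \<phi> s \<le> l"
    and far: "16 * (l + 8) \<le> ln (1 / s)"
  shows "ln (s / t) \<le> 84 * (l + 8)"
proof -
  note E = partial_energy_mono[of t s] partial_energy(2,3)[of t] partial_energy(2,3)[of s]
  have l4: "- 4 \<le> l" and en: "ln (1 / s) * partial_energy \<phi> s \<le> 4 * (l + 8)"
    using garsia_defect_energy[of s l] t l by auto
  have eq: "ln (1 / t) - ln (1 / s) = ln (s / t)" using t by (simp add: ln_div)
  have "enn2real (adams_potential \<phi> t) \<le> 2 * sqrt (partial_energy \<phi> t) + sqrt (ln (s / t)) * sqrt (partial_energy \<phi> s - partial_energy \<phi> t)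
    + sqrt (ln (1 / s)) * sqrt (1 - partial_energy \<phi> s)"
    using adams_potential_le[of t s] t E by (intro enn2real_leI) auto
  also have "\<dots> \<le> 2 * sqrt (partial_energy \<phi> t) + sqrt (ln (s / t)) * sqrt (partial_energy \<phi> s) + sqrt (ln (1 / s)) * 1"
    using t E by (intro add_mono mult_left_mono) auto
  finally have "enn2real (adams_potential \<phi> t) \<le> 2 * sqrt (partial_energy \<phi> t) + sqrt (ln (1 / t) - ln (1 / s)) * sqrt (partial_energy \<phi> s) + sqrt (ln (1 / s))"
    using eq by simp
  moreover have "ln (1 / s) \<le> ln (1 / t)" using t by (simp add: ln_div)
  ultimately have "ln (1 / t) - ln (1 / s) \<le> 84 * (l + 8)"
    using l4 t E en l(1) far by (intro garsia_gap_bound) (simp_all add: garsia_defect_def)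
  then show ?thesis using eq by simp
qed

text \<open>The measure dt / t is length on the scale ln (1 / t). Put A = l + 8. Points with ln (1 /
  t) \<le> 16 A fill a length of at most 16 A. Any two deeper points are within 84 A of each other
  by \<open>garsia_defect_gap\<close>, so all of them lie in one window of length 168 A about any
  one of them. Together this is 184 A. The defect never drops below -4, whence the
  indicator.\<close>

lemma garsia_sublevel:
  shows "(\<integral>\<^sup>+t\<in>{t. 0 < t \<and> t < 1 \<and> garsia_defect \<phi> t \<le> l}. ennreal (1 / t) \<partial>lborel)
    \<le> ennreal (184 * (l + 8) * indicator {-4..} l)"
proof (cases "l < -4")
  case True
  have "{t. 0 < t \<and> t < 1 \<and> garsia_defect \<phi> t \<le> l} = {}"
    using garsia_defect_energy(1)[of _ l] True by force
  then show ?thesis by simp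
next
  case False
  define A where "A = l + 8"
  have A: "4 \<le> A" using False by (simp add: A_def)
  define S where "S = {t. 0 < t \<and> t < 1 \<and> garsia_defect \<phi> t \<le> l}"
  define a where "a = exp (- 16 * A)"
  have a: "0 < a" "a \<le> 1" "ln (1 / a) = 16 * A" using A by (auto simp: a_def ln_div)
  obtain c d where cd: "0 < c" "c \<le> d" "ln (d / c) \<le> 168 * A" and Ssub: "S \<subseteq> {a..1} \<union> {c..d}"
  proof (cases "S \<inter> {..<a} = {}")
    case True
    then have "S \<subseteq> {a..1} \<union> {1..1}" by (force simp: S_def)
    then show ?thesis using that[of 1 1] A by simp
  next
    case False
    then obtain b where b: "b \<in> S" "b < a" by auto
    have b0: "0 < b" using b by (auto simp: S_def)
    let ?b = "b * exp (- 84 * A)"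
    let ?d = "b * exp (84 * A)"
    have far: "16 * (l + 8) \<le> ln (1 / t)" if "0 < t" "t < a" for t
      using that a ln_less_cancel_iff[of t a] by (simp add: A_def ln_div del: ln_less_cancel_iff)
    have "S \<subseteq> {a..1} \<union> {?b..?d}"
    proof
      fix t assume t: "t \<in> S"
      then have t0: "0 < t" by (simp add: S_def)
      show "t \<in> {a..1} \<union> {?b..?d}"
      proof (cases "t < a")
        case True
        have "\<bar>ln t - ln b\<bar> \<le> 84 * A"
        proof (cases "t \<le> b")
          case True
          then have "ln (b / t) \<le> 84 * (l + 8)"
            using t b t0 far[of b] b0 by (intro garsia_defect_gap) (auto simp: S_def)
          then show ?thesis using True t0 b0 by (simp add: ln_div A_def)
        next
          case False
          then have "ln (t / b) \<le> 84 * (l + 8)"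
            using t b t0 far[of t] \<open>t < a\<close> b0 by (intro garsia_defect_gap) (auto simp: S_def)
          then show ?thesis using False t0 b0 by (simp add: ln_div A_def)
        qed
        then have "ln (?b) \<le> ln t" "ln t \<le> ln (?d)"
          using b0 by (auto simp: ln_mult)
        then show ?thesis using t0 b0 by simp
      qed (use t in \<open>auto simp: S_def\<close>)
    qed
    moreover have "ln (?d / (?b)) \<le> 168 * A"
      using b0 by (simp add: ln_div ln_mult)
    ultimately show ?thesis using b0 A by (intro that[of "?b" "?d"]) auto
  qed
  have "(\<integral>\<^sup>+t\<in>S. ennreal (1 / t) \<partial>lborel)
    \<le> (\<integral>\<^sup>+t. ennreal (1 / t) * indicator {a..1} t + ennreal (1 / t) * indicator {c..d} t \<partial>lborel)"
    using Ssub by (intro nn_integral_mono) (auto simp: indicator_def)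
  also have "\<dots> = ennreal (ln (1 / a)) + ennreal (ln (d / c))"
    using a cd by (subst nn_integral_add) (auto simp: nn_integral_inverse)
  also have "\<dots> \<le> ennreal (16 * A) + ennreal (168 * A)"
    using a cd by (intro add_mono ennreal_leI) auto
  also have "\<dots> = ennreal (184 * A)" using A by (simp add: ennreal_plus[symmetric] del: ennreal_plus)
  finally show ?thesis using False by (simp add: S_def A_def)
qed

text \<open>Layer cake over the levels l of the defect: the weight exp (- l) beats the linear growth
  of the sublevel sets in the measure dt / t. The constant is the integral of 184 (l + 8) exp (- l)
  over l \<ge> -4.\<close>

lemma nn_integral_exp_adams_potential:
  "(\<integral>\<^sup>+t\<in>{0<..<1}. ennreal (exp ((enn2real (adams_potential \<phi> t))^2)) \<partial>lborel) \<le> ennreal (184 * 5 * exp 4)"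
proof -
  let ?S = "\<lambda>l. indicator {t. 0 < t \<and> t < 1 \<and> garsia_defect \<phi> t \<le> l}"
  let ?Y = "\<lambda>t. ennreal (exp ((enn2real (adams_potential \<phi> t))^2))"
  have [measurable]: "garsia_defect \<phi> \<in> borel_measurable borel"
    unfolding garsia_defect_def by measurable
  have e: "ennreal (exp (- x)) = (\<integral>\<^sup>+l\<in>{x..}. ennreal (exp (- l)) \<partial>lborel)" for x :: real
  proof -
    have lim: "((\<lambda>l::real. - exp (- l)) \<longlongrightarrow> - 0) at_top"
      by (intro tendsto_minus filterlim_compose[OF exp_at_bot] filterlim_uminus_at_bot_at_top)
    show ?thesis
      by (subst nn_integral_FTC_atLeast[OF _ _ _ lim]) (auto intro!: derivative_eq_intros)
  qed
  have "(\<integral>\<^sup>+t\<in>{0<..<1}. ?Y t \<partial>lborel)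
    = (\<integral>\<^sup>+t. (\<integral>\<^sup>+l. ennreal (exp (- l)) * (ennreal (1 / t) * ?S l t) \<partial>lborel) \<partial>lborel)"
  proof (rule nn_integral_cong)
    fix t :: real
    show "?Y t * indicator {0<..<1} t
      = (\<integral>\<^sup>+l. ennreal (exp (- l)) * (ennreal (1 / t) * ?S l t) \<partial>lborel)"
    proof (cases "0 < t \<and> t < 1")
      case True
      have "exp ((enn2real (adams_potential \<phi> t))^2) = exp (- garsia_defect \<phi> t) * (1 / t)"
        using True by (simp add: garsia_defect_def exp_diff exp_minus)
      then have "?Y t = ennreal (exp (- garsia_defect \<phi> t)) * ennreal (1 / t)"
        using True by (subst ennreal_mult[symmetric]) auto
      also have "\<dots> = (\<integral>\<^sup>+l. ennreal (exp (- l)) * indicator {garsia_defect \<phi> t..} l * ennreal (1 / t) \<partial>lborel)"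
        by (subst e) (rule nn_integral_multc[symmetric], measurable)
      also have "\<dots> = (\<integral>\<^sup>+l. ennreal (exp (- l)) * (ennreal (1 / t) * ?S l t) \<partial>lborel)"
        using True by (intro nn_integral_cong) (auto simp: indicator_def)
      finally show ?thesis using True by simp
    next
      case False
      then have "indicator {0<..<1} t = (0 :: ennreal)"
        and "?S l t = (0 :: ennreal)" for l
        by (auto simp: indicator_def)
      then show ?thesis by simp
    qed
  qed
  also have "\<dots> = (\<integral>\<^sup>+l. (\<integral>\<^sup>+t. ennreal (exp (- l)) * (ennreal (1 / t) * ?S l t) \<partial>lborel) \<partial>lborel)"
    by (rule lborel_pair.Fubini') measurable
  also have "\<dots> = (\<integral>\<^sup>+l. ennreal (exp (- l)) * (\<integral>\<^sup>+t. ennreal (1 / t) * ?S l t \<partial>lborel) \<partial>lborel)"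
    by (intro nn_integral_cong nn_integral_cmult) measurable
  also have "\<dots> \<le> (\<integral>\<^sup>+l. ennreal (exp (- l)) * ennreal (184 * (l + 8) * indicator {-4..} l) \<partial>lborel)"
    by (intro nn_integral_mono mult_left_mono garsia_sublevel) auto
  also have "\<dots> = (\<integral>\<^sup>+l\<in>{-4..}. ennreal (184 * (l + 8) * exp (- l)) \<partial>lborel)"
    by (intro nn_integral_cong) (auto simp: indicator_def ennreal_mult[symmetric] mult_ac)
  also have "\<dots> = ennreal (184 * 5 * exp 4)"
  proof -
    have "(\<integral>\<^sup>+l\<in>{-4..}. ennreal (184 * (l + 8) * exp (- l)) \<partial>lborel)
      = ennreal (0 - (- 184 * (- 4 + 9) * exp (- (- 4))))"
    proof (rule nn_integral_FTC_atLeast)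
    show "((\<lambda>l. - 184 * (l + 9) * exp (- l)) has_real_derivative 184 * (l + 8) * exp (- l)) (at l)" for l :: real
      by (auto intro!: derivative_eq_intros simp: algebra_simps)
    show "((\<lambda>l::real. - 184 * (l + 9) * exp (- l)) \<longlongrightarrow> 0) at_top" by real_asymp
    show "0 \<le> 184 * (l + 8) * exp (- l)" if "- 4 \<le> l" for l :: real using that by simp
    qed measurable
    then show ?thesis by simp
  qed
  finally show ?thesis .
qed

end

section \<open>Rearrangements and Adams' inequality\<close>

lemma layer_cake:
  fixes z :: "'a::euclidean_space \<Rightarrow> real"
  assumes [measurable]: "z \<in> borel_measurable borel" "S \<in> sets borel" and nonneg: "\<And>x. 0 \<le> z x"
  shows "(\<integral>\<^sup>+x\<in>S. ennreal (z x) \<partial>lborel)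
      = (\<integral>\<^sup>+c. indicator {0..} c * emeasure lborel {x\<in>S. c \<le> z x} \<partial>lborel)"
proof -
  have "(\<integral>\<^sup>+x\<in>S. ennreal (z x) \<partial>lborel)
    = (\<integral>\<^sup>+x. \<integral>\<^sup>+c. indicator {0..} c * indicator {x\<in>S. c \<le> z x} x \<partial>lborel \<partial>lborel)"
  proof (rule nn_integral_cong)
    fix x
    have "(\<integral>\<^sup>+c. indicator {0..} c * indicator {x\<in>S. c \<le> z x} x \<partial>lborel) = (\<integral>\<^sup>+c\<in>{0..z x}. indicator S x \<partial>lborel)"
      by (rule nn_integral_cong) (simp add: indicator_def)
    also have "\<dots> = indicator S x * ennreal (z x)"
      using nonneg[of x] by (subst nn_integral_cmult_indicator) auto
    finally show "ennreal (z x) * indicator S x = (\<integral>\<^sup>+c. indicator {0..} c * indicator {x\<in>S. c \<le> z x} x \<partial>lborel)"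
      by (simp add: mult.commute)
  qed
  also have "\<dots> = (\<integral>\<^sup>+c. \<integral>\<^sup>+x. indicator {0..} c * indicator {x\<in>S. c \<le> z x} x \<partial>lborel \<partial>lborel)"
    by (rule lborel_pair.Fubini') measurable
  also have "\<dots> = (\<integral>\<^sup>+c. indicator {0..} c * emeasure lborel {x\<in>S. c \<le> z x} \<partial>lborel)"
    by (intro nn_integral_cong) (subst nn_integral_cmult, auto)
  finally show "(\<integral>\<^sup>+x\<in>S. ennreal (z x) \<partial>lborel)
      = (\<integral>\<^sup>+c. indicator {0..} c * emeasure lborel {x\<in>S. c \<le> z x} \<partial>lborel)" .
qed

definition distribution_function :: "(real ^ 2 \<Rightarrow> real) \<Rightarrow> real \<Rightarrow> ennreal" where
  "distribution_function f l = emeasure lborel {y. l < f y}"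

text \<open>The distribution function decreases, so the measure of this set of levels agrees with
  the usual infimum of levels. As an integral it can be handled by Tonelli alone.\<close>

definition decreasing_rearrangement :: "(real ^ 2 \<Rightarrow> real) \<Rightarrow> real \<Rightarrow> ennreal" where
  "decreasing_rearrangement f r = (\<integral>\<^sup>+l. indicator {l. 0 \<le> l \<and> ennreal r < distribution_function f l} l \<partial>lborel)"

text \<open>Times sqrt pi, this will bound the mean of the Riesz potential of \<open>f\<close> over
  a set of measure t. Each layer {f > l} contributes the better of two estimates, according to
  whether the kernel is integrated over the layer or over the set.\<close>

definition rearrangement_bound :: "(real ^ 2 \<Rightarrow> real) \<Rightarrow> real \<Rightarrow> ennreal" where
  "rearrangement_bound f t = (\<integral>\<^sup>+l. indicator {0..} l *
     ennreal (2 * min (enn2real (distribution_function f l) / sqrt t) (sqrt (enn2real (distribution_function f l)))) \<partial>lborel)"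

context
  fixes f :: "real ^ 2 \<Rightarrow> real"
  assumes f_measurable [measurable]: "f \<in> borel_measurable borel" and f_nonneg: "\<And>x. 0 \<le> f x"
begin

lemma distribution_function_measurable [measurable]: "distribution_function f \<in> borel_measurable borel"
proof -
  have "distribution_function f = (\<lambda>l. \<integral>\<^sup>+y. indicator {y. l < f y} y \<partial>lborel)"
    by (auto simp: distribution_function_def fun_eq_iff)
  also have "\<dots> \<in> borel_measurable borel" by measurable
  finally show ?thesis .
qed

lemma decreasing_rearrangement_measurable [measurable]: "decreasing_rearrangement f \<in> borel_measurable borel"
  unfolding decreasing_rearrangement_def by measurable

text \<open>Both squares are double integrals over pairs of nonnegative levels. Superlevel sets are
  nested, so a pair l, l' enters only through the measure at max l l', on both sides. The cut r < 1
  leaves an inequality.\<close>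

lemma rearrangement_energy_le:
  "(\<integral>\<^sup>+r\<in>{0<..<1}. (decreasing_rearrangement f r)^2 \<partial>lborel) \<le> (\<integral>\<^sup>+y. ennreal ((f y)^2) \<partial>lborel)"
proof -
  define W where "W l r = (indicator {l. 0 \<le> l \<and> ennreal r < distribution_function f l} l :: ennreal)" for l r
  have [measurable]: "(\<lambda>(l, r). W l r) \<in> borel_measurable (borel \<Otimes>\<^sub>M borel)"
    unfolding W_def by measurable
  define V where "V l y = (indicator {l. 0 \<le> l \<and> l < f y} l :: ennreal)" for l y
  have [measurable]: "(\<lambda>(l, y). V l y) \<in> borel_measurable (borel \<Otimes>\<^sub>M borel)"
    unfolding V_def by measurable
  let ?P = "\<lambda>l l' r. W l r * W l' r * indicator {0<..<1} r"
  let ?Q = "\<lambda>l l' y. V l y * V l' y"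
  have sq: "(\<integral>\<^sup>+l. a l \<partial>lborel)^2 = (\<integral>\<^sup>+l. \<integral>\<^sup>+l'. a l * a l' \<partial>lborel \<partial>lborel)"
    if [measurable]: "a \<in> borel_measurable borel" for a :: "real \<Rightarrow> ennreal"
    by (simp add: nn_integral_cmult nn_integral_multc power2_eq_square)
  have Vint: "(\<integral>\<^sup>+l. V l y \<partial>lborel) = ennreal (f y)" for y
  proof -
    have "{l. 0 \<le> l \<and> l < f y} = {0..<f y}" by auto
    then show ?thesis using f_nonneg[of y] by (simp add: V_def)
  qed
  have swap: "(\<integral>\<^sup>+r\<in>{0<..<1}. W l r * W l' r \<partial>lborel) \<le> (\<integral>\<^sup>+y. ?Q l l' y \<partial>lborel)" for l l'
  proof (cases "0 \<le> l \<and> 0 \<le> l'")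
    case True
    define N where "N = distribution_function f (max l l')"
    have N: "N = distribution_function f l \<or> N = distribution_function f l'"
      by (simp add: N_def max_def)
    have "(\<integral>\<^sup>+r\<in>{0<..<1}. W l r * W l' r \<partial>lborel) \<le> (\<integral>\<^sup>+r. indicator {r. 0 < r \<and> ennreal r < N} r \<partial>lborel)"
      using N by (intro nn_integral_mono) (auto simp: W_def indicator_def)
    also have "\<dots> = emeasure lborel {r. 0 < r \<and> ennreal r < N}"
      by (subst nn_integral_indicator) auto
    also have "\<dots> \<le> N"
    proof (cases N)
      case (real n)
      then have "{r. 0 < r \<and> ennreal r < N} = {0<..<n}" by (auto simp: ennreal_less_iff)
      then show ?thesis using real by simp
    qed simp
    also have "N = (\<integral>\<^sup>+y. indicator {y. max l l' < f y} y \<partial>lborel)"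
      by (simp add: N_def distribution_function_def)
    also have "\<dots> = (\<integral>\<^sup>+y. ?Q l l' y \<partial>lborel)"
      using True by (intro nn_integral_cong) (auto simp: V_def indicator_def)
    finally show ?thesis .
  next
    case False
    then have "(\<integral>\<^sup>+r\<in>{0<..<1}. W l r * W l' r \<partial>lborel) = (\<integral>\<^sup>+(r::real). 0 \<partial>lborel)"
      by (intro nn_integral_cong) (auto simp: W_def)
    then show ?thesis by simp
  qed
  have "(\<integral>\<^sup>+r\<in>{0<..<1}. (decreasing_rearrangement f r)^2 \<partial>lborel)
    = (\<integral>\<^sup>+r. \<integral>\<^sup>+l. \<integral>\<^sup>+l'. ?P l l' r \<partial>lborel \<partial>lborel \<partial>lborel)"
    by (simp add: decreasing_rearrangement_def sq W_def[symmetric] nn_integral_multc)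
  also have "\<dots> = (\<integral>\<^sup>+l. \<integral>\<^sup>+r. \<integral>\<^sup>+l'. ?P l l' r \<partial>lborel \<partial>lborel \<partial>lborel)"
    by (rule lborel_pair.Fubini') measurable
  also have "\<dots> = (\<integral>\<^sup>+l. \<integral>\<^sup>+l'. \<integral>\<^sup>+r. ?P l l' r \<partial>lborel \<partial>lborel \<partial>lborel)"
    by (intro nn_integral_cong lborel_pair.Fubini') measurable
  also have "\<dots> \<le> (\<integral>\<^sup>+l. \<integral>\<^sup>+l'. \<integral>\<^sup>+y. ?Q l l' y \<partial>lborel \<partial>lborel \<partial>lborel)"
    by (intro nn_integral_mono swap)
  also have "\<dots> = (\<integral>\<^sup>+l. \<integral>\<^sup>+y. \<integral>\<^sup>+l'. ?Q l l' y \<partial>lborel \<partial>lborel \<partial>lborel)"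
    by (intro nn_integral_cong lborel_pair.Fubini') measurable
  also have "\<dots> = (\<integral>\<^sup>+y. \<integral>\<^sup>+l. \<integral>\<^sup>+l'. ?Q l l' y \<partial>lborel \<partial>lborel \<partial>lborel)"
    by (rule lborel_pair.Fubini') measurable
  also have "\<dots> = (\<integral>\<^sup>+y. ennreal ((f y)^2) \<partial>lborel)"
  proof (rule nn_integral_cong)
    fix y
    have "(\<integral>\<^sup>+l. \<integral>\<^sup>+l'. ?Q l l' y \<partial>lborel \<partial>lborel) = (ennreal (f y))^2"
      by (subst sq[symmetric]) (simp_all add: Vint)
    also have "\<dots> = ennreal ((f y)^2)" by (rule ennreal_power[OF f_nonneg])
    finally show "(\<integral>\<^sup>+l. \<integral>\<^sup>+l'. ?Q l l' y \<partial>lborel \<partial>lborel) = ennreal ((f y)^2)" .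
  qed
  finally show ?thesis .
qed

text \<open>Over (0, n) the kernel integrates to 2 n / sqrt t as long as n \<le> t, and beyond that
  to 2 sqrt t + (2 sqrt n - 2 sqrt t). These are the two entries of the minimum in
  \<open>rearrangement_bound\<close>.\<close>

lemma nn_integral_adams_kernel_ge:
  assumes "0 < t" "0 \<le> n"
  shows "ennreal (2 * min (n / sqrt t) (sqrt n)) \<le> (\<integral>\<^sup>+r\<in>{0<..<n}. ennreal (adams_kernel t r) \<partial>lborel)"
proof (cases "n \<le> t")
  case True
  have "(\<integral>\<^sup>+r\<in>{0<..<n}. ennreal (adams_kernel t r) \<partial>lborel) = (\<integral>\<^sup>+r\<in>{0<..<n}. ennreal (2 / sqrt t) \<partial>lborel)"
    using True by (intro nn_integral_cong) (auto simp: indicator_def adams_kernel_def)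
  also have "\<dots> = ennreal (2 * (n / sqrt t))"
    using assms by (subst nn_integral_cmult_indicator) (auto simp: ennreal_mult[symmetric])
  finally show ?thesis by (auto intro!: ennreal_leI)
next
  case False
  have "(\<integral>\<^sup>+r\<in>{t..n}. ennreal (1 / sqrt r) \<partial>lborel) = ennreal (2 * sqrt n - 2 * sqrt t)"
    by (rule nn_integral_FTC_Icc) (use assms False in \<open>auto intro!: derivative_eq_intros simp: field_simps\<close>)
  moreover have "(\<integral>\<^sup>+r\<in>{0<..<t}. ennreal (2 / sqrt t) \<partial>lborel) = ennreal (2 * sqrt t)"
    using assms by (subst nn_integral_cmult_indicator) (auto simp: ennreal_mult[symmetric] real_div_sqrt simp flip: times_divide_eq_right)
  ultimately have "ennreal (2 * sqrt n) = (\<integral>\<^sup>+r\<in>{0<..<t}. ennreal (2 / sqrt t) \<partial>lborel)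
      + (\<integral>\<^sup>+r\<in>{t..n}. ennreal (1 / sqrt r) \<partial>lborel)"
    using assms False by (simp add: ennreal_plus[symmetric] del: ennreal_plus)
  also have "\<dots> = (\<integral>\<^sup>+r. ennreal (2 / sqrt t) * indicator {0<..<t} r + ennreal (1 / sqrt r) * indicator {t..n} r \<partial>lborel)"
    by (rule nn_integral_add[symmetric]) measurable
  also have "\<dots> = (\<integral>\<^sup>+r\<in>{0<..<n}. ennreal (adams_kernel t r) \<partial>lborel)"
  proof (rule nn_integral_cong_AE)
    have *: "ennreal (2 / sqrt t) * indicator {0<..<t} r + ennreal (1 / sqrt r) * indicator {t..n} r
      = ennreal (adams_kernel t r) * indicator {0<..<n} r" if "r \<noteq> n" for r
      using that False assms by (cases "r < t") (auto simp: adams_kernel_def indicator_def)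
    show "AE r in lborel. ennreal (2 / sqrt t) * indicator {0<..<t} r + ennreal (1 / sqrt r) * indicator {t..n} r
      = ennreal (adams_kernel t r) * indicator {0<..<n} r"
      using AE_lborel_singleton[of n] by eventually_elim (rule *)
  qed
  finally have eq: "ennreal (2 * sqrt n) = (\<integral>\<^sup>+r\<in>{0<..<n}. ennreal (adams_kernel t r) \<partial>lborel)" .
  show ?thesis unfolding eq[symmetric] by (intro ennreal_leI) simp
qed

context
  assumes f_dist: "\<And>l. 0 \<le> l \<Longrightarrow> distribution_function f l \<le> 1"
begin

lemma rearrangement_bound_antimono:
  "0 < s \<Longrightarrow> s \<le> t \<Longrightarrow> rearrangement_bound f t \<le> rearrangement_bound f s"
  unfolding rearrangement_bound_def
  by (intro nn_integral_mono mult_left_mono ennreal_leI min.mono divide_left_mono) auto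

text \<open>Tonelli in the level l and the position r. Since the distribution function is at most 1,
  restricting r to (0, 1) loses nothing.\<close>

lemma rearrangement_bound_le:
  assumes t: "0 < t"
  shows "rearrangement_bound f t \<le> adams_potential (decreasing_rearrangement f) t"
proof -
  let ?W = "\<lambda>l r. ennreal (adams_kernel t r) * indicator {l. 0 \<le> l \<and> ennreal r < distribution_function f l} l
     * indicator {0<..<1} r"
  let ?W' = "\<lambda>l r. ennreal (adams_kernel t r) * indicator {l. 0 \<le> l \<and> ennreal r < distribution_function f l} l
         * indicator {0<..<1} r"
  let ?D = "{(l, r). 0 \<le> l \<and> ennreal r < distribution_function f l}"
  have "rearrangement_bound f t \<le> (\<integral>\<^sup>+l. \<integral>\<^sup>+r. ?W l r \<partial>lborel \<partial>lborel)"
    unfolding rearrangement_bound_def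
  proof (rule nn_integral_mono)
    fix l
    show "indicator {0..} l * ennreal (2 * min (enn2real (distribution_function f l) / sqrt t) (sqrt (enn2real (distribution_function f l))))
      \<le> (\<integral>\<^sup>+r. ?W l r \<partial>lborel)"
    proof (cases "0 \<le> l")
      case True
      define n where "n = enn2real (distribution_function f l)"
      have n: "distribution_function f l = ennreal n" "0 \<le> n"
        using le_less_trans[OF f_dist[OF True], of \<infinity>] by (auto simp: n_def)
      then have n1: "n \<le> 1" using f_dist[OF True] by simp
      have "ennreal (2 * min (n / sqrt t) (sqrt n)) \<le> (\<integral>\<^sup>+r\<in>{0<..<n}. ennreal (adams_kernel t r) \<partial>lborel)"
        by (rule nn_integral_adams_kernel_ge) (use t n in auto)
      also have "\<dots> \<le> (\<integral>\<^sup>+r. ?W' l r \<partial>lborel)"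
        using True n n1 by (intro nn_integral_mono) (auto simp: indicator_def ennreal_less_iff)
      finally show ?thesis using True by (simp add: n_def)
    qed simp
  qed
  also have "\<dots> = (\<integral>\<^sup>+r. \<integral>\<^sup>+l. ?W l r \<partial>lborel \<partial>lborel)"
    by (rule lborel_pair.Fubini') measurable
  also have "\<dots> = (\<integral>\<^sup>+r\<in>{0<..<1}. ennreal (adams_kernel t r) * decreasing_rearrangement f r \<partial>lborel)"
    unfolding decreasing_rearrangement_def
    by (intro nn_integral_cong) (subst nn_integral_multc, simp, subst nn_integral_cmult, simp_all)
  finally show ?thesis by (simp add: adams_potential_def)
qed

text \<open>The bathtub principle for the Riesz kernel, applied to the layers \<open>{f > l}\<close> and to \<open>E\<close> in turn.\<close>

lemma nn_integral_riesz_potential_le: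
  fixes E :: "(real ^ 2) set"
  assumes E [measurable]: "E \<in> sets borel" and t: "emeasure lborel E = ennreal t" "0 < t"
  shows "(\<integral>\<^sup>+x. indicator E x * (\<integral>\<^sup>+y. ennreal (f y) * ennreal (1 / norm (y - x)) \<partial>lborel) \<partial>lborel)
    \<le> ennreal (sqrt pi * t) * rearrangement_bound f t"
proof -
  let ?m = "\<lambda>l. ennreal (2 * min (enn2real (distribution_function f l) / sqrt t) (sqrt (enn2real (distribution_function f l))))"
  let ?k = "\<lambda>x y :: real ^ 2. ennreal (1 / norm (y - x))"
  have fy: "ennreal (f y) = (\<integral>\<^sup>+l. indicator {0..} l * indicator {y. l < f y} y \<partial>lborel)" for y
  proof -
    have "(\<integral>\<^sup>+l. indicator {0..} l * indicator {y. l < f y} y \<partial>lborel) = (\<integral>\<^sup>+l. indicator {0..<f y} l \<partial>lborel)"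
      by (intro nn_integral_cong) (auto simp: indicator_def)
    then show ?thesis using f_nonneg[of y] by simp
  qed
  have "(\<integral>\<^sup>+x. indicator E x * (\<integral>\<^sup>+y. ennreal (f y) * ?k x y \<partial>lborel) \<partial>lborel)
    = (\<integral>\<^sup>+x. \<integral>\<^sup>+y. \<integral>\<^sup>+l. indicator {0..} l * (indicator E x * (indicator {y. l < f y} y * ?k x y)) \<partial>lborel \<partial>lborel \<partial>lborel)"
    unfolding fy by (simp add: nn_integral_cmult[symmetric] nn_integral_multc[symmetric] mult_ac)
  also have "\<dots> = (\<integral>\<^sup>+x. \<integral>\<^sup>+l. \<integral>\<^sup>+y. indicator {0..} l * (indicator E x * (indicator {y. l < f y} y * ?k x y)) \<partial>lborel \<partial>lborel \<partial>lborel)"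
    by (intro nn_integral_cong lborel_pair.Fubini') measurable
  also have "\<dots> = (\<integral>\<^sup>+l. \<integral>\<^sup>+x. \<integral>\<^sup>+y. indicator {0..} l * (indicator E x * (indicator {y. l < f y} y * ?k x y)) \<partial>lborel \<partial>lborel \<partial>lborel)"
    by (rule lborel_pair.Fubini') measurable
  also have "\<dots> \<le> (\<integral>\<^sup>+l. ennreal (sqrt pi * t) * (indicator {0..} l *
     ?m l) \<partial>lborel)"
  proof (rule nn_integral_mono)
    fix l
    show "(\<integral>\<^sup>+x. \<integral>\<^sup>+y. indicator {0..} l * (indicator E x * (indicator {y. l < f y} y * ?k x y)) \<partial>lborel \<partial>lborel)
      \<le> ennreal (sqrt pi * t) * (indicator {0..} l *
     ?m l)"
    proof (cases "0 \<le> l")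
      case True
      define F where "F = {y. l < f y}"
      have [measurable]: "F \<in> sets borel" unfolding F_def by measurable
      define n where "n = enn2real (distribution_function f l)"
      have n: "emeasure lborel F = ennreal n" "0 \<le> n"
        using le_less_trans[OF f_dist[OF True], of \<infinity>] by (auto simp: n_def F_def distribution_function_def)
      have mt: "measure lborel E = t" "measure lborel F = n"
        using t n by (auto simp: measure_def)
      have 1: "(\<integral>\<^sup>+x. \<integral>\<^sup>+y. indicator E x * (indicator F y * ?k x y) \<partial>lborel \<partial>lborel) \<le> ennreal (2 * sqrt (pi * n)) * ennreal t"
      proof -
        have "(\<integral>\<^sup>+x. \<integral>\<^sup>+y. indicator E x * (indicator F y * ?k x y) \<partial>lborel \<partial>lborel)
          = (\<integral>\<^sup>+x. indicator E x * (\<integral>\<^sup>+y. indicator F y * ?k x y \<partial>lborel) \<partial>lborel)"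
          by (simp add: nn_integral_cmult)
        also have "\<dots> \<le> (\<integral>\<^sup>+x. indicator E x * ennreal (2 * sqrt (pi * n)) \<partial>lborel)"
          using nn_integral_riesz_kernel_le[of F] n mt by (intro nn_integral_mono mult_left_mono) auto
        also have "\<dots> = ennreal (2 * sqrt (pi * n)) * ennreal t"
          using t by (subst mult.commute, subst nn_integral_cmult_indicator) auto
        finally show ?thesis .
      qed
      have 2: "(\<integral>\<^sup>+x. \<integral>\<^sup>+y. indicator E x * (indicator F y * ?k x y) \<partial>lborel \<partial>lborel) \<le> ennreal (2 * sqrt (pi * t)) * ennreal n"
      proof -
        have "(\<integral>\<^sup>+x. \<integral>\<^sup>+y. indicator E x * (indicator F y * ?k x y) \<partial>lborel \<partial>lborel)
          = (\<integral>\<^sup>+y. \<integral>\<^sup>+x. indicator E x * (indicator F y * ?k x y) \<partial>lborel \<partial>lborel)"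
          by (rule lborel_pair.Fubini') measurable
        also have "\<dots> = (\<integral>\<^sup>+y. indicator F y * (\<integral>\<^sup>+x. indicator E x * ennreal (1 / norm (x - y)) \<partial>lborel) \<partial>lborel)"
          by (simp add: nn_integral_cmult[symmetric] mult_ac norm_minus_commute)
        also have "\<dots> \<le> (\<integral>\<^sup>+y. indicator F y * ennreal (2 * sqrt (pi * t)) \<partial>lborel)"
          using nn_integral_riesz_kernel_le[of E] t mt by (intro nn_integral_mono mult_left_mono) auto
        also have "\<dots> = ennreal (2 * sqrt (pi * t)) * ennreal n"
          using n by (subst mult.commute, subst nn_integral_cmult_indicator) auto
        finally show ?thesis .
      qed
      have eq1: "2 * sqrt (pi * t) * n = 2 * sqrt pi * t * (n / sqrt t)"
      proof -
        have "t * (n / sqrt t) = (t / sqrt t) * n" by simp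
        also have "t / sqrt t = sqrt t" by (rule real_div_sqrt) (use t in simp)
        finally show ?thesis by (simp only: real_sqrt_mult mult.assoc)
      qed
      have eq2: "2 * sqrt (pi * n) * t = 2 * sqrt pi * t * sqrt n"
        by (simp add: real_sqrt_mult)
      have "min (2 * sqrt (pi * n) * t) (2 * sqrt (pi * t) * n) = sqrt pi * t * (2 * min (n / sqrt t) (sqrt n))"
        using t unfolding eq1 eq2 by (simp add: min_mult_distrib_left min.commute mult_ac)
      moreover have "(\<integral>\<^sup>+x. \<integral>\<^sup>+y. indicator E x * (indicator F y * ?k x y) \<partial>lborel \<partial>lborel)
        \<le> ennreal (min (2 * sqrt (pi * n) * t) (2 * sqrt (pi * t) * n))"
        using 1 2 t n by (auto simp: min_def ennreal_mult)
      ultimately show ?thesis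
        using True t n by (simp add: F_def n_def ennreal_mult[symmetric])
    qed simp
  qed
  also have "\<dots> = ennreal (sqrt pi * t) * rearrangement_bound f t"
    unfolding rearrangement_bound_def by (rule nn_integral_cmult) measurable
  finally show ?thesis .
qed

text \<open>Compares superlevel sets. Let E be the part of \<open>A\<close> where the exponential is
  at least c, and t its measure. The lower bound for \<open>w\<close> on E is at most the mean of
  the Riesz potential over E, hence at most sqrt pi times \<open>rearrangement_bound f t\<close>,
  hence at most sqrt pi times the one-dimensional potential at each s < t. So (0, t) lies in the
  one-dimensional superlevel set, and integrating over c reduces the claim to the unit
  interval.\<close>

lemma adams_inequality:
  fixes w :: "real ^ 2 \<Rightarrow> real" and A :: "(real ^ 2) set"
  assumes energy: "(\<integral>\<^sup>+y. ennreal ((f y)^2) \<partial>lborel) \<le> 1"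
    and [measurable]: "w \<in> borel_measurable borel" "A \<in> sets borel" and A: "emeasure lborel A \<le> 1"
    and w: "\<And>x. 0 \<le> w x" "\<And>x. ennreal (w x) \<le> (\<integral>\<^sup>+y. ennreal (f y) * ennreal (1 / norm (y - x)) \<partial>lborel)"
  shows "(\<integral>\<^sup>+x\<in>A. ennreal (exp ((w x)^2 / pi)) \<partial>lborel) \<le> ennreal (184 * 5 * exp 4)"
proof -
  let ?h = "\<lambda>x. \<integral>\<^sup>+y. ennreal (f y) * ennreal (1 / norm (y - x)) \<partial>lborel"
  let ?P = "adams_potential (decreasing_rearrangement f)"
  have e: "(\<integral>\<^sup>+r\<in>{0<..<1}. (decreasing_rearrangement f r)^2 \<partial>lborel) \<le> 1"
    using rearrangement_energy_le energy by (rule order_trans)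
  note P_meas [measurable] = adams_potential_measurable[OF decreasing_rearrangement_measurable e]
  note P_fin = adams_potential_finite[OF decreasing_rearrangement_measurable e]
  define Z where "Z x = exp ((w x)^2 / pi)" for x
  define Y where "Y t = exp ((enn2real (?P t))^2)" for t
  have [measurable]: "Z \<in> borel_measurable borel" "Y \<in> borel_measurable borel"
    unfolding Z_def Y_def by measurable
  have cmp: "emeasure lborel {x\<in>A. c \<le> Z x} \<le> emeasure lborel {t\<in>{0<..<1}. c \<le> Y t}" if c: "0 \<le> c" for c
  proof (cases "c < 1")
    case True
    \<comment> \<open>For levels below 1 the one-dimensional superlevel set is all of (0, 1), whose
      measure 1 is at least that of \<open>A\<close>.\<close>
    have "1 \<le> Y t" for t by (simp add: Y_def)
    then have "c \<le> Y t" for t using True order.strict_implies_order order.strict_trans2 by blast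
    then have "{t\<in>{0<..<1}. c \<le> Y t} = {0<..<1}" by auto
    moreover have "emeasure lborel {x\<in>A. c \<le> Z x} \<le> emeasure lborel A" by (rule emeasure_mono) auto
    ultimately show ?thesis using A by simp
  next
    case False
    define E where "E = {x\<in>A. c \<le> Z x}"
    have [measurable]: "E \<in> sets borel" unfolding E_def by measurable
    have "emeasure lborel E \<le> emeasure lborel A" by (rule emeasure_mono) (auto simp: E_def)
    then have E1: "emeasure lborel E \<le> 1" using A by (rule order_trans)
    then obtain t where t: "emeasure lborel E = ennreal t" "0 \<le> t" "t \<le> 1"
      by (cases "emeasure lborel E") (auto simp: top_unique)
    \<comment> \<open>The value of \<open>w\<close> at which the exponential reaches
      \<open>c\<close>.\<close>
    define a where "a = sqrt (pi * ln c)"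
    have a: "0 \<le> a" "a^2 = pi * ln c" using False by (auto simp: a_def)
    have wE: "a \<le> w x" if "x \<in> E" for x
    proof -
      have "c \<le> exp ((w x)^2 / pi)" using that by (simp add: E_def Z_def)
      then have "ln c \<le> ln (exp ((w x)^2 / pi))" using False by (subst ln_le_cancel_iff) auto
      then have "a^2 \<le> (w x)^2" unfolding ln_exp using a by (simp add: field_simps)
      then show ?thesis using w(1) by (rule power2_le_imp_le)
    qed
    show ?thesis
    proof (cases "t = 0")
      case True
      then show ?thesis using t by (simp add: E_def)
    next
      case False
      then have t0: "0 < t" using t by simp
      have "ennreal a * ennreal t = (\<integral>\<^sup>+x. indicator E x * ennreal a \<partial>lborel)"
        by (subst mult.commute[of "indicator E _"], subst nn_integral_cmult_indicator) (auto simp: t)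
      also have "\<dots> \<le> (\<integral>\<^sup>+x. indicator E x * (?h x) \<partial>lborel)"
      proof (rule nn_integral_mono)
        fix x
        have "ennreal a \<le> (?h x)" if "x \<in> E"
          using order_trans[OF ennreal_leI[OF wE[OF that]] w(2)] .
        then show "indicator E x * ennreal a \<le> indicator E x * (?h x)"
          by (cases "x \<in> E") simp_all
      qed
      also have "\<dots> \<le> ennreal (sqrt pi * t) * rearrangement_bound f t"
        by (rule nn_integral_riesz_potential_le) (use t t0 in auto)
      finally have at: "ennreal a * ennreal t \<le> ennreal (sqrt pi * t) * rearrangement_bound f t" .
      have "{0<..<t} \<subseteq> {t\<in>{0<..<1}. c \<le> Y t}"
      proof
        fix s assume s: "s \<in> {0<..<t}"
        define p where "p = enn2real (?P s)"
        have p: "?P s = ennreal p" "0 \<le> p"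
          using P_fin[of s] s t by (auto simp: p_def)
        have "rearrangement_bound f t \<le> ?P s"
          using rearrangement_bound_antimono[of s t] rearrangement_bound_le[of s] s by auto
        then have "ennreal a * ennreal t \<le> ennreal (sqrt pi * t) * ennreal p"
          using at p by (metis mult_left_mono order_trans zero_le)
        then have "ennreal (a * t) \<le> ennreal (sqrt pi * t * p)"
          using a t p by (simp add: ennreal_mult[symmetric])
        then have "a * t \<le> sqrt pi * t * p" using t p by (subst (asm) ennreal_le_iff) auto
        then have "a \<le> sqrt pi * p" using t0 by (simp add: mult.commute mult.left_commute)
        then have "a^2 \<le> (sqrt pi * p)^2" using a by (intro power_mono) auto
        then have "pi * ln c \<le> pi * p^2" using a by (simp add: power_mult_distrib)
        then have "ln c \<le> p^2" by simp
        then have "exp (ln c) \<le> exp (p^2)" by (subst exp_le_cancel_iff)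
        then have "c \<le> Y s" using \<open>\<not> c < 1\<close> by (simp add: Y_def p_def)
        then show "s \<in> {t\<in>{0<..<1}. c \<le> Y t}" using s t by auto
      qed
      then have "emeasure lborel {0<..<t} \<le> emeasure lborel {t\<in>{0<..<1}. c \<le> Y t}"
        by (rule emeasure_mono) measurable
      then show ?thesis using t by (simp add: E_def)
    qed
  qed
  have "(\<integral>\<^sup>+x\<in>A. ennreal (Z x) \<partial>lborel) = (\<integral>\<^sup>+c. indicator {0..} c * emeasure lborel {x\<in>A. c \<le> Z x} \<partial>lborel)"
    by (rule layer_cake) (auto simp: Z_def)
  also have "\<dots> \<le> (\<integral>\<^sup>+c. indicator {0..} c * emeasure lborel {t\<in>{0<..<1}. c \<le> Y t} \<partial>lborel)"
  proof (rule nn_integral_mono)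
    fix c :: real
    show "indicator {0..} c * emeasure lborel {x\<in>A. c \<le> Z x} \<le> indicator {0..} c * emeasure lborel {t\<in>{0<..<1}. c \<le> Y t}"
      using cmp[of c] by (cases "0 \<le> c") (auto intro: mult_left_mono)
  qed
  also have "\<dots> = (\<integral>\<^sup>+t\<in>{0<..<1}. ennreal (Y t) \<partial>lborel)"
    by (rule layer_cake[symmetric]) (auto simp: Y_def)
  also have "\<dots> \<le> ennreal (184 * 5 * exp 4)"
    unfolding Y_def by (rule nn_integral_exp_adams_potential[OF decreasing_rearrangement_measurable e])
  finally show ?thesis by (simp add: Z_def)
qed

end

end

text \<open>The origin of 4 pi: dividing the gradient above the cut by sqrt e gives energy at most
  1, and the Riesz bound then controls w = 2 pi (|u| - t) / sqrt e, for which w^2 / pi = 4 pi (|u| -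
  t)^2 / e. The measure hypothesis bounds the distribution function of the normalised gradient by
  1.\<close>

lemma moser_trudinger_superlevel:
  fixes u :: "real ^ 2 \<Rightarrow> real" and g :: "real ^ 2 \<Rightarrow> real ^ 2"
  assumes der: "\<And>x. (u has_derivative (\<lambda>h. g x \<bullet> h)) (at x)"
    and cont: "continuous_on UNIV g" and bd: "bounded {x. u x \<noteq> 0}" and t: "0 \<le> t"
    and small: "emeasure lborel {y. t < \<bar>u y\<bar>} \<le> 1" and e: "0 < e"
    and energy: "(\<integral>\<^sup>+y\<in>{y. t < \<bar>u y\<bar>}. ennreal ((norm (g y))^2) \<partial>lborel) \<le> ennreal e"
  shows "(\<integral>\<^sup>+x\<in>{y. t < \<bar>u y\<bar>}. ennreal (exp (4 * pi * (\<bar>u x\<bar> - t)^2 / e)) \<partial>lborel) \<le> ennreal (184 * 5 * exp 4)"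
proof -
  note [measurable] = gradient_borel_measurable[OF der cont]
  define A where "A = {y. t < \<bar>u y\<bar>}"
  have [measurable]: "A \<in> sets borel" unfolding A_def by measurable
  define f where "f y = norm (g y) * indicator A y / sqrt e" for y
  have [measurable]: "f \<in> borel_measurable borel" unfolding f_def by measurable
  define w where "w x = 2 * pi * max 0 (\<bar>u x\<bar> - t) / sqrt e" for x
  have [measurable]: "w \<in> borel_measurable borel" unfolding w_def by measurable
  have "(\<integral>\<^sup>+x\<in>A. ennreal (exp ((w x)^2 / pi)) \<partial>lborel) \<le> ennreal (184 * 5 * exp 4)"
  proof (rule adams_inequality)
    show "0 \<le> f y" for y using e by (simp add: f_def)
    show "distribution_function f l \<le> 1" if "0 \<le> l" for l
    proof -
      have "distribution_function f l \<le> emeasure lborel A"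
        unfolding distribution_function_def
        by (rule emeasure_mono) (use that in \<open>auto simp: f_def indicator_def split: if_splits\<close>)
      then show ?thesis using small unfolding A_def by (rule order_trans)
    qed
    have "(\<integral>\<^sup>+y. ennreal ((f y)^2) \<partial>lborel) = (\<integral>\<^sup>+y. ennreal (1 / e) * (ennreal ((norm (g y))^2) * indicator A y) \<partial>lborel)"
      using e by (intro nn_integral_cong) (auto simp: f_def indicator_def power_divide ennreal_mult[symmetric])
    also have "\<dots> = ennreal (1 / e) * (\<integral>\<^sup>+y\<in>A. ennreal ((norm (g y))^2) \<partial>lborel)"
      by (rule nn_integral_cmult) measurable
    also have "\<dots> \<le> ennreal (1 / e) * ennreal e"
      using energy by (intro mult_left_mono) (auto simp: A_def)
    also have "\<dots> = 1" using e by (simp add: ennreal_mult[symmetric])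
    finally show "(\<integral>\<^sup>+y. ennreal ((f y)^2) \<partial>lborel) \<le> 1" .
    show "ennreal (w x) \<le> (\<integral>\<^sup>+y. ennreal (f y) * ennreal (1 / norm (y - x)) \<partial>lborel)" for x
    proof -
      have "ennreal (w x) = ennreal (1 / sqrt e) * ennreal (2 * pi * max 0 (\<bar>u x\<bar> - t))"
        using e by (simp add: w_def ennreal_mult[symmetric])
      also have "ennreal (2 * pi * max 0 (\<bar>u x\<bar> - t)) = ennreal (2 * pi * (\<bar>u x\<bar> - t))"
        by (cases "t \<le> \<bar>u x\<bar>") (auto simp: max_def ennreal_neg mult_nonneg_nonpos)
      also have "ennreal (1 / sqrt e) * \<dots>
        \<le> ennreal (1 / sqrt e) * (\<integral>\<^sup>+y. ennreal (norm (g y)) * indicator {y. t < \<bar>u y\<bar>} y * ennreal (1 / norm (y - x)) \<partial>lborel)"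
        by (intro mult_left_mono riesz_potential_bound[OF der cont bd t]) auto
      also have "\<dots> = (\<integral>\<^sup>+y. ennreal (1 / sqrt e) * (ennreal (norm (g y)) * indicator A y * ennreal (1 / norm (y - x))) \<partial>lborel)"
        unfolding A_def[symmetric] by (rule nn_integral_cmult[symmetric]) measurable
      also have "\<dots> = (\<integral>\<^sup>+y. ennreal (f y) * ennreal (1 / norm (y - x)) \<partial>lborel)"
        using e by (intro nn_integral_cong) (auto simp: f_def indicator_def ennreal_mult[symmetric])
      finally show ?thesis .
    qed
    show "0 \<le> w x" for x using e by (simp add: w_def)
    show "emeasure lborel A \<le> 1" using small by (simp add: A_def)
  qed measurable
  also have "(\<integral>\<^sup>+x\<in>A. ennreal (exp ((w x)^2 / pi)) \<partial>lborel)
    = (\<integral>\<^sup>+x\<in>{y. t < \<bar>u y\<bar>}. ennreal (exp (4 * pi * (\<bar>u x\<bar> - t)^2 / e)) \<partial>lborel)"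
  proof (rule nn_integral_cong)
    fix x
    have "(w x)^2 / pi = 4 * pi * (\<bar>u x\<bar> - t)^2 / e" if "t < \<bar>u x\<bar>"
      using that e by (simp add: w_def power_divide power_mult_distrib power2_eq_square[of pi])
    then show "ennreal (exp ((w x)^2 / pi)) * indicator A x
      = ennreal (exp (4 * pi * (\<bar>u x\<bar> - t)^2 / e)) * indicator {y. t < \<bar>u y\<bar>} x"
      by (auto simp: A_def indicator_def)
  qed
  finally show ?thesis .
qed

section \<open>Poincare inequality outside a finite union of continua\<close>

lemma cis_vec_surj:
  assumes "norm v = s" "0 < s"
  obtains \<theta> where "0 \<le> \<theta>" "\<theta> < 2 * pi" "v = s *\<^sub>R cis_vec \<theta>"
proof -
  have s2: "s^2 = (v$1)^2 + (v$2)^2"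
    using assms by (auto simp: norm_vec_def L2_set_def sum_2)
  then have "(v$1 / s)^2 + (v$2 / s)^2 = 1"
    unfolding power_divide add_divide_distrib[symmetric] s2[symmetric] using assms by simp
  then obtain t where t: "0 \<le> t" "t < 2*pi" "v$1 / s = cos t" "v$2 / s = sin t"
    using sincos_total_2pi by metis
  have "v = s *\<^sub>R cis_vec t"
    using assms by (simp add: vec2_eq_iff cis_vec_def axis_def flip: t(3,4))
  with t show ?thesis by (intro that)
qed

text \<open>From the zero \<open>q\<close> every other point of the circle is reached by an arc of
  parameters inside [0, 2 pi), so the truncated value there is at most the integral of the
  tangential derivative at levels below \<open>m\<close>. Cauchy-Schwarz yields one factor 2 pi and
  integration over the angle the other.\<close>

lemma circle_poincare:
  fixes u :: "real ^ 2 \<Rightarrow> real" and g :: "real ^ 2 \<Rightarrow> real ^ 2"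
  assumes der: "\<And>x. (u has_derivative (\<lambda>h. g x \<bullet> h)) (at x)"
    and cont: "continuous_on UNIV g" and m: "0 < m" and s: "0 < s"
    and q: "dist p q = s" "u q = 0"
  shows "(\<integral>\<^sup>+\<theta>\<in>{0<..<2*pi}. ennreal ((min \<bar>u (p + s *\<^sub>R cis_vec \<theta>)\<bar> m)^2) \<partial>lborel)
    \<le> ennreal (4 * pi^2 * s^2) * (\<integral>\<^sup>+\<theta>. ennreal ((norm (g (p + s *\<^sub>R cis_vec \<theta>)))^2)
        * indicator {y. \<bar>u y\<bar> \<le> m} (p + s *\<^sub>R cis_vec \<theta>) * indicator {0<..<2*pi} \<theta> \<partial>lborel)"
proof -
  note [measurable] = gradient_borel_measurable[OF der cont]
  have "norm (q - p) = s" using q by (simp add: dist_norm norm_minus_commute)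
  then obtain \<theta>0 where \<theta>0: "0 \<le> \<theta>0" "\<theta>0 < 2 * pi" "q - p = s *\<^sub>R cis_vec \<theta>0"
    using s by (rule cis_vec_surj)
  let ?x = "\<lambda>\<theta>. p + s *\<^sub>R cis_vec \<theta>"
  define h where "h \<theta> = u (?x \<theta>)" for \<theta>
  define d where "d \<theta> = s *\<^sub>R ((- sin \<theta>) *\<^sub>R axis 1 1 + cos \<theta> *\<^sub>R axis 2 1 :: real ^ 2)" for \<theta>
  define h' where "h' \<theta> = g (?x \<theta>) \<bullet> d \<theta>" for \<theta>
  have h0: "h \<theta>0 = 0" using q \<theta>0 by (simp add: h_def flip: \<theta>0(3))
  have nd: "norm (d \<theta>) = s" for \<theta>
  proof -
    have "norm ((- sin \<theta>) *\<^sub>R axis 1 1 + cos \<theta> *\<^sub>R axis 2 1 :: real ^ 2) = 1"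
      by (simp add: norm_vec_def L2_set_def sum_2 axis_def)
    then show ?thesis unfolding d_def norm_scaleR using s by simp
  qed
  have hder: "(h has_real_derivative h' \<theta>) (at \<theta>)" for \<theta>
  proof -
    have "(?x has_derivative (\<lambda>r. r *\<^sub>R d \<theta>)) (at \<theta>)"
      unfolding cis_vec_def d_def
      by (auto intro!: derivative_eq_intros simp: algebra_simps scaleR_add_right)
    from has_derivative_compose[OF this der] show ?thesis
      by (simp add: has_field_derivative_def mult_commute_abs h_def[abs_def] h'_def)
  qed
  have gc: "continuous_on UNIV (\<lambda>\<theta>. g (?x \<theta>))"
    by (rule continuous_on_compose2[OF cont]) (auto intro!: continuous_intros continuous_cis_vec)
  have dc: "continuous_on UNIV d"
    unfolding d_def by (intro continuous_intros)
  have h'c: "continuous_on UNIV h'"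
    unfolding h'_def by (intro continuous_on_inner gc dc)
  have h'le: "\<bar>h' \<theta>\<bar> \<le> s * norm (g (?x \<theta>))" for \<theta>
    using Cauchy_Schwarz_ineq2[of "g (?x \<theta>)" "d \<theta>"] by (simp add: h'_def nd mult.commute)
  define G where "G \<theta> = (ennreal (norm (g (?x \<theta>))) * indicator {y. \<bar>u y\<bar> \<le> m} (?x \<theta>) * indicator {0<..<2*pi} \<theta>)" for \<theta>
  have [measurable]: "G \<in> borel_measurable borel" unfolding G_def by measurable
  have pt: "ennreal (min \<bar>h \<theta>\<bar> m) \<le> ennreal s * (\<integral>\<^sup>+r. G r \<partial>lborel)" if \<theta>: "\<theta> \<in> {0<..<2*pi}" for \<theta>
  proof (cases "min \<bar>h \<theta>\<bar> m \<le> 0")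
    case True
    then show ?thesis by (simp add: ennreal_neg)
  next
    case False
    define a where "a = min \<theta> \<theta>0"
    define b where "b = max \<theta> \<theta>0"
    have "ennreal (min \<bar>h \<theta>\<bar> m - 0) \<le> (\<integral>\<^sup>+x. ennreal \<bar>h' x\<bar> * indicator {x\<in>{a..b}. 0 < \<bar>h x\<bar> \<and> \<bar>h x\<bar> < min \<bar>h \<theta>\<bar> m} x \<partial>lborel)"
    proof (cases "\<theta>0 \<le> \<theta>")
      case True
      then have ab: "a = \<theta>0" "b = \<theta>" by (auto simp: a_def b_def)
      show ?thesis unfolding ab
        by (rule level_crossing[OF True hder h'c]) (use False h0 in auto)
    next
      case le: False
      then have ab: "a = \<theta>" "b = \<theta>0" by (auto simp: a_def b_def)
      show ?thesis unfolding ab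
        by (rule level_crossing_reverse[OF _ hder h'c]) (use False h0 le in auto)
    qed
    also have "\<dots> \<le> (\<integral>\<^sup>+r. ennreal s * G r \<partial>lborel)"
    proof (rule nn_integral_mono_AE)
      \<comment> \<open>The zero may sit at angle 0, the endpoint that the open interval leaves
        out.\<close>
      have *: "ennreal \<bar>h' x\<bar> * indicator {x\<in>{a..b}. 0 < \<bar>h x\<bar> \<and> \<bar>h x\<bar> < min \<bar>h \<theta>\<bar> m} x \<le> ennreal s * G x" if "x \<noteq> 0" for x
      proof (cases "x \<in> {a..b} \<and> \<bar>h x\<bar> < m")
        case True
        have "0 \<le> a" "b < 2 * pi" using \<theta> \<theta>0 by (auto simp: a_def b_def)
        then have "G x = ennreal (norm (g (?x x)))" using True that by (simp add: G_def h_def)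
        then have "ennreal \<bar>h' x\<bar> \<le> ennreal s * G x"
          using h'le[of x] s by (simp add: ennreal_mult[symmetric] ennreal_leI)
        then show ?thesis by (auto simp: indicator_def)
      qed (auto simp: indicator_def)
      show "AE x in lborel. ennreal \<bar>h' x\<bar> * indicator {x\<in>{a..b}. 0 < \<bar>h x\<bar> \<and> \<bar>h x\<bar> < min \<bar>h \<theta>\<bar> m} x \<le> ennreal s * G x"
        using AE_lborel_singleton[of 0] by eventually_elim (rule *)
    qed
    also have "\<dots> = ennreal s * (\<integral>\<^sup>+r. G r \<partial>lborel)" by (rule nn_integral_cmult) measurable
    finally show ?thesis by simp
  qed
  define J where "J = (\<integral>\<^sup>+\<theta>\<in>{0<..<2*pi}. ennreal ((norm (g (?x \<theta>)))^2) * indicator {y. \<bar>u y\<bar> \<le> m} (?x \<theta>) \<partial>lborel)"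
  have GJ: "(\<integral>\<^sup>+r. G r \<partial>lborel)^2 \<le> ennreal (2 * pi) * J"
  proof -
    have "(\<integral>\<^sup>+r. G r \<partial>lborel) = (\<integral>\<^sup>+r. indicator {0<..<2*pi} r * G r \<partial>lborel)"
      by (intro nn_integral_cong) (auto simp: G_def indicator_def)
    also have "(\<dots>)^2 \<le> (\<integral>\<^sup>+r. (indicator {0<..<2*pi} r)^2 \<partial>lborel) * (\<integral>\<^sup>+r. (G r)^2 \<partial>lborel)"
      by (rule Cauchy_Schwarz_nn_integral) measurable
    also have "(\<integral>\<^sup>+r. (indicator {0<..<2*pi} r)^2 \<partial>lborel) = (\<integral>\<^sup>+r. indicator {0<..<2*pi} r \<partial>(lborel :: real measure))"
      by (intro nn_integral_cong) (auto simp: indicator_def)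
    also have "\<dots> = ennreal (2 * pi)" by simp
    also have "(\<integral>\<^sup>+r. (G r)^2 \<partial>lborel) = J"
      unfolding J_def G_def
      by (intro nn_integral_cong) (auto simp: indicator_def ennreal_power)
    finally show ?thesis .
  qed
  have "(\<integral>\<^sup>+\<theta>\<in>{0<..<2*pi}. ennreal ((min \<bar>h \<theta>\<bar> m)^2) \<partial>lborel)
    \<le> (\<integral>\<^sup>+\<theta>\<in>{0<..<2*pi}. (ennreal (s^2) * (ennreal (2 * pi) * J)) \<partial>lborel)"
  proof (rule nn_integral_mono)
    fix \<theta>
    have "ennreal ((min \<bar>h \<theta>\<bar> m)^2) \<le> ennreal (s^2) * (ennreal (2 * pi) * J)" if "\<theta> \<in> {0<..<2*pi}"
    proof -
      have "ennreal ((min \<bar>h \<theta>\<bar> m)^2) = (ennreal (min \<bar>h \<theta>\<bar> m))^2"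
        using m by (intro ennreal_power[symmetric]) auto
      also have "\<dots> \<le> (ennreal s * (\<integral>\<^sup>+r. G r \<partial>lborel))^2"
        by (rule power_mono[OF pt[OF that]]) simp
      also have "\<dots> = ennreal (s^2) * (\<integral>\<^sup>+r. G r \<partial>lborel)^2"
        using s by (simp add: power_mult_distrib ennreal_power)
      also have "\<dots> \<le> ennreal (s^2) * (ennreal (2 * pi) * J)"
        by (rule mult_left_mono[OF GJ]) simp
      finally show ?thesis .
    qed
    then show "ennreal ((min \<bar>h \<theta>\<bar> m)^2) * indicator {0<..<2*pi} \<theta>
      \<le> (ennreal (s^2) * (ennreal (2 * pi) * J)) * indicator {0<..<2*pi} \<theta>"
      by (auto simp: indicator_def)
  qed
  also have "\<dots> = (ennreal (s^2) * (ennreal (2 * pi) * J)) * ennreal (2 * pi)"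
    by (subst nn_integral_cmult_indicator) auto
  also have "\<dots> = (ennreal (s^2) * ennreal (2 * pi) * ennreal (2 * pi)) * J"
    by (simp only: mult_ac)
  also have "ennreal (s^2) * ennreal (2 * pi) * ennreal (2 * pi) = ennreal (4 * pi^2 * s^2)"
    by (simp add: ennreal_mult[symmetric] power2_eq_square mult_ac)
  finally show ?thesis by (simp add: J_def h_def)
qed

text \<open>A zero on every circle about \<open>p\<close> takes the place of a boundary condition on
  the disk; circles of radius at least \<open>R\<close> contribute nothing to either side.\<close>

lemma disk_poincare:
  fixes u :: "real ^ 2 \<Rightarrow> real" and g :: "real ^ 2 \<Rightarrow> real ^ 2"
  assumes der: "\<And>x. (u has_derivative (\<lambda>h. g x \<bullet> h)) (at x)"
    and cont: "continuous_on UNIV g" and m: "0 < m"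
    and zero: "\<And>s. 0 < s \<Longrightarrow> \<exists>q. dist p q = s \<and> u q = 0"
  shows "(\<integral>\<^sup>+y\<in>ball p R. ennreal ((min \<bar>u y\<bar> m)^2) \<partial>lborel)
    \<le> ennreal (4 * pi^2 * R^2) * (\<integral>\<^sup>+y\<in>ball p R. ennreal ((norm (g y))^2) * indicator {y. \<bar>u y\<bar> \<le> m} y \<partial>lborel)"
proof -
  let ?c = "ennreal (4 * pi^2 * R^2)"
  note [measurable] = gradient_borel_measurable[OF der cont]
  have [measurable]: "ball p R \<in> sets borel" by simp
  let ?f = "\<lambda>y. ennreal ((min \<bar>u y\<bar> m)^2) * indicator (ball p R) y"
  let ?g = "\<lambda>y. ennreal ((norm (g y))^2) * indicator {y. \<bar>u y\<bar> \<le> m} y * indicator (ball p R) y"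
  let ?I = "\<lambda>f r. \<integral>\<^sup>+\<theta>. f (p + r *\<^sub>R cis_vec \<theta>) * indicator {0<..<2*pi} \<theta> \<partial>lborel"
  have le: "?I ?f r \<le> ?c * ?I ?g r" if r: "0 < r" for r
  proof (cases "r < R")
    case True
    have ind: "indicator (ball p R) (p + r *\<^sub>R cis_vec \<theta>) = (1 :: ennreal)" for \<theta>
      using True r by (simp add: dist_norm)
    obtain q where "dist p q = r" "u q = 0" using zero[OF r] by blast
    then have "?I ?f r \<le> ennreal (4 * pi^2 * r^2) * ?I ?g r"
      using circle_poincare[OF der cont m r] unfolding ind by simp
    also have "\<dots> \<le> ?c * ?I ?g r"
      using True r by (intro mult_right_mono ennreal_leI mult_left_mono power_mono) auto
    finally show ?thesis .
  next
    case False
    then have "indicator (ball p R) (p + r *\<^sub>R cis_vec \<theta>) = (0 :: ennreal)" for \<theta>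
      using r by (simp add: dist_norm)
    then show ?thesis by simp
  qed
  have "(\<integral>\<^sup>+y. ?f y \<partial>lborel) = (\<integral>\<^sup>+r\<in>{0<..}. ennreal r * ?I ?f r \<partial>lborel)"
    by (rule nn_integral_polar(2)) measurable
  also have "\<dots> \<le> (\<integral>\<^sup>+r. ?c * (ennreal r * ?I ?g r * indicator {0<..} r) \<partial>lborel)"
  proof (rule nn_integral_mono)
    fix r :: real
    show "ennreal r * ?I ?f r * indicator {0<..} r \<le> ?c * (ennreal r * ?I ?g r * indicator {0<..} r)"
    proof (cases "0 < r")
      case True
      then show ?thesis
        using mult_left_mono[OF le[OF True], of "ennreal r"] by (simp add: mult_ac)
    qed simp
  qed
  also have "\<dots> = ?c * (\<integral>\<^sup>+r\<in>{0<..}. ennreal r * ?I ?g r \<partial>lborel)"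
    by (rule nn_integral_cmult) measurable
  also have "(\<integral>\<^sup>+r\<in>{0<..}. ennreal r * ?I ?g r \<partial>lborel) = (\<integral>\<^sup>+y. ?g y \<partial>lborel)"
    by (rule nn_integral_polar(2)[symmetric]) measurable
  finally show ?thesis .
qed

text \<open>A component of the complement that misses infinity is closed in the compactification,
  hence compact; finitely many of them fit into one disk of radius \<open>M\<close>. A complement
  point beyond it lies in the component of infinity. A circle about this point inside \<Omega> would
  split that component between the open disk and the exterior together with infinity.\<close>

lemma circles_meet_complement:
  assumes "multiply_connected k \<Omega>"
  obtains M where "0 \<le> M"
    and "\<And>p s. p \<notin> \<Omega> \<Longrightarrow> M < norm p \<Longrightarrow> 0 < s \<Longrightarrow> \<exists>q. dist p q = s \<and> q \<notin> \<Omega>"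
proof -
  define X where "X = Alexandroff_compactification (euclidean :: (real ^ 2) topology)"
  define Y where "Y = subtopology X (topspace X - Some ` \<Omega>)"
  have op: "open \<Omega>" and fin: "finite (connected_components_of Y)"
    using assms by (auto simp: multiply_connected_def Let_def X_def Y_def)
  have "openin X (Some ` \<Omega>)" using op by (simp add: X_def)
  then have clX: "closedin X (topspace X - Some ` \<Omega>)" by blast
  define \<B> where "\<B> = {C \<in> connected_components_of Y. None \<notin> C}"
  have bd: "bounded (Some -` C)" if "C \<in> \<B>" for C
  proof -
    have "closedin Y C" using that by (auto simp: \<B>_def closedin_connected_components_of)
    then have cl: "closedin X C" using clX unfolding Y_def by (simp add: closedin_closed_subtopology)
    have eq: "Some ` (Some -` C) = C"
    proof -
      have "x \<in> range Some" if "x \<in> C" for x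
        using that \<open>C \<in> \<B>\<close> by (cases x) (auto simp: \<B>_def)
      then show ?thesis by auto
    qed
    have "closedin X (Some ` (Some -` C))" unfolding eq by (rule cl)
    then have "compactin euclidean (Some -` C)"
      unfolding X_def closedin_Alexandroff_compactification_image_Some by simp
    then show ?thesis by (simp add: compact_imp_bounded)
  qed
  have "bounded (\<Union>C\<in>\<B>. Some -` C)"
    using fin bd by (intro bounded_UN) (auto simp: \<B>_def)
  then obtain M where M0: "0 < M" and MB: "\<forall>x\<in>(\<Union>C\<in>\<B>. Some -` C). norm x \<le> M"
    unfolding bounded_pos by (elim exE conjE)
  note M = M0 bspec[OF MB]
  show thesis
  proof (rule that[of M])
    fix p :: "real ^ 2" and s :: real assume p: "p \<notin> \<Omega>" "M < norm p" and s: "0 < s"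
    show "\<exists>q. dist p q = s \<and> q \<notin> \<Omega>"
    proof (rule ccontr)
      assume no: "\<nexists>q. dist p q = s \<and> q \<notin> \<Omega>"
      have "Some p \<in> topspace Y" using p by (auto simp: Y_def X_def)
      then obtain C where C: "C \<in> connected_components_of Y" "Some p \<in> C"
        unfolding Union_connected_components_of[symmetric] by (elim UnionE)
      have "None \<in> C"
      proof (rule ccontr)
        assume "None \<notin> C"
        then have "p \<in> (\<Union>C\<in>\<B>. Some -` C)" using C by (auto simp: \<B>_def)
        then show False using M(2) p by fastforce
      qed
      have conn: "connectedin X C" and CY: "C \<subseteq> topspace X - Some ` \<Omega>"
        using connectedin_connected_components_of[OF C(1)] by (auto simp: Y_def connectedin_subtopology)
      define E1 where "E1 = (Some ` ball p s :: (real ^ 2) option set)"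
      define E2 where "E2 = insert None (Some ` (UNIV - cball p s))"
      have "openin X E1" unfolding E1_def X_def by simp
      moreover have "openin X E2"
        unfolding E2_def X_def openin_Alexandroff_compactification
        by (intro disjI2 exI[of _ "cball p s"]) simp
      moreover have "C \<subseteq> E1 \<union> E2"
      proof
        fix x assume x: "x \<in> C"
        show "x \<in> E1 \<union> E2"
        proof (cases x)
          case (Some y)
          then have "y \<notin> \<Omega>" using x CY by auto
          then have "dist p y \<noteq> s" using no by blast
          then show ?thesis using Some by (auto simp: E1_def E2_def)
        qed (simp add: E2_def)
      qed
      moreover have "E1 \<inter> E2 \<inter> C = {}" by (auto simp: E1_def E2_def)
      moreover have "E1 \<inter> C \<noteq> {}" using C(2) s centre_in_ball[of p s] unfolding E1_def by blast
      moreover have "E2 \<inter> C \<noteq> {}" using \<open>None \<in> C\<close> by (auto simp: E2_def)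
      ultimately show False using conn unfolding connectedin by blast
    qed
  qed (use M in auto)
qed

lemma circles_meet_complement_near:
  assumes mc: "multiply_connected k \<Omega>" and "inradius \<Omega> < \<infinity>"
  obtains D where "0 < D"
    and "\<And>a. \<exists>p. dist a p \<le> D \<and> (\<forall>s>0. \<exists>q. dist p q = s \<and> q \<notin> \<Omega>)"
proof -
  obtain M where M: "0 \<le> M" "\<And>p s. p \<notin> \<Omega> \<Longrightarrow> M < norm p \<Longrightarrow> 0 < s \<Longrightarrow> \<exists>q. dist p q = s \<and> q \<notin> \<Omega>"
    using circles_meet_complement[OF mc] by blast
  define R where "R = enn2real (inradius \<Omega>) + 1"
  have R: "0 < R" by (simp add: R_def add_nonneg_pos)
  have nb: "\<not> ball x R \<subseteq> \<Omega>" for x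
  proof
    assume "ball x R \<subseteq> \<Omega>"
    then have "ennreal R \<le> inradius \<Omega>"
      unfolding inradius_def using R by (intro Sup_upper) auto
    also have "inradius \<Omega> = ennreal (R - 1)" using assms by (simp add: R_def)
    finally show False using R by (subst (asm) ennreal_le_iff) (auto simp: R_def)
  qed
  show thesis
  proof (rule that[of "2 * M + 3 * R"])
    fix a :: "real ^ 2"
    \<comment> \<open>A point near the origin is first moved out to norm M + R, so that a complement
      point within \<open>R\<close> of it has norm above \<open>M\<close>. The move costs at most 2
      (M + R) and the last step \<open>R\<close>, which adds up to 2 M + 3 R.\<close>
    define a' where "a' = (if M + R \<le> norm a then a else (M + R) *\<^sub>R axis 1 1)"
    have a': "M + R \<le> norm a'" using M(1) R by (auto simp: a'_def)
    have "dist a a' \<le> 2 * (M + R)"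
      using norm_triangle_ineq4[of a "(M + R) *\<^sub>R axis 1 1"] M(1) R
      by (auto simp: a'_def dist_norm)
    obtain p where p: "p \<in> ball a' R" "p \<notin> \<Omega>" using nb[of a'] by blast
    have "norm a' \<le> norm p + dist a' p"
      using norm_triangle_ineq[of p "a' - p"] by (simp add: dist_norm)
    then have "M < norm p" using a' p by simp
    moreover have "dist a p \<le> 2 * M + 3 * R"
      using \<open>dist a a' \<le> 2 * (M + R)\<close> dist_triangle[of a p a'] p by simp
    ultimately show "\<exists>p. dist a p \<le> 2 * M + 3 * R \<and> (\<forall>s>0. \<exists>q. dist p q = s \<and> q \<notin> \<Omega>)"
      using M(2) p by blast
  qed (use M R in auto)
qed

lemma card_int_interval_le:
  "finite {i::int. \<bar>x - of_int i\<bar> < R} \<and> card {i::int. \<bar>x - of_int i\<bar> < R} \<le> nat \<lceil>2 * R + 3\<rceil>" for x R :: real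
proof -
  let ?I = "{i::int. \<bar>x - of_int i\<bar> < R}"
  have sub: "?I \<subseteq> {\<lfloor>x - R\<rfloor>..\<lceil>x + R\<rceil>}"
    by (auto simp: abs_less_iff) linarith+
  have "card ?I \<le> card {\<lfloor>x - R\<rfloor>..\<lceil>x + R\<rceil>}"
    by (rule card_mono[OF _ sub]) simp
  also have "\<dots> \<le> nat \<lceil>2 * R + 3\<rceil>" by simp linarith
  finally show ?thesis using finite_subset[OF sub] by simp
qed

text \<open>Sums \<open>disk_poincare\<close> over disks of equal radius whose centres are good
  points near the integer lattice. The disks cover the plane, and no point lies in more than
  \<open>N\<close>^2 of them: x in \<open>T z\<close> puts each coordinate of z within S + D of that
  of x. Summing over lattice indices allows centres to coincide.\<close>

theorem poincare_inequality:
  assumes mc: "multiply_connected k \<Omega>" and "inradius \<Omega> < \<infinity>"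
  obtains P where "0 < P"
    and "\<And>u g m. \<lbrakk>\<And>x. (u has_derivative (\<lambda>h. g x \<bullet> h)) (at x); continuous_on UNIV g; \<And>x. x \<notin> \<Omega> \<Longrightarrow> u x = 0; 0 < m\<rbrakk>
      \<Longrightarrow> (\<integral>\<^sup>+y. ennreal ((min \<bar>u y\<bar> m)^2) \<partial>lborel)
        \<le> ennreal P * (\<integral>\<^sup>+y\<in>{y. \<bar>u y\<bar> \<le> m}. ennreal ((norm (g y))^2) \<partial>lborel)"
proof -
  obtain D where D: "0 < D" "\<And>a. \<exists>p. dist a p \<le> D \<and> (\<forall>s>0. \<exists>q. dist p q = s \<and> q \<notin> \<Omega>)"
    using circles_meet_complement_near[OF assms] by blast
  obtain c where c: "\<And>a. dist a (c a) \<le> D" "\<And>a s. 0 < s \<Longrightarrow> \<exists>q. dist (c a) q = s \<and> q \<notin> \<Omega>"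
    using D(2) by metis
  define A where "A z = (real_of_int (fst z) *\<^sub>R axis 1 1 + real_of_int (snd z) *\<^sub>R axis 2 1 :: real ^ 2)" for z
  \<comment> \<open>Every point is within 2 of a lattice point, which is within \<open>D\<close> of
    its chosen centre.\<close>
  define S where "S = D + 2"
  let ?c = "ennreal (4 * pi^2 * S^2)"
  define T where "T z = ball (c (A z)) S" for z
  define N where "N = real (nat \<lceil>2 * (S + D) + 3\<rceil>)"
  have [measurable]: "T z \<in> sets borel" for z by (simp add: T_def)
  have cover: "\<exists>z. x \<in> T z" for x
  proof
    define z where "z = (\<lfloor>x$1\<rfloor>, \<lfloor>x$2\<rfloor>)"
    have "\<bar>(x - A z)$1\<bar> < 1" "\<bar>(x - A z)$2\<bar> < 1"
      by (simp_all add: A_def z_def axis_def abs_less_iff) linarith+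
    then have "dist x (A z) < 2"
      using norm_le_l1_cart[of "x - A z"] by (simp add: dist_norm sum_2)
    then have "dist (c (A z)) x < S"
      using c(1)[of "A z"] dist_triangle[of "c (A z)" x "A z"] by (simp add: S_def dist_commute)
    then show "x \<in> T z" by (simp add: T_def)
  qed
  have mult: "emeasure (count_space UNIV) {z. x \<in> T z} \<le> ennreal (N^2)" for x
  proof -
    let ?I = "\<lambda>i. {j::int. \<bar>x$i - of_int j\<bar> < S + D}"
    have sub: "{z. x \<in> T z} \<subseteq> ?I 1 \<times> ?I 2"
    proof
      fix z assume "z \<in> {z. x \<in> T z}"
      then have "dist x (A z) < S + D"
        using c(1)[of "A z"] dist_triangle[of x "A z" "c (A z)"] by (simp add: T_def dist_commute)
      then have "\<bar>(x - A z)$i\<bar> < S + D" for i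
        using component_le_norm_cart[of "x - A z" i] by (simp add: dist_norm)
      from this[of 1] this[of 2] show "z \<in> ?I 1 \<times> ?I 2"
        by (cases z) (simp add: A_def axis_def)
    qed
    have If: "finite (?I i)" and Ic: "card (?I i) \<le> nat \<lceil>2 * (S + D) + 3\<rceil>" for i
      using card_int_interval_le[of "x$i" "S + D"] by simp_all
    have fin: "finite (?I 1 \<times> ?I 2)" by (rule finite_cartesian_product[OF If If])
    have "card {z. x \<in> T z} \<le> card (?I 1 \<times> ?I 2)" by (rule card_mono[OF fin sub])
    also have "\<dots> \<le> nat \<lceil>2 * (S + D) + 3\<rceil> * nat \<lceil>2 * (S + D) + 3\<rceil>"
      unfolding card_cartesian_product by (rule mult_le_mono[OF Ic Ic])
    finally have "real (card {z. x \<in> T z}) \<le> real (nat \<lceil>2 * (S + D) + 3\<rceil> * nat \<lceil>2 * (S + D) + 3\<rceil>)"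
      by (rule of_nat_mono)
    also have "\<dots> = N^2" by (simp add: N_def power2_eq_square)
    finally have "ennreal (real (card {z. x \<in> T z})) \<le> ennreal (N^2)" by (rule ennreal_leI)
    then show ?thesis
      using finite_subset[OF sub fin] by (simp add: emeasure_count_space_finite ennreal_of_nat_eq_real_of_nat)
  qed
  show thesis
  proof (rule that[of "4 * pi^2 * S^2 * N^2"])
    have "0 < N" "0 < S" using D by (auto simp: S_def N_def)
    then show "0 < 4 * pi^2 * S^2 * N^2" by simp
    fix u :: "real ^ 2 \<Rightarrow> real" and g and m :: real
    assume der: "\<And>x. (u has_derivative (\<lambda>h. g x \<bullet> h)) (at x)" and cont: "continuous_on UNIV g"
      and zero: "\<And>x. x \<notin> \<Omega> \<Longrightarrow> u x = 0" and m: "0 < m"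
    note [measurable] = gradient_borel_measurable[OF der cont]
    let ?f = "\<lambda>y. ennreal ((min \<bar>u y\<bar> m)^2)"
    let ?g = "\<lambda>y. ennreal ((norm (g y))^2) * indicator {y. \<bar>u y\<bar> \<le> m} y"
    have "(\<integral>\<^sup>+y. ?f y \<partial>lborel) \<le> (\<integral>\<^sup>+y. \<integral>\<^sup>+z. ?f y * indicator (T z) y \<partial>count_space UNIV \<partial>lborel)"
    proof (rule nn_integral_mono)
      fix y
      obtain z where z: "y \<in> T z" using cover by blast
      have "?f y * indicator (T z) y \<le> (\<integral>\<^sup>+z. ?f y * indicator (T z) y \<partial>count_space UNIV)"
        by (rule nn_integral_ge_point) simp
      then show "?f y \<le> (\<integral>\<^sup>+z. ?f y * indicator (T z) y \<partial>count_space UNIV)" using z by simp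
    qed
    also have "\<dots> = (\<integral>\<^sup>+z. \<integral>\<^sup>+y. ?f y * indicator (T z) y \<partial>lborel \<partial>count_space UNIV)"
      by (rule nn_integral_count_space_nn_integral) auto
    also have "\<dots> \<le> (\<integral>\<^sup>+z. ?c * (\<integral>\<^sup>+y\<in>T z. ?g y \<partial>lborel) \<partial>count_space UNIV)"
    proof (rule nn_integral_mono)
      fix z
      have "\<exists>q. dist (c (A z)) q = s \<and> u q = 0" if "0 < s" for s
        using c(2)[OF that] zero by blast
      from disk_poincare[OF der cont m this]
      show "(\<integral>\<^sup>+y\<in>T z. ?f y \<partial>lborel) \<le> ?c * (\<integral>\<^sup>+y\<in>T z. ?g y \<partial>lborel)"
        by (simp add: T_def)
    qed
    also have "\<dots> = ?c * (\<integral>\<^sup>+z. \<integral>\<^sup>+y. ?g y * indicator (T z) y \<partial>lborel \<partial>count_space UNIV)"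
      by (rule nn_integral_cmult) simp
    also have "(\<integral>\<^sup>+z. \<integral>\<^sup>+y. ?g y * indicator (T z) y \<partial>lborel \<partial>count_space UNIV)
      = (\<integral>\<^sup>+y. \<integral>\<^sup>+z. ?g y * indicator (T z) y \<partial>count_space UNIV \<partial>lborel)"
      by (rule nn_integral_count_space_nn_integral[symmetric]) auto
    also have "\<dots> \<le> (\<integral>\<^sup>+y. ennreal (N^2) * ?g y \<partial>lborel)"
    proof (rule nn_integral_mono)
      fix y
      have "(\<integral>\<^sup>+z. ?g y * indicator (T z) y \<partial>count_space UNIV) = (\<integral>\<^sup>+z. ?g y * indicator {z. y \<in> T z} z \<partial>count_space UNIV)"
        by (intro nn_integral_cong) (auto simp: indicator_def)
      also have "\<dots> = ?g y * emeasure (count_space UNIV) {z. y \<in> T z}"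
        by (rule nn_integral_cmult_indicator) simp
      also have "\<dots> \<le> ?g y * ennreal (N^2)" by (rule mult_left_mono[OF mult]) simp
      finally show "(\<integral>\<^sup>+z. ?g y * indicator (T z) y \<partial>count_space UNIV) \<le> ennreal (N^2) * ?g y"
        by (simp only: mult.commute)
    qed
    also have "\<dots> = ennreal (N^2) * (\<integral>\<^sup>+y. ?g y \<partial>lborel)"
      by (rule nn_integral_cmult) measurable
    finally have "(\<integral>\<^sup>+y. ?f y \<partial>lborel) \<le> ?c * (ennreal (N^2) * (\<integral>\<^sup>+y. ?g y \<partial>lborel))"
      by (simp add: mult_left_mono)
    then show "(\<integral>\<^sup>+y. ?f y \<partial>lborel) \<le> ennreal (4 * pi^2 * S^2 * N^2) * (\<integral>\<^sup>+y. ?g y \<partial>lborel)"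
      by (simp add: ennreal_mult mult.assoc)
  qed
qed

section \<open>From the Poincare inequality to the critical exponential\<close>

lemma exp_minus_one_le: "exp x - 1 \<le> x * exp x" for x :: real
proof -
  have "(1 - x) * exp x \<le> exp (- x) * exp x"
    using exp_ge_add_one_self[of "- x"] by (intro mult_right_mono) auto
  then show ?thesis by (simp add: algebra_simps flip: exp_add)
qed

lemma square_sum_le_weighted:
  fixes v t :: real
  assumes "0 < \<epsilon>" "\<epsilon> < 1"
  shows "(v + t)^2 \<le> v^2 / (1 - \<epsilon>) + t^2 / \<epsilon>"
proof -
  have "v^2 / (1 - \<epsilon>) + t^2 / \<epsilon> - (v + t)^2 = (\<epsilon> * v - (1 - \<epsilon>) * t)^2 / ((1 - \<epsilon>) * \<epsilon>)"
    using assms by (simp add: field_simps) (simp add: power2_eq_square algebra_simps)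
  also have "\<dots> \<ge> 0" using assms by simp
  finally show ?thesis by simp
qed

text \<open>The level \<open>t\<close> is chosen so that \<open>{|u| > t}\<close> has measure about one. Below \<open>t\<close> the Poincare inequality
  gives \<open>t^2 \<le> P \<epsilon>\<close>, where \<open>\<epsilon>\<close> is the energy below \<open>t\<close>. Above \<open>t\<close> the energy is at most \<open>1 - \<epsilon>\<close>, and this
  deficit pays for the passage from \<open>|u| - t\<close> to \<open>|u|\<close> in the exponent.\<close>

theorem moser_trudinger_of_poincare:
  fixes u :: "real ^ 2 \<Rightarrow> real" and g :: "real ^ 2 \<Rightarrow> real ^ 2"
  assumes der: "\<And>x. (u has_derivative (\<lambda>h. g x \<bullet> h)) (at x)"
    and cont: "continuous_on UNIV g" and bd: "bounded {x. u x \<noteq> 0}" and P: "0 < P"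
    and poincare: "\<And>m. 0 < m \<Longrightarrow> (\<integral>\<^sup>+y. ennreal ((min \<bar>u y\<bar> m)^2) \<partial>lborel)
        \<le> ennreal P * (\<integral>\<^sup>+y\<in>{y. \<bar>u y\<bar> \<le> m}. ennreal ((norm (g y))^2) \<partial>lborel)"
    and energy: "(\<integral>\<^sup>+y. ennreal ((norm (g y))^2) \<partial>lborel) \<le> 1"
  shows "(\<integral>\<^sup>+y. ennreal (exp (4 * pi * (u y)^2) - 1) \<partial>lborel)
    \<le> ennreal (exp (8 * pi * P) * (184 * 5 * exp 4) + 4 * pi * exp (4 * pi * P) * P)"
proof -
  let ?X = "\<lambda>y. ennreal (exp (4 * pi * (u y)^2) - 1)"
  let ?e = "\<lambda>y. ennreal ((norm (g y))^2)"
  let ?low = "\<lambda>m y. indicator {y. \<bar>u y\<bar> \<le> m} y"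
  let ?up = "\<lambda>t y. indicator {y. t < \<bar>u y\<bar>} y"
  let ?K = "184 * 5 * exp 4"
  note [measurable] = gradient_borel_measurable[OF der cont]
  define \<mu> where "\<mu> t = emeasure lborel {y. t < \<bar>u y\<bar>}" for t
  have \<mu>_mono: "\<mu> t \<le> \<mu> s" if "s \<le> t" for s t
    unfolding \<mu>_def by (rule emeasure_mono) (use that in auto)
  define \<epsilon> where "\<epsilon> m = enn2real (\<integral>\<^sup>+y. ?e y * ?low m y \<partial>lborel)" for m
  have \<epsilon>: "(\<integral>\<^sup>+y. ?e y * ?low m y \<partial>lborel) = ennreal (\<epsilon> m)" "0 \<le> \<epsilon> m" "\<epsilon> m \<le> 1" for m
  proof -
    have "(\<integral>\<^sup>+y. ?e y * ?low m y \<partial>lborel) \<le> (\<integral>\<^sup>+y. ?e y \<partial>lborel)"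
      by (intro nn_integral_mono) (auto simp: indicator_def)
    also note energy
    finally have le: "(\<integral>\<^sup>+y. ?e y * ?low m y \<partial>lborel) \<le> 1" .
    then show eq: "(\<integral>\<^sup>+y. ?e y * ?low m y \<partial>lborel) = ennreal (\<epsilon> m)"
      using le_less_trans[OF le, of \<infinity>] unfolding \<epsilon>_def by simp
    show "0 \<le> \<epsilon> m" by (simp add: \<epsilon>_def)
    then show "\<epsilon> m \<le> 1" using le unfolding eq by simp
  qed
  \<comment> \<open>Chebyshev's inequality for |u| truncated at t. The levels s and t are kept apart
    so that s can approach the cut from below while the energy stays the one at the cut.\<close>
  have mass: "ennreal (s^2) * \<mu> s \<le> ennreal (P * \<epsilon> t)" if st: "0 \<le> s" "s \<le> t" "0 < t" for s t
  proof -
    have "ennreal (s^2) * \<mu> s = (\<integral>\<^sup>+y. ennreal (s^2) * ?up s y \<partial>lborel)"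
      unfolding \<mu>_def by (rule nn_integral_cmult_indicator[symmetric]) measurable
    also have "\<dots> \<le> (\<integral>\<^sup>+y. ennreal ((min \<bar>u y\<bar> t)^2) \<partial>lborel)"
    proof (rule nn_integral_mono)
      fix y
      have "s^2 \<le> (min \<bar>u y\<bar> t)^2" if "s < \<bar>u y\<bar>" using that st by (intro power_mono) auto
      then show "ennreal (s^2) * ?up s y \<le> ennreal ((min \<bar>u y\<bar> t)^2)"
        by (simp add: indicator_def ennreal_leI)
    qed
    also have "\<dots> \<le> ennreal P * ennreal (\<epsilon> t)"
      using poincare[OF st(3)] unfolding \<epsilon> .
    also have "\<dots> = ennreal (P * \<epsilon> t)" using P \<epsilon> by (simp add: ennreal_mult)
    finally show ?thesis .
  qed
  define T where "T = {t. 0 \<le> t \<and> \<mu> t \<le> 1}"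
  have "sqrt P \<in> T"
  proof -
    have "ennreal P * \<mu> (sqrt P) \<le> ennreal (P * \<epsilon> (sqrt P))"
      using mass[of "sqrt P" "sqrt P"] P by simp
    also have "\<dots> \<le> ennreal P * 1" using P \<epsilon>[of "sqrt P"] by (simp add: ennreal_leI mult_left_le)
    finally have "\<mu> (sqrt P) \<le> 1" using P by (subst (asm) ennreal_mult_le_mult_iff) auto
    then show ?thesis using P by (simp add: T_def)
  qed
  then have T_ne: "T \<noteq> {}" by auto
  have T_bdd: "bdd_below T" by (rule bdd_belowI[of _ 0]) (simp add: T_def)
  define t where "t = Inf T"
  have t0: "0 \<le> t" unfolding t_def by (rule cInf_greatest[OF T_ne]) (simp add: T_def)
  have \<mu>_above: "\<mu> s \<le> 1" if s: "t < s" for s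
  proof -
    obtain r where "r \<in> T" "r < s" using cInf_lessD[OF T_ne] s unfolding t_def by blast
    then show ?thesis using \<mu>_mono[of r s] by (auto simp: T_def)
  qed
  have \<mu>_t: "\<mu> t \<le> 1"
  proof -
    have eq: "{y. t < \<bar>u y\<bar>} = (\<Union>n. {y. t + 1 / real (Suc n) < \<bar>u y\<bar>})"
    proof (intro equalityI subsetI)
      fix y assume "y \<in> {y. t < \<bar>u y\<bar>}"
      then obtain n where "inverse (real (Suc n)) < \<bar>u y\<bar> - t"
        using reals_Archimedean[of "\<bar>u y\<bar> - t"] by auto
      then show "y \<in> (\<Union>n. {y. t + 1 / real (Suc n) < \<bar>u y\<bar>})" by (auto simp: inverse_eq_divide algebra_simps intro!: exI[of _ n])
    next
      fix y assume "y \<in> (\<Union>n. {y. t + 1 / real (Suc n) < \<bar>u y\<bar>})"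
      then obtain n where "t + 1 / real (Suc n) < \<bar>u y\<bar>" by auto
      moreover have "0 < 1 / real (Suc n)" by simp
      ultimately have "t < \<bar>u y\<bar>" by linarith
      then show "y \<in> {y. t < \<bar>u y\<bar>}" by simp
    qed
    have "incseq (\<lambda>n. {y. t + 1 / real (Suc n) < \<bar>u y\<bar>})"
    proof (rule incseq_SucI, rule subsetI)
      fix n y assume "y \<in> {y. t + 1 / real (Suc n) < \<bar>u y\<bar>}"
      moreover have "1 / real (Suc (Suc n)) \<le> 1 / real (Suc n)" by (intro divide_left_mono) auto
      ultimately show "y \<in> {y. t + 1 / real (Suc (Suc n)) < \<bar>u y\<bar>}" by simp
    qed
    then have "(SUP n. emeasure lborel {y. t + 1 / real (Suc n) < \<bar>u y\<bar>}) = emeasure lborel (\<Union>n. {y. t + 1 / real (Suc n) < \<bar>u y\<bar>})"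
      by (intro SUP_emeasure_incseq) auto
    then have "\<mu> t = (SUP n. \<mu> (t + 1 / real (Suc n)))"
      unfolding \<mu>_def eq by simp
    also have "\<dots> \<le> 1" by (intro SUP_least \<mu>_above) simp
    finally show ?thesis .
  qed
  \<comment> \<open>Since |u| may equal t on a set of positive measure, the superlevel set at t
    itself may be far too small for Chebyshev. Every nonnegative s < t lies outside
    \<open>T\<close>, hence has measure above one, and \<open>mass\<close> bounds s^2; letting s
    approach t gives the claim.\<close>
  have t2: "t^2 \<le> P * \<epsilon> t"
  proof (cases "t = 0")
    case True
    then show ?thesis using P \<epsilon>[of t] by simp
  next
    case False
    then have tp: "0 < t" using t0 by simp
    show ?thesis
    proof (rule ccontr)
      assume "\<not> t^2 \<le> P * \<epsilon> t"
      then have "sqrt (P * \<epsilon> t) < t" using tp by (intro real_less_lsqrt) auto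
      then obtain s where s: "sqrt (P * \<epsilon> t) < s" "s < t" using dense by blast
      have s0: "0 \<le> sqrt (P * \<epsilon> t)" using P \<epsilon>[of t] by simp
      have "s \<notin> T" using s cInf_lower[OF _ T_bdd, of s] by (auto simp: t_def)
      then have "1 \<le> \<mu> s" using s s0 by (simp add: T_def)
      then have "ennreal (s^2) * 1 \<le> ennreal (s^2) * \<mu> s" by (rule mult_left_mono) simp
      also have "\<dots> \<le> ennreal (P * \<epsilon> t)" using mass[of s t] s s0 tp by simp
      finally have "s^2 \<le> P * \<epsilon> t" using P \<epsilon>[of t] by simp
      moreover have "(sqrt (P * \<epsilon> t))^2 < s^2" using s s0 by (intro power_strict_mono) auto
      ultimately show False using P \<epsilon>[of t] by simp
    qed
  qed
  \<comment> \<open>All the energy may lie below the cut, and then 1 - \<epsilon> t vanishes. The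
    cap at 1 / 2 keeps the denominator 1 - \<delta> positive, at the price of a factor 2 in t^2
    \<le> 2 P \<delta>.\<close>
  define \<delta> where "\<delta> = min (\<epsilon> t) (1 / 2)"
  have \<delta>: "0 \<le> \<delta>" "\<delta> \<le> 1 / 2" "\<delta> \<le> \<epsilon> t" using \<epsilon>[of t] by (auto simp: \<delta>_def)
  have t2\<delta>: "t^2 \<le> 2 * P * \<delta>"
  proof (cases "\<epsilon> t \<le> 1 / 2")
    case True
    have "P * \<epsilon> t \<le> 2 * P * \<epsilon> t" using P \<epsilon>[of t] by simp
    then show ?thesis using t2 True by (simp add: \<delta>_def min_def)
  next
    case False
    have "P * \<epsilon> t \<le> P * 1" using P \<epsilon>[of t] by (intro mult_left_mono) auto
    then show ?thesis using t2 False by (simp add: \<delta>_def)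
  qed
  have tP: "t^2 \<le> P" using t2 P mult_left_mono[of "\<epsilon> t" 1 P] \<epsilon>[of t] by linarith
  have upper_energy: "(\<integral>\<^sup>+y. ?e y * ?up t y \<partial>lborel) \<le> ennreal (1 - \<delta>)"
  proof -
    have "(\<integral>\<^sup>+y. ?e y * ?up t y \<partial>lborel) + ennreal (\<epsilon> t)
      = (\<integral>\<^sup>+y. ?e y * ?up t y + ?e y * ?low t y \<partial>lborel)"
      unfolding \<epsilon>(1)[symmetric] by (rule nn_integral_add[symmetric]) measurable
    also have "\<dots> = (\<integral>\<^sup>+y. ?e y \<partial>lborel)"
      by (intro nn_integral_cong) (auto simp: indicator_def)
    also note energy
    finally have "(\<integral>\<^sup>+y. ?e y * ?up t y \<partial>lborel) \<le> 1 - ennreal (\<epsilon> t)"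
      by (simp add: ennreal_le_minus_iff add.commute)
    also have "1 - ennreal (\<epsilon> t) = ennreal (1 - \<epsilon> t)"
      using \<epsilon>[of t] by (simp add: ennreal_minus flip: ennreal_1)
    also have "\<dots> \<le> ennreal (1 - \<delta>)" using \<delta> by (intro ennreal_leI) auto
    finally show ?thesis .
  qed
  have square: "(u y)^2 \<le> (\<bar>u y\<bar> - t)^2 / (1 - \<delta>) + 2 * P" for y
  proof (cases "\<delta> = 0")
    case True
    then have "t = 0" using t2\<delta> by simp
    then show ?thesis using True P by simp
  next
    case False
    then have d: "0 < \<delta>" "\<delta> < 1" using \<delta> by auto
    have "(u y)^2 = ((\<bar>u y\<bar> - t) + t)^2" by simp
    also have "\<dots> \<le> (\<bar>u y\<bar> - t)^2 / (1 - \<delta>) + t^2 / \<delta>"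
      by (rule square_sum_le_weighted[OF d])
    also have "t^2 / \<delta> \<le> 2 * P" using t2\<delta> d by (simp add: field_simps)
    finally show ?thesis by simp
  qed
  have high: "(\<integral>\<^sup>+y. ?X y * ?up t y \<partial>lborel)
    \<le> ennreal (exp (8 * pi * P) * (?K))"
  proof -
    have "(\<integral>\<^sup>+y. ?X y * ?up t y \<partial>lborel)
      \<le> (\<integral>\<^sup>+y. ennreal (exp (8 * pi * P)) * (ennreal (exp (4 * pi * (\<bar>u y\<bar> - t)^2 / (1 - \<delta>))) * ?up t y) \<partial>lborel)"
    proof (rule nn_integral_mono)
      fix y
      have "4 * pi * (u y)^2 \<le> 4 * pi * ((\<bar>u y\<bar> - t)^2 / (1 - \<delta>) + 2 * P)"
        using square[of y] by (intro mult_left_mono) auto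
      also have "\<dots> = 8 * pi * P + 4 * pi * (\<bar>u y\<bar> - t)^2 / (1 - \<delta>)" by (simp add: algebra_simps)
      finally have "exp (4 * pi * (u y)^2) \<le> exp (8 * pi * P) * exp (4 * pi * (\<bar>u y\<bar> - t)^2 / (1 - \<delta>))"
        by (simp flip: exp_add)
      then have "?X y \<le> ennreal (exp (8 * pi * P) * exp (4 * pi * (\<bar>u y\<bar> - t)^2 / (1 - \<delta>)))"
        by (intro ennreal_leI) linarith
      then show "?X y * ?up t y
        \<le> ennreal (exp (8 * pi * P)) * (ennreal (exp (4 * pi * (\<bar>u y\<bar> - t)^2 / (1 - \<delta>))) * ?up t y)"
        by (simp add: indicator_def ennreal_mult)
    qed
    also have "\<dots> = ennreal (exp (8 * pi * P)) * (\<integral>\<^sup>+y. ennreal (exp (4 * pi * (\<bar>u y\<bar> - t)^2 / (1 - \<delta>))) * ?up t y \<partial>lborel)"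
      by (rule nn_integral_cmult) measurable
    also have "\<dots> \<le> ennreal (exp (8 * pi * P)) * ennreal (?K)"
      by (intro mult_left_mono moser_trudinger_superlevel[OF der cont bd t0 _ _ upper_energy])
         (use \<mu>_t \<delta> in \<open>auto simp: \<mu>_def\<close>)
    finally show ?thesis by (simp add: ennreal_mult)
  qed
  have low: "(\<integral>\<^sup>+y. ?X y * ?low t y \<partial>lborel)
    \<le> ennreal (4 * pi * exp (4 * pi * P) * P)"
  proof (cases "t = 0")
    case True
    have "(\<integral>\<^sup>+y. ?X y * ?low t y \<partial>lborel) = (\<integral>\<^sup>+(y :: real ^ 2). 0 \<partial>lborel)"
      by (intro nn_integral_cong) (auto simp: indicator_def True)
    then show ?thesis by simp
  next
    case False
    then have tp: "0 < t" using t0 by simp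
    have "(\<integral>\<^sup>+y. ?X y * ?low t y \<partial>lborel)
      \<le> (\<integral>\<^sup>+y. ennreal (4 * pi * exp (4 * pi * P)) * ennreal ((min \<bar>u y\<bar> t)^2) \<partial>lborel)"
    proof (rule nn_integral_mono)
      fix y
      show "?X y * ?low t y
        \<le> ennreal (4 * pi * exp (4 * pi * P)) * ennreal ((min \<bar>u y\<bar> t)^2)"
      proof (cases "\<bar>u y\<bar> \<le> t")
        case True
        then have "(u y)^2 \<le> t^2" using power_mono[of "\<bar>u y\<bar>" t 2] by simp
        then have uP: "(u y)^2 \<le> P" using tP by simp
        have "exp (4 * pi * (u y)^2) - 1 \<le> 4 * pi * (u y)^2 * exp (4 * pi * (u y)^2)" by (rule exp_minus_one_le)
        also have "\<dots> \<le> 4 * pi * (u y)^2 * exp (4 * pi * P)" using uP by (intro mult_left_mono) auto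
        finally have "exp (4 * pi * (u y)^2) - 1 \<le> 4 * pi * exp (4 * pi * P) * (u y)^2" by (simp add: mult_ac)
        then have "?X y \<le> ennreal (4 * pi * exp (4 * pi * P)) * ennreal ((u y)^2)"
          by (subst ennreal_mult[symmetric]) (auto intro: ennreal_leI)
        then show ?thesis using True by (simp add: min_def)
      qed simp
    qed
    also have "\<dots> = ennreal (4 * pi * exp (4 * pi * P)) * (\<integral>\<^sup>+y. ennreal ((min \<bar>u y\<bar> t)^2) \<partial>lborel)"
      by (rule nn_integral_cmult) measurable
    also have "\<dots> \<le> ennreal (4 * pi * exp (4 * pi * P)) * (ennreal P * ennreal (\<epsilon> t))"
      by (intro mult_left_mono) (use poincare[OF tp] in \<open>auto simp: \<epsilon>\<close>)
    also have "\<dots> \<le> ennreal (4 * pi * exp (4 * pi * P)) * (ennreal P * 1)"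
      using \<epsilon>[of t] by (intro mult_left_mono) auto
    finally show ?thesis using P by (simp add: ennreal_mult)
  qed
  have "(\<integral>\<^sup>+y. ?X y \<partial>lborel)
    = (\<integral>\<^sup>+y. ?X y * ?up t y
        + ?X y * ?low t y \<partial>lborel)"
    by (intro nn_integral_cong) (auto simp: indicator_def)
  also have "\<dots> = (\<integral>\<^sup>+y. ?X y * ?up t y \<partial>lborel)
    + (\<integral>\<^sup>+y. ?X y * ?low t y \<partial>lborel)"
    by (rule nn_integral_add) measurable
  also have "\<dots> \<le> ennreal (exp (8 * pi * P) * (?K)) + ennreal (4 * pi * exp (4 * pi * P) * P)"
    by (rule add_mono[OF high low])
  also have "\<dots> = ennreal (exp (8 * pi * P) * (?K) + 4 * pi * exp (4 * pi * P) * P)"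
    using P by (intro ennreal_plus[symmetric]) auto
  finally show ?thesis .
qed

section \<open>Test functions\<close>

text \<open>\<open>gradient\<close> is a definite description, so it is identified through
  uniqueness of the derivative. The coordinate formula is what transfers continuity of the
  directional derivatives to it.\<close>

lemma gradient_has_derivative:
  assumes "u differentiable at x"
  shows "(u has_derivative (\<lambda>h. gradient u x \<bullet> h)) (at x)"
    and "gradient u x = (\<Sum>b\<in>Basis. frechet_derivative u (at x) b *\<^sub>R b)"
proof -
  define D where "D = (\<Sum>b\<in>Basis. frechet_derivative u (at x) b *\<^sub>R b)"
  have fd: "(u has_derivative frechet_derivative u (at x)) (at x)"
    using assms frechet_derivative_works by blast
  then interpret linear "frechet_derivative u (at x)" by (rule has_derivative_linear)
  have "frechet_derivative u (at x) h = D \<bullet> h" for h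
  proof -
    have "frechet_derivative u (at x) h = frechet_derivative u (at x) (\<Sum>b\<in>Basis. (h \<bullet> b) *\<^sub>R b)"
      by (simp add: euclidean_representation)
    also have "\<dots> = D \<bullet> h" by (simp add: sum scale D_def inner_sum_left inner_commute[of h] mult.commute)
    finally show ?thesis .
  qed
  then have der: "(u has_derivative (\<lambda>h. D \<bullet> h)) (at x)" using fd by (metis (no_types, lifting) ext)
  have "gradient u x = D" unfolding gradient_def gderiv_def
  proof (rule the_equality)
    show "(u has_derivative (\<lambda>h. h \<bullet> D)) (at x)" using der by (simp add: inner_commute)
    fix E assume "(u has_derivative (\<lambda>h. h \<bullet> E)) (at x)"
    then have "(\<lambda>h. h \<bullet> E) = (\<lambda>h. D \<bullet> h)" using der by (rule has_derivative_unique)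
    then have "h \<bullet> E = h \<bullet> D" for h by (metis inner_commute)
    then show "E = D" by (rule vector_eq_ldot[THEN iffD1, rule_format])
  qed
  then show "gradient u x = (\<Sum>b\<in>Basis. frechet_derivative u (at x) b *\<^sub>R b)"
    and "(u has_derivative (\<lambda>h. gradient u x \<bullet> h)) (at x)"
    using der by (simp_all add: D_def)
qed

section \<open>Energy and norms of test functions\<close>

lemma C0_infinityD:
  assumes "u \<in> C0_infinity \<Omega>"
  shows "(u has_derivative (\<lambda>h. gradient u x \<bullet> h)) (at x)"
    and "continuous_on UNIV (gradient u)" and "continuous_on UNIV u"
    and "bounded {x. u x \<noteq> 0}" and "x \<notin> \<Omega> \<Longrightarrow> u x = 0" and "x \<notin> \<Omega> \<Longrightarrow> gradient u x = 0"
    and "\<exists>K. compact K \<and> (\<forall>x. x \<notin> K \<longrightarrow> u x = 0 \<and> gradient u x = 0)"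
proof -
  define K where "K = closure (support_on UNIV u)"
  have K: "compact K" "K \<subseteq> \<Omega>" and C: "\<And>n. C_n n u"
    using assms by (auto simp: C0_infinity_def K_def)
  have diff: "u differentiable at x" for x using C[of "Suc 0"] by simp
  show der: "(u has_derivative (\<lambda>h. gradient u x \<bullet> h)) (at x)" for x
    by (rule gradient_has_derivative[OF diff])
  have "continuous_on UNIV (\<lambda>x. frechet_derivative u (at x) v)" for v
    using C[of "Suc 0"] by simp
  then show "continuous_on UNIV (gradient u)"
    unfolding gradient_has_derivative(2)[OF diff, abs_def] by (intro continuous_intros) auto
  show "continuous_on UNIV u" using C[of 0] by simp
  have u0: "u x = 0" if "x \<notin> K" for x
  proof (rule ccontr)
    assume "u x \<noteq> 0"
    then have "x \<in> support_on UNIV u" by (simp add: support_on_def)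
    then show False using that closure_subset unfolding K_def by blast
  qed
  then have "{x. u x \<noteq> 0} \<subseteq> K" by blast
  then show "bounded {x. u x \<noteq> 0}" using compact_imp_bounded[OF K(1)] bounded_subset by blast
  have g0: "gradient u x = 0" if x: "x \<notin> K" for x
  proof -
    have "open (- K)" using compact_imp_closed[OF K(1)] by (simp add: open_Compl)
    have "((\<lambda>_. 0) has_derivative (\<lambda>h. gradient u x \<bullet> h)) (at x)"
      by (rule has_derivative_transform_within_open[OF der \<open>open (- K)\<close>]) (use x u0 in auto)
    then have "(\<lambda>h. gradient u x \<bullet> h) = (\<lambda>h. 0)"
      using has_derivative_const by (rule has_derivative_unique)
    then have "gradient u x \<bullet> gradient u x = 0" by (rule fun_cong)
    then show ?thesis by simp
  qed
  show "u x = 0" if "x \<notin> \<Omega>" for x using that u0 K by blast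
  show "gradient u x = 0" if "x \<notin> \<Omega>" for x using that g0 K by blast
  show "\<exists>K. compact K \<and> (\<forall>x. x \<notin> K \<longrightarrow> u x = 0 \<and> gradient u x = 0)"
    using K u0 g0 by blast
qed

text \<open>Links the Bochner integrals of the statement to the nonnegative integrals of the
  estimates. Continuity and compact support give integrability, so the default value 0 never
  intervenes.\<close>

lemma nn_integral_eq_set_integral:
  fixes f :: "real ^ 2 \<Rightarrow> real"
  assumes K: "compact K" "\<And>x. x \<notin> K \<Longrightarrow> f x = 0" and f: "continuous_on UNIV f" "\<And>x. 0 \<le> f x"
    and \<Omega>: "\<And>x. x \<notin> \<Omega> \<Longrightarrow> f x = 0"
  shows "(\<integral>\<^sup>+x. ennreal (f x) \<partial>lborel) = ennreal (LINT x:\<Omega>|lborel. f x)"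
    and "0 \<le> (LINT x:\<Omega>|lborel. f x)"
proof -
  have eq: "(\<lambda>x. indicator \<Omega> x *\<^sub>R f x) = f" using \<Omega> by (auto simp: indicator_def fun_eq_iff)
  have eq': "(\<lambda>x. indicator K x *\<^sub>R f x) = f" using K by (auto simp: indicator_def fun_eq_iff)
  have "integrable lborel (\<lambda>x. indicator K x *\<^sub>R f x)"
    by (rule borel_integrable_compact[OF K(1)]) (use f continuous_on_subset in blast)
  then have int: "integrable lborel f" by (simp only: eq')
  have L: "(LINT x:\<Omega>|lborel. f x) = integral\<^sup>L lborel f"
    by (simp only: set_lebesgue_integral_def eq)
  show "(\<integral>\<^sup>+x. ennreal (f x) \<partial>lborel) = ennreal (LINT x:\<Omega>|lborel. f x)"
    unfolding L by (rule nn_integral_eq_integral[OF int]) (use f in simp)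
  show "0 \<le> (LINT x:\<Omega>|lborel. f x)" unfolding L using f by (simp add: integral_nonneg_AE)
qed

abbreviation (input) dirichlet_energy :: "(real ^ 2) set \<Rightarrow> (real ^ 2 \<Rightarrow> real) \<Rightarrow> real" where
  "dirichlet_energy \<Omega> u \<equiv> (LINT x:\<Omega>|lborel. (norm (gradient u x))^2)"

lemma C0_infinity_energy:
  assumes u: "u \<in> C0_infinity \<Omega>"
  shows "(\<integral>\<^sup>+x. ennreal ((norm (gradient u x))^2) \<partial>lborel) = ennreal (dirichlet_energy \<Omega> u)"
    and "0 \<le> dirichlet_energy \<Omega> u"
proof -
  let ?e = "\<lambda>x. (norm (gradient u x))^2"
  obtain K where K: "compact K" "\<And>x. x \<notin> K \<Longrightarrow> gradient u x = 0"
    using C0_infinityD(7)[OF u] by blast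
  have c: "continuous_on UNIV (\<lambda>x. ?e x)"
    using C0_infinityD(2)[OF u] by (intro continuous_intros)
  show "(\<integral>\<^sup>+x. ennreal (?e x) \<partial>lborel) = ennreal (dirichlet_energy \<Omega> u)"
    by (rule nn_integral_eq_set_integral[OF K(1) _ c]) (use K C0_infinityD(6)[OF u] in auto)
  show "0 \<le> dirichlet_energy \<Omega> u"
    by (rule nn_integral_eq_set_integral[OF K(1) _ c]) (use K C0_infinityD(6)[OF u] in auto)
qed

lemma C0_infinity_powr_norm:
  assumes u: "u \<in> C0_infinity \<Omega>" and q: "0 < q"
  shows "(\<integral>\<^sup>+x. ennreal (\<bar>u x\<bar> powr q) \<partial>lborel) = ennreal (LINT x:\<Omega>|lborel. \<bar>u x\<bar> powr q)"
    and "0 \<le> (LINT x:\<Omega>|lborel. \<bar>u x\<bar> powr q)"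
proof -
  obtain K where K: "compact K" "\<And>x. x \<notin> K \<Longrightarrow> u x = 0"
    using C0_infinityD(7)[OF u] by blast
  have c: "continuous_on UNIV (\<lambda>x. \<bar>u x\<bar> powr q)"
    using C0_infinityD(3)[OF u] q by (intro continuous_on_powr' continuous_intros) auto
  show "(\<integral>\<^sup>+x. ennreal (\<bar>u x\<bar> powr q) \<partial>lborel) = ennreal (LINT x:\<Omega>|lborel. \<bar>u x\<bar> powr q)"
    by (rule nn_integral_eq_set_integral[OF K(1) _ c]) (use K C0_infinityD(5)[OF u] in auto)
  show "0 \<le> (LINT x:\<Omega>|lborel. \<bar>u x\<bar> powr q)"
    by (rule nn_integral_eq_set_integral[OF K(1) _ c]) (use K C0_infinityD(5)[OF u] in auto)
qed

text \<open>The Riesz bound at level 0 holds at every point, so a potential that vanishes almost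
  everywhere in its integrand gives u = 0 everywhere. The disjunction covers two uses: vanishing
  energy, and vanishing integral of a power of |u|.\<close>

lemma AE_riesz_zero_imp_zero:
  assumes u: "u \<in> C0_infinity \<Omega>" and ae: "AE y in lborel. gradient u y = 0 \<or> u y = 0"
  shows "u = (\<lambda>x. 0)"
proof
  fix x
  let ?f = "\<lambda>y. ennreal (norm (gradient u y)) * indicator {y. 0 < \<bar>u y\<bar>} y * ennreal (1 / norm (y - x))"
  have ae: "AE y in lborel. ?f y = 0"
    using ae by eventually_elim auto
  have "ennreal (2 * pi * (\<bar>u x\<bar> - 0))
    \<le> (\<integral>\<^sup>+y. ?f y \<partial>lborel)"
    by (rule riesz_potential_bound[OF C0_infinityD(1)[OF u] C0_infinityD(2)[OF u] C0_infinityD(4)[OF u]]) simp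
  also have "\<dots> = (\<integral>\<^sup>+(y :: real ^ 2). 0 \<partial>lborel)"
    by (rule nn_integral_cong_AE[OF ae])
  finally have "2 * pi * \<bar>u x\<bar> \<le> 0" by (simp add: ennreal_eq_0_iff)
  then show "u x = 0" using pi_gt_zero by (auto simp: mult_le_0_iff)
qed

lemma gradient_zero_imp_zero:
  assumes u: "u \<in> C0_infinity \<Omega>" and E: "dirichlet_energy \<Omega> u = 0"
  shows "u = (\<lambda>x. 0)"
proof (rule AE_riesz_zero_imp_zero[OF u])
  have [measurable]: "gradient u \<in> borel_measurable borel"
    using C0_infinityD(2)[OF u] by (rule borel_measurable_continuous_onI)
  have "(\<integral>\<^sup>+x. ennreal ((norm (gradient u x))^2) \<partial>lborel) = 0"
    using C0_infinity_energy(1)[OF u] E by simp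
  then have "AE x in lborel. gradient u x = 0" by (subst (asm) nn_integral_0_iff_AE) auto
  then show "AE y in lborel. gradient u y = 0 \<or> u y = 0" by eventually_elim simp
qed

lemma C_n_cmult: "C_n n u \<Longrightarrow> C_n n (\<lambda>x. c * u x)"
proof (induction n arbitrary: u)
  case 0
  then show ?case by (auto intro!: continuous_intros)
next
  case (Suc n)
  then have d: "u differentiable at x" and C: "C_n n (\<lambda>x. frechet_derivative u (at x) v)" for x v by auto
  have der: "((\<lambda>x. c * u x) has_derivative (\<lambda>v. c * frechet_derivative u (at x) v)) (at x)" for x
    using d[of x] by (intro has_derivative_mult_right) (simp add: frechet_derivative_works)
  then have "frechet_derivative (\<lambda>x. c * u x) (at x) = (\<lambda>v. c * frechet_derivative u (at x) v)" for x
    using frechet_derivative_at by metis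
  moreover have "(\<lambda>x. c * u x) differentiable at x" for x using der by (rule differentiableI)
  ultimately show ?case using Suc.IH[OF C] by simp
qed

lemma C0_infinity_cmult:
  assumes u: "u \<in> C0_infinity \<Omega>" and c: "c \<noteq> 0"
  shows "(\<lambda>x. c * u x) \<in> C0_infinity \<Omega>" "gradient (\<lambda>x. c * u x) x = c *\<^sub>R gradient u x"
proof -
  have "support_on UNIV (\<lambda>x. c * u x) = support_on UNIV u"
    using c by (auto simp: support_on_def)
  then show 1: "(\<lambda>x. c * u x) \<in> C0_infinity \<Omega>"
    using u by (auto simp: C0_infinity_def C_n_cmult)
  have "((\<lambda>x. c * u x) has_derivative (\<lambda>h. c * (gradient u x \<bullet> h))) (at x)"
    by (intro has_derivative_mult_right C0_infinityD(1)[OF u])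
  from has_derivative_unique[OF C0_infinityD(1)[OF 1] this]
  have "gradient (\<lambda>x. c * u x) x \<bullet> h = (c *\<^sub>R gradient u x) \<bullet> h" for h by (simp add: fun_eq_iff)
  then show "gradient (\<lambda>x. c * u x) x = c *\<^sub>R gradient u x" by (rule vector_eq_rdot[THEN iffD1, rule_format])
qed

lemma C0_infinity_normalize:
  assumes u: "u \<in> C0_infinity \<Omega>" and E: "E = dirichlet_energy \<Omega> u" "0 < E"
  shows "(\<lambda>x. (1 / sqrt E) * u x) \<in> C0_infinity \<Omega>"
    and "dirichlet_energy \<Omega> (\<lambda>x. (1 / sqrt E) * u x) = 1"
proof -
  let ?v = "(\<lambda>x. (1 / sqrt E) * u x)"
  have c: "1 / sqrt E \<noteq> 0" using E(2) by simp
  show "?v \<in> C0_infinity \<Omega>" by (rule C0_infinity_cmult(1)[OF u c])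
  have "(norm (gradient ?v x))^2 = (1 / E) * (norm (gradient u x))^2" for x
    unfolding C0_infinity_cmult(2)[OF u c] using E(2) by (simp add: power_mult_distrib power_divide)
  then have "dirichlet_energy \<Omega> ?v = (1 / E) * E"
    unfolding E(1) by simp
  then show "dirichlet_energy \<Omega> ?v = 1"
    using E(2) by simp
qed

section \<open>Smooth functions of compact support\<close>

definition flat_exp :: "real poly \<Rightarrow> real \<Rightarrow> real" where
  "flat_exp p z = (if 0 < z then poly p (1 / z) * exp (- (1 / z)) else 0)"

lemma poly_div_exp_tendsto_0: "((\<lambda>w. poly p w / exp w) \<longlongrightarrow> 0) at_top" for p :: "real poly"
proof -
  have "((\<lambda>w. \<Sum>i\<le>degree p. coeff p i * (w ^ i / exp w)) \<longlongrightarrow> (\<Sum>i\<le>degree p. coeff p i * 0)) at_top"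
    by (intro tendsto_sum tendsto_mult tendsto_const tendsto_power_div_exp_0)
  then show ?thesis by (simp add: poly_altdef sum_divide_distrib)
qed

text \<open>For w = 1 / z one has dw / dz = - w^2, so p(w) exp (- w) has z-derivative w^2 (p(w) -
  p'(w)) exp (- w): the family reproduces itself under differentiation. At 0 the exponential beats
  every polynomial in 1 / z.\<close>

lemma flat_exp_derivative:
  "(flat_exp p has_real_derivative flat_exp (monom 1 2 * (p - pderiv p)) z) (at z)"
proof -
  let ?q = "(monom 1 2 * (p - pderiv p))"
  consider "0 < z" | "z < 0" | "z = 0" by linarith
  then show ?thesis
  proof cases
    case 1
    have "((\<lambda>z. poly p (1 / z) * exp (- (1 / z))) has_real_derivative
      poly (pderiv p) (1 / z) * (- 1 / z^2) * exp (- (1 / z)) + poly p (1 / z) * (exp (- (1 / z)) * (1 / z^2))) (at z)"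
      using 1 by (auto intro!: derivative_eq_intros DERIV_chain2[OF poly_DERIV] simp: power2_eq_square)
    moreover have "poly (pderiv p) (1 / z) * (- 1 / z^2) * exp (- (1 / z)) + poly p (1 / z) * (exp (- (1 / z)) * (1 / z^2))
      = flat_exp ?q z"
      using 1 by (simp add: flat_exp_def poly_monom field_simps)
    ultimately have "((\<lambda>z. poly p (1 / z) * exp (- (1 / z))) has_real_derivative flat_exp ?q z) (at z)"
      by simp
    then show ?thesis
      by (rule has_field_derivative_transform_within_open[where S = "{0<..}"]) (use 1 in \<open>auto simp: flat_exp_def\<close>)
  next
    case 2
    have "((\<lambda>z. 0) has_real_derivative 0) (at z)" by simp
    then have "(flat_exp p has_real_derivative 0) (at z)"
      by (rule has_field_derivative_transform_within_open[where S = "{..<0}"]) (use 2 in \<open>auto simp: flat_exp_def\<close>)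
    then show ?thesis using 2 by (simp add: flat_exp_def)
  next
    case 3
    \<comment> \<open>The polynomial \<open>pCons 0 p\<close> is w p(w); the extra factor w = 1 / h
      comes from the difference quotient.\<close>
    have "((\<lambda>w. poly (pCons 0 p) w / exp w) \<longlongrightarrow> 0) at_top" by (rule poly_div_exp_tendsto_0)
    from filterlim_compose[OF this filterlim_inverse_at_top_right]
    have "((\<lambda>h. poly (pCons 0 p) (1 / h) / exp (1 / h)) \<longlongrightarrow> 0) (at_right (0 :: real))"
      by (simp only: inverse_eq_divide)
    moreover have "\<forall>\<^sub>F h in at_right (0 :: real). poly (pCons 0 p) (1 / h) / exp (1 / h) = flat_exp p h / h"
      using eventually_at_right_less[of "0 :: real"]
      by eventually_elim (simp add: flat_exp_def exp_minus field_simps)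
    ultimately have R: "((\<lambda>h. flat_exp p h / h) \<longlongrightarrow> 0) (at_right 0)"
      by (rule Lim_transform_eventually)
    have "\<forall>\<^sub>F h in at_left (0 :: real). 0 = flat_exp p h / h"
      by (auto simp: eventually_at_filter flat_exp_def)
    then have L: "((\<lambda>h. flat_exp p h / h) \<longlongrightarrow> 0) (at_left 0)"
      by (rule Lim_transform_eventually[OF tendsto_const])
    have "((\<lambda>h. flat_exp p h / h) \<longlongrightarrow> 0) (at 0)" using L R by (simp add: filterlim_split_at)
    then have "(flat_exp p has_real_derivative 0) (at 0)"
      by (simp add: has_field_derivative_iff flat_exp_def)
    then show ?thesis using 3 by (simp add: flat_exp_def)
  qed
qed

text \<open>Closed under directional derivatives, hence contained in every class \<open>C_n\<close>.\<close>

inductive_set smooth_family :: "(real ^ 2 \<Rightarrow> real) set" where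
  const: "(\<lambda>x. c) \<in> smooth_family"
| linear: "(\<lambda>x. x \<bullet> v) \<in> smooth_family"
| add: "f \<in> smooth_family \<Longrightarrow> g \<in> smooth_family \<Longrightarrow> (\<lambda>x. f x + g x) \<in> smooth_family"
| mult: "f \<in> smooth_family \<Longrightarrow> g \<in> smooth_family \<Longrightarrow> (\<lambda>x. f x * g x) \<in> smooth_family"
| flat_exp: "f \<in> smooth_family \<Longrightarrow> (\<lambda>x. flat_exp p (f x)) \<in> smooth_family"
| inverse: "f \<in> smooth_family \<Longrightarrow> (\<And>x. 0 < f x) \<Longrightarrow> (\<lambda>x. inverse (f x)) \<in> smooth_family"
| ln: "f \<in> smooth_family \<Longrightarrow> (\<And>x. 0 < f x) \<Longrightarrow> (\<lambda>x. ln (f x)) \<in> smooth_family"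

lemma smooth_family_derivative:
  "f \<in> smooth_family \<Longrightarrow> \<exists>F. (\<forall>x. (f has_derivative F x) (at x)) \<and> (\<forall>v. (\<lambda>x. F x v) \<in> smooth_family)"
proof (induction rule: smooth_family.induct)
  case (const c)
  show ?case by (intro exI[of _ "\<lambda>x h. 0"]) (auto intro: smooth_family.const)
next
  case (linear v)
  show ?case
    by (intro exI[of _ "\<lambda>x h. h \<bullet> v"] conjI allI smooth_family.const
        bounded_linear_imp_has_derivative bounded_linear_inner_left)
next
  case (add f g)
  then obtain F G where F: "\<And>x. (f has_derivative F x) (at x)" "\<And>v. (\<lambda>x. F x v) \<in> smooth_family"
    and G: "\<And>x. (g has_derivative G x) (at x)" "\<And>v. (\<lambda>x. G x v) \<in> smooth_family" by blast
  show ?case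
    by (intro exI[of _ "\<lambda>x h. F x h + G x h"] conjI allI smooth_family.add has_derivative_add F G)
next
  case (mult f g)
  then obtain F G where F: "\<And>x. (f has_derivative F x) (at x)" "\<And>v. (\<lambda>x. F x v) \<in> smooth_family"
    and G: "\<And>x. (g has_derivative G x) (at x)" "\<And>v. (\<lambda>x. G x v) \<in> smooth_family" by blast
  show ?case
    by (intro exI[of _ "\<lambda>x h. f x * G x h + F x h * g x"] conjI allI smooth_family.add smooth_family.mult
        has_derivative_mult F G mult.hyps)
next
  case (flat_exp f p)
  then obtain F where F: "\<And>x. (f has_derivative F x) (at x)" "\<And>v. (\<lambda>x. F x v) \<in> smooth_family" by blast
  show ?case
    by (intro exI[of _ "\<lambda>x h. flat_exp (monom 1 2 * (p - pderiv p)) (f x) * F x h"] conjI allI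
        has_derivative_compose[OF F(1) flat_exp_derivative[unfolded has_field_derivative_def]]
        smooth_family.mult smooth_family.flat_exp F flat_exp.hyps)
next
  case (inverse f)
  then obtain F where F: "\<And>x. (f has_derivative F x) (at x)" "\<And>v. (\<lambda>x. F x v) \<in> smooth_family" by blast
  have "((\<lambda>x. inverse (f x)) has_derivative (\<lambda>h. - (inverse (f x) * F x h * inverse (f x)))) (at x)" for x
    by (rule Deriv.has_derivative_inverse[OF _ F(1)]) (use inverse.hyps(2)[of x] in simp)
  moreover have "(\<lambda>x. - (inverse (f x) * F x v * inverse (f x))) \<in> smooth_family" for v
    using smooth_family.mult[OF smooth_family.const[of "- 1"]
        smooth_family.mult[OF smooth_family.mult[OF smooth_family.inverse[OF inverse.hyps] F(2)[of v]] smooth_family.inverse[OF inverse.hyps]]]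
    by simp
  ultimately show ?case by (intro exI[of _ "\<lambda>x h. - (inverse (f x) * F x h * inverse (f x))"]) auto
next
  case (ln f)
  then obtain F where F: "\<And>x. (f has_derivative F x) (at x)" "\<And>v. (\<lambda>x. F x v) \<in> smooth_family" by blast
  have "((\<lambda>x. ln (f x)) has_derivative (\<lambda>h. inverse (f x) * F x h)) (at x)" for x
    by (rule has_derivative_compose[OF F(1) DERIV_ln[unfolded has_field_derivative_def]]) (use ln.hyps(2) in simp)
  then show ?case
    by (intro exI[of _ "\<lambda>x h. inverse (f x) * F x h"] conjI allI smooth_family.mult
        smooth_family.inverse F(2) ln.hyps)
qed

lemma smooth_family_C_n: "f \<in> smooth_family \<Longrightarrow> C_n n f"
proof (induction n arbitrary: f)
  case 0
  obtain F where "\<And>x. (f has_derivative F x) (at x)" using smooth_family_derivative[OF 0] by blast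
  then show ?case using has_derivative_continuous_on[of UNIV f F] by simp
next
  case (Suc n)
  obtain F where F: "\<And>x. (f has_derivative F x) (at x)" "\<And>v. (\<lambda>x. F x v) \<in> smooth_family"
    using smooth_family_derivative[OF Suc.prems] by blast
  have "frechet_derivative f (at x) = F x" for x using frechet_derivative_at[OF F(1)] by simp
  then show ?case using Suc.IH[OF F(2)] F(1) by (auto intro: differentiableI)
qed

text \<open>A smooth substitute for the positive part: z exp (- 1 / z) for positive z. Its slope is
  at most 1, so composing with it does not increase the energy, and it loses at most 1 in
  height.\<close>

definition smooth_ramp :: "real \<Rightarrow> real" where
  "smooth_ramp z = z * flat_exp 1 z"

lemma smooth_ramp_nonpos: "z \<le> 0 \<Longrightarrow> smooth_ramp z = 0"
  by (simp add: smooth_ramp_def flat_exp_def)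

lemma smooth_ramp_ge: "z - 1 \<le> smooth_ramp z"
proof (cases "0 < z")
  case True
  have "z * (1 - 1 / z) \<le> z * exp (- (1 / z))"
    using True exp_ge_add_one_self[of "- (1 / z)"] by (intro mult_left_mono) auto
  then show ?thesis using True by (simp add: smooth_ramp_def flat_exp_def algebra_simps)
qed (simp add: smooth_ramp_def flat_exp_def)

lemma smooth_ramp_derivative:
  obtains D where "\<And>z. (smooth_ramp has_real_derivative D z) (at z)" "\<And>z. \<bar>D z\<bar> \<le> 1" "\<And>z. z \<le> 0 \<Longrightarrow> D z = 0"
proof
  define D where "D z = flat_exp 1 z + z * flat_exp (monom 1 2 * (1 - pderiv 1)) z" for z
  show "(smooth_ramp has_real_derivative D z) (at z)" for z
    unfolding smooth_ramp_def[abs_def] D_def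
    by (auto intro!: derivative_eq_intros flat_exp_derivative)
  show "\<bar>D z\<bar> \<le> 1" for z
  proof (cases "0 < z")
    case True
    have "D z = (1 + 1 / z) * exp (- (1 / z))"
      using True by (simp add: D_def flat_exp_def poly_monom field_simps power2_eq_square)
    moreover have "(1 + 1 / z) * exp (- (1 / z)) \<le> exp (1 / z) * exp (- (1 / z))"
      using exp_ge_add_one_self[of "1 / z"] by (intro mult_right_mono) auto
    ultimately show ?thesis using True by (simp flip: exp_add)
  qed (simp add: D_def flat_exp_def)
  show "D z = 0" if "z \<le> 0" for z using that by (simp add: D_def flat_exp_def)
qed

lemma smooth_ramp_test_function:
  assumes \<psi>: "\<psi> \<in> smooth_family" and supp: "\<And>x. 0 < \<psi> x \<Longrightarrow> x \<in> cball a r" and sub: "cball a r \<subseteq> \<Omega>"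
    and der: "\<And>x. (\<psi> has_derivative (\<lambda>h. G x \<bullet> h)) (at x)"
  shows "(\<lambda>x. smooth_ramp (\<psi> x)) \<in> C0_infinity \<Omega>"
    and "norm (gradient (\<lambda>x. smooth_ramp (\<psi> x)) x) \<le> norm (G x) * indicator (cball a r) x"
proof -
  let ?u = "(\<lambda>x. smooth_ramp (\<psi> x))"
  have S: "?u \<in> smooth_family"
    unfolding smooth_ramp_def by (intro smooth_family.mult smooth_family.flat_exp \<psi>)
  have sub_cball: "support_on UNIV ?u \<subseteq> cball a r"
  proof
    fix x assume "x \<in> support_on UNIV ?u"
    then have "smooth_ramp (\<psi> x) \<noteq> 0" by (simp add: support_on_def)
    then have "0 < \<psi> x" using smooth_ramp_nonpos[of "\<psi> x"] by linarith
    then show "x \<in> cball a r" by (rule supp)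
  qed
  have "closure (support_on UNIV ?u) \<subseteq> cball a r"
    by (rule closure_minimal[OF sub_cball]) simp
  then show C: "?u \<in> C0_infinity \<Omega>"
    using order_trans[OF _ sub] smooth_family_C_n[OF S] bounded_subset[OF bounded_cball sub_cball]
    unfolding C0_infinity_def by (simp add: compact_closure)
  obtain D where D: "\<And>z. (smooth_ramp has_real_derivative D z) (at z)" "\<And>z. \<bar>D z\<bar> \<le> 1" "\<And>z. z \<le> 0 \<Longrightarrow> D z = 0"
    using smooth_ramp_derivative by blast
  have "(?u has_derivative (\<lambda>h. D (\<psi> x) * (G x \<bullet> h))) (at x)"
    by (rule has_derivative_compose[OF der D(1)[unfolded has_field_derivative_def]])
  from has_derivative_unique[OF C0_infinityD(1)[OF C] this]
  have "gradient ?u x \<bullet> h = (D (\<psi> x) *\<^sub>R G x) \<bullet> h" for h by (simp add: fun_eq_iff)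
  then have g: "gradient ?u x = D (\<psi> x) *\<^sub>R G x" by (rule vector_eq_rdot[THEN iffD1, rule_format])
  show "norm (gradient ?u x) \<le> norm (G x) * indicator (cball a r) x"
  proof (cases "x \<in> cball a r")
    case True
    then show ?thesis unfolding g using mult_right_mono[OF D(2)[of "\<psi> x"], of "norm (G x)"] by simp
  next
    case False
    then have "\<psi> x \<le> 0" using supp[of x] by (meson not_le)
    then show ?thesis using False D(3) by (simp add: g)
  qed
qed

section \<open>Cones and truncated logarithms\<close>

lemma norm_square_smooth_family: "(\<lambda>x. (norm (x - a))^2) \<in> smooth_family"
proof -
  have "(norm (x - a))^2 = x \<bullet> axis 1 1 * (x \<bullet> axis 1 1) + x \<bullet> axis 2 1 * (x \<bullet> axis 2 1) + (x \<bullet> (- 2 *\<^sub>R a) + (norm a)^2)" for x :: "real ^ 2"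
    by (simp add: power2_norm_eq_inner inner_vec_def sum_2 axis_def algebra_simps)
  then show ?thesis
    by (simp only:) (intro smooth_family.add smooth_family.mult smooth_family.linear smooth_family.const)
qed

lemma norm_square_derivative: "((\<lambda>x. (norm (x - a))^2) has_derivative (\<lambda>h. (2 *\<^sub>R (x - a)) \<bullet> h)) (at x)" for a x :: "real ^ 2"
  unfolding power2_norm_eq_inner
  by (auto intro!: derivative_eq_intros simp: inner_commute)

lemma emeasure_cball_plane: "0 \<le> r \<Longrightarrow> emeasure lborel (cball (c :: real ^ 2) r) = ennreal (pi * r^2)"
  by (simp add: emeasure_cball unit_ball_vol_2)

lemma emeasure_ball_plane: "0 \<le> r \<Longrightarrow> emeasure lborel (ball (c :: real ^ 2) r) = ennreal (pi * r^2)"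
  by (simp add: emeasure_ball unit_ball_vol_2)

text \<open>The Dirichlet energy in the plane is invariant under scaling: a gradient of at most 2 /
  R on area pi R^2 gives 4 pi whatever \<open>R\<close> is. The height on the half disk does not
  depend on \<open>R\<close> either, while the area does. The height constant is z exp (- 1 / z) at
  z = 3 / 4, the value of 1 - |x - a|^2 / R^2 at distance R / 2.\<close>

lemma cone_test_function:
  assumes R: "0 < R" and sub: "cball a R \<subseteq> \<Omega>"
  obtains u where "u \<in> C0_infinity \<Omega>" "dirichlet_energy \<Omega> u \<le> 4 * pi"
    "\<And>x. x \<in> ball a (R / 2) \<Longrightarrow> 3 / 4 * exp (- (4 / 3)) \<le> u x"
proof -
  define \<psi> where "\<psi> x = 1 + (- (1 / R^2)) * (norm (x - a))^2" for x :: "real ^ 2"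
  have S: "\<psi> \<in> smooth_family"
    unfolding \<psi>_def[abs_def] by (intro smooth_family.add smooth_family.mult smooth_family.const norm_square_smooth_family)
  have der: "(\<psi> has_derivative (\<lambda>h. ((- (2 / R^2)) *\<^sub>R (x - a)) \<bullet> h)) (at x)" for x
  proof -
    have "(\<psi> has_derivative (\<lambda>h. 0 + (- (1 / R^2)) * ((2 *\<^sub>R (x - a)) \<bullet> h))) (at x)"
      unfolding \<psi>_def[abs_def]
      by (intro has_derivative_add has_derivative_const has_derivative_mult_right norm_square_derivative)
    moreover have "(\<lambda>h. 0 + (- (1 / R^2)) * ((2 *\<^sub>R (x - a)) \<bullet> h)) = (\<lambda>h. ((- (2 / R^2)) *\<^sub>R (x - a)) \<bullet> h)"
      by (simp add: fun_eq_iff)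
    ultimately show ?thesis by simp
  qed
  have supp: "x \<in> cball a R" if "0 < \<psi> x" for x
  proof -
    have "(norm (x - a))^2 < R^2" using that R by (simp add: \<psi>_def field_simps)
    then have "norm (x - a) < R" by (rule power2_less_imp_less) (use R in simp)
    then show ?thesis by (simp add: dist_norm norm_minus_commute)
  qed
  let ?u = "\<lambda>x. smooth_ramp (\<psi> x)"
  note u = smooth_ramp_test_function[where G = "\<lambda>x. (- (2 / R^2)) *\<^sub>R (x - a)", OF S supp sub der]
  show thesis
  proof (rule that[OF u(1)])
    have "ennreal (dirichlet_energy \<Omega> ?u) = (\<integral>\<^sup>+x. ennreal ((norm (gradient ?u x))^2) \<partial>lborel)"
      by (rule C0_infinity_energy(1)[OF u(1), symmetric])
    also have "\<dots> \<le> (\<integral>\<^sup>+x\<in>cball a R. ennreal (4 / R^2) \<partial>lborel)"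
    proof (rule nn_integral_mono)
      fix x
      show "ennreal ((norm (gradient ?u x))^2) \<le> ennreal (4 / R^2) * indicator (cball a R) x"
      proof (cases "x \<in> cball a R")
        case True
        have "norm (gradient ?u x) \<le> 2 / R^2 * norm (x - a)" using u(2)[of x] True by simp
        also have "\<dots> \<le> 2 / R^2 * R" using True by (intro mult_left_mono) (auto simp: dist_norm norm_minus_commute)
        also have "\<dots> = 2 / R" using R by (simp add: power2_eq_square)
        finally have "(norm (gradient ?u x))^2 \<le> (2 / R)^2" by (intro power_mono) auto
        then show ?thesis using True by (simp add: power_divide ennreal_leI)
      next
        case False
        then show ?thesis using u(2)[of x] by simp
      qed
    qed
    also have "\<dots> = ennreal (4 / R^2) * ennreal (pi * R^2)"
      using R by (subst nn_integral_cmult_indicator) (auto simp: emeasure_cball_plane)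
    also have "\<dots> = ennreal (4 * pi)" using R by (simp add: ennreal_mult[symmetric])
    finally show "dirichlet_energy \<Omega> ?u \<le> 4 * pi" by (simp add: ennreal_le_iff)
    fix x assume "x \<in> ball a (R / 2)"
    then have "(norm (x - a))^2 \<le> (R / 2)^2" by (intro power_mono) (auto simp: dist_norm norm_minus_commute)
    then have z: "3 / 4 \<le> \<psi> x" using R by (simp add: \<psi>_def field_simps)
    have "- (4 / 3) \<le> - (1 / \<psi> x)" using z by (simp add: field_simps)
    then have "3 / 4 * exp (- (4 / 3)) \<le> \<psi> x * exp (- (1 / \<psi> x))" using z by (intro mult_mono) auto
    then show "3 / 4 * exp (- (4 / 3)) \<le> ?u x" using z by (simp add: smooth_ramp_def flat_exp_def)
  qed
qed

text \<open>Moser's concentrating function in smooth form: ln (r^2 / (|x - a|^2 + \<rho>^2))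
  replaces the logarithm with a plateau of radius \<open>\<rho>\<close>. Its squared gradient is at
  most 4 / (|x - a|^2 + \<rho>^2), which integrates in polar coordinates. Smoothing costs ln 2 and
  the ramp costs 1 in height, both negligible as \<open>\<rho>\<close> shrinks.\<close>

lemma logarithmic_test_function:
  assumes r: "0 < r" and \<rho>: "0 < \<rho>" and sub: "cball a r \<subseteq> \<Omega>"
  obtains u where "u \<in> C0_infinity \<Omega>" "dirichlet_energy \<Omega> u \<le> 4 * pi * ln ((r^2 + \<rho>^2) / \<rho>^2)"
    "\<And>x. x \<in> ball a \<rho> \<Longrightarrow> ln (r^2 / (2 * \<rho>^2)) - 1 \<le> u x"
proof -
  let ?A = "ln ((r^2 + \<rho>^2) / \<rho>^2)"
  let ?w = "\<lambda>x. (norm (x - a))^2 + \<rho>^2"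
  define \<psi> where "\<psi> x = ln (r^2) + (- 1) * ln (?w x)" for x :: "real ^ 2"
  have pos: "0 < ?w x" for x using \<rho> by (simp add: add_nonneg_pos)
  have S: "\<psi> \<in> smooth_family"
    unfolding \<psi>_def[abs_def]
    by (intro smooth_family.add smooth_family.mult smooth_family.const smooth_family.ln norm_square_smooth_family pos)
  define G where "G x = (- (2 / (?w x))) *\<^sub>R (x - a)" for x
  have der: "(\<psi> has_derivative (\<lambda>h. G x \<bullet> h)) (at x)" for x
  proof -
    have "((\<lambda>x. ?w x) has_derivative (\<lambda>h. (2 *\<^sub>R (x - a)) \<bullet> h)) (at x)"
      using has_derivative_add[OF norm_square_derivative has_derivative_const] by simp
    from has_derivative_compose[OF this DERIV_ln[OF pos, unfolded has_field_derivative_def]]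
    have "((\<lambda>x. ln (?w x)) has_derivative (\<lambda>h. inverse (?w x) * ((2 *\<^sub>R (x - a)) \<bullet> h))) (at x)" .
    from has_derivative_add[OF has_derivative_const[of "ln (r^2)"] has_derivative_mult_right[OF this, of "- 1"]]
    have "(\<psi> has_derivative (\<lambda>h. 0 + - 1 * (inverse (?w x) * ((2 *\<^sub>R (x - a)) \<bullet> h)))) (at x)"
      unfolding \<psi>_def[abs_def] .
    moreover have "(\<lambda>h. 0 + - 1 * (inverse (?w x) * ((2 *\<^sub>R (x - a)) \<bullet> h))) = (\<lambda>h. G x \<bullet> h)"
      by (simp add: fun_eq_iff G_def inverse_eq_divide)
    ultimately show ?thesis by simp
  qed
  have supp: "x \<in> cball a r" if "0 < \<psi> x" for x
  proof -
    have "?w x < r^2" using that r pos[of x] by (simp add: \<psi>_def)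
    then have "(norm (x - a))^2 < r^2" using zero_le_power2[of \<rho>] by linarith
    then have "norm (x - a) < r" by (rule power2_less_imp_less) (use r in simp)
    then show ?thesis by (simp add: dist_norm norm_minus_commute)
  qed
  let ?u = "\<lambda>x. smooth_ramp (\<psi> x)"
  note u = smooth_ramp_test_function[where G = G, OF S supp sub der]
  have [measurable]: "cball a r \<in> sets borel" by simp
  have ratio: "0 \<le> ?A" using \<rho> by (intro ln_ge_zero) (simp add: field_simps)
  show thesis
  proof (rule that[OF u(1)])
    let ?f = "\<lambda>x. ennreal (4 / (?w x)) * indicator (cball a r) x"
    have "ennreal (dirichlet_energy \<Omega> ?u) = (\<integral>\<^sup>+x. ennreal ((norm (gradient ?u x))^2) \<partial>lborel)"
      by (rule C0_infinity_energy(1)[OF u(1), symmetric])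
    also have "\<dots> \<le> (\<integral>\<^sup>+x. ?f x \<partial>lborel)"
    proof (rule nn_integral_mono)
      fix x
      show "ennreal ((norm (gradient ?u x))^2) \<le> ?f x"
      proof (cases "x \<in> cball a r")
        case True
        let ?w = "?w x"
        have "norm (gradient ?u x) \<le> 2 / ?w * norm (x - a)"
          using u(2)[of x] True pos[of x] by (simp add: G_def)
        then have "(norm (gradient ?u x))^2 \<le> (2 / ?w * norm (x - a))^2" by (intro power_mono) auto
        also have "\<dots> = 4 / ?w * ((norm (x - a))^2 / ?w)"
          by (simp add: power_mult_distrib power_divide power2_eq_square[of ?w])
        also have "\<dots> \<le> 4 / ?w * 1" using pos[of x] by (intro mult_left_mono) auto
        finally show ?thesis using True by (simp add: ennreal_leI)
      next
        case False
        then show ?thesis using u(2)[of x] by simp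
      qed
    qed
    also have "\<dots> = (\<integral>\<^sup>+\<theta>. (\<integral>\<^sup>+s\<in>{0<..}. ennreal s * ?f (a + s *\<^sub>R cis_vec \<theta>) \<partial>lborel) * indicator {0<..<2*pi} \<theta> \<partial>lborel)"
      by (rule nn_integral_polar(1)) measurable
    also have "\<dots> \<le> (\<integral>\<^sup>+\<theta>\<in>{0<..<2*pi}. ennreal (2 * ?A) \<partial>lborel)"
    proof (intro nn_integral_mono mult_right_mono)
      fix \<theta> :: real
      have "(\<integral>\<^sup>+s\<in>{0<..}. ennreal s * ?f (a + s *\<^sub>R cis_vec \<theta>) \<partial>lborel)
        \<le> (\<integral>\<^sup>+s\<in>{0..r}. ennreal (4 * s / (s^2 + \<rho>^2)) \<partial>lborel)"
      proof (rule nn_integral_mono)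
        fix s :: real
        show "ennreal s * ?f (a + s *\<^sub>R cis_vec \<theta>) * indicator {0<..} s \<le> ennreal (4 * s / (s^2 + \<rho>^2)) * indicator {0..r} s"
        proof (cases "0 < s \<and> s \<le> r")
          case True
          then have "a + s *\<^sub>R cis_vec \<theta> \<in> cball a r" by (simp add: dist_norm)
          then show ?thesis using True by (simp add: ennreal_mult[symmetric] mult.commute)
        next
          case False
          then have "s \<le> 0 \<or> a + s *\<^sub>R cis_vec \<theta> \<notin> cball a r" by (auto simp: dist_norm)
          then show ?thesis by (auto simp: indicator_def)
        qed
      qed
      also have "\<dots> = ennreal (2 * ln (r^2 + \<rho>^2) - 2 * ln (0^2 + \<rho>^2))"
      proof (rule nn_integral_FTC_Icc)
        show "((\<lambda>s. 2 * ln (s^2 + \<rho>^2)) has_real_derivative 4 * s / (s^2 + \<rho>^2)) (at s)" for s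
        proof -
          have "0 < s^2 + \<rho>^2" using \<rho> by (simp add: add_nonneg_pos)
          then show ?thesis by (auto intro!: derivative_eq_intros simp: field_simps)
        qed
      qed (use r in auto)
      also have "2 * ln (r^2 + \<rho>^2) - 2 * ln (0^2 + \<rho>^2) = 2 * ?A"
        using r \<rho> by (simp add: ln_div add_pos_pos)
      finally show "(\<integral>\<^sup>+s\<in>{0<..}. ennreal s * ?f (a + s *\<^sub>R cis_vec \<theta>) \<partial>lborel) \<le> ennreal (2 * ?A)" .
    qed simp
    also have "\<dots> = ennreal (2 * ?A) * ennreal (2 * pi)"
      by (subst nn_integral_cmult_indicator) auto
    also have "\<dots> = ennreal (4 * pi * ?A)"
      using ratio by (simp add: ennreal_mult[symmetric] mult_ac)
    finally show "dirichlet_energy \<Omega> ?u \<le> 4 * pi * ?A"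
      using ratio by (simp add: ennreal_le_iff)
    fix x assume "x \<in> ball a \<rho>"
    then have "(norm (x - a))^2 \<le> \<rho>^2" by (intro power_mono) (auto simp: dist_norm norm_minus_commute)
    then have "ln (?w x) \<le> ln (2 * \<rho>^2)" using pos[of x] by (subst ln_le_cancel_iff) (use \<rho> in auto)
    then have "ln (r^2 / (2 * \<rho>^2)) \<le> \<psi> x" using r \<rho> by (simp add: \<psi>_def ln_div)
    then show "ln (r^2 / (2 * \<rho>^2)) - 1 \<le> ?u x" using smooth_ramp_ge[of "\<psi> x"] by linarith
  qed
qed

section \<open>The supremum and the limit\<close>

lemma moser_trudinger_finite_inradius:
  assumes "multiply_connected k \<Omega>" "inradius \<Omega> < \<infinity>"
  obtains C where "1 \<le> C"
    and "\<And>u. u \<in> C0_infinity \<Omega> \<Longrightarrow> dirichlet_energy \<Omega> u = 1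
      \<Longrightarrow> (\<integral>\<^sup>+x. ennreal (exp (4 * pi * (u x)^2) - 1) \<partial>lborel) \<le> ennreal C"
proof (rule poincare_inequality[OF assms])
  fix P assume P: "0 < P"
    and poincare: "\<And>u g m. \<lbrakk>\<And>x. (u has_derivative (\<lambda>h. g x \<bullet> h)) (at x); continuous_on UNIV g; \<And>x. x \<notin> \<Omega> \<Longrightarrow> u x = 0; 0 < m\<rbrakk>
      \<Longrightarrow> (\<integral>\<^sup>+y. ennreal ((min \<bar>u y\<bar> m)^2) \<partial>lborel)
        \<le> ennreal P * (\<integral>\<^sup>+y\<in>{y. \<bar>u y\<bar> \<le> m}. ennreal ((norm (g y))^2) \<partial>lborel)"
  define C where "C = exp (8 * pi * P) * (184 * 5 * exp 4) + 4 * pi * exp (4 * pi * P) * P + 1"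
  show thesis
  proof (rule that[of C])
    show "1 \<le> C" using P by (simp add: C_def)
    fix u assume u: "u \<in> C0_infinity \<Omega>" and E: "dirichlet_energy \<Omega> u = 1"
    have "(\<integral>\<^sup>+x. ennreal (exp (4 * pi * (u x)^2) - 1) \<partial>lborel)
      \<le> ennreal (exp (8 * pi * P) * (184 * 5 * exp 4) + 4 * pi * exp (4 * pi * P) * P)"
    proof (rule moser_trudinger_of_poincare[OF C0_infinityD(1)[OF u] C0_infinityD(2)[OF u] C0_infinityD(4)[OF u] P])
      show "(\<integral>\<^sup>+y. ennreal ((min \<bar>u y\<bar> m)^2) \<partial>lborel)
        \<le> ennreal P * (\<integral>\<^sup>+y\<in>{y. \<bar>u y\<bar> \<le> m}. ennreal ((norm (gradient u y))^2) \<partial>lborel)" if "0 < m" for m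
        by (rule poincare[OF C0_infinityD(1)[OF u] C0_infinityD(2)[OF u] C0_infinityD(5)[OF u] that])
      show "(\<integral>\<^sup>+y. ennreal ((norm (gradient u y))^2) \<partial>lborel) \<le> 1"
        unfolding C0_infinity_energy(1)[OF u] E by simp
    qed
    also have "\<dots> \<le> ennreal C" unfolding C_def by (intro ennreal_leI) simp
    finally show "(\<integral>\<^sup>+x. ennreal (exp (4 * pi * (u x)^2) - 1) \<partial>lborel) \<le> ennreal C" .
  qed
qed

lemma infinite_inradius_cball:
  assumes "inradius \<Omega> = \<infinity>"
  obtains a where "cball a R \<subseteq> \<Omega>"
proof -
  have "ennreal \<bar>R\<bar> < inradius \<Omega>" unfolding assms by simp
  then obtain r x where r: "\<bar>R\<bar> < r" "ball x r \<subseteq> \<Omega>"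
    unfolding inradius_def less_Sup_iff by (auto simp: ennreal_less_iff)
  have "cball x R \<subseteq> ball x r" using r by auto
  then show thesis using r that by blast
qed

text \<open>The cone has energy E \<le> 4 pi, so normalising it leaves the exponent 4 pi v^2 / E at
  least v^2. With exp x - 1 \<ge> x the integrand is bounded below on the half disk, and the
  integral grows like \<open>R\<close>^2.\<close>

lemma exponential_integral_unbounded:
  assumes sub: "cball a R \<subseteq> \<Omega>" and R: "0 < R"
  obtains u where "u \<in> C0_infinity \<Omega>" "dirichlet_energy \<Omega> u = 1"
    "ennreal ((3 / 4 * exp (- (4 / 3)))^2 * (pi * (R / 2)^2)) \<le> (\<integral>\<^sup>+x\<in>\<Omega>. ennreal (exp (4 * pi * (u x)^2) - 1) \<partial>lborel)"
proof -
  define \<kappa> where "\<kappa> = 3 / 4 * exp (- (4 / 3) :: real)"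
  have \<kappa>: "0 < \<kappa>" by (simp add: \<kappa>_def)
  obtain v where v: "v \<in> C0_infinity \<Omega>" "dirichlet_energy \<Omega> v \<le> 4 * pi"
    "\<And>x. x \<in> ball a (R / 2) \<Longrightarrow> \<kappa> \<le> v x"
    using cone_test_function[OF R sub] unfolding \<kappa>_def by blast
  define E where "E = dirichlet_energy \<Omega> v"
  let ?X = "\<lambda>x. 4 * pi * (1 / sqrt E * v x)^2"
  have "v a \<noteq> 0" using v(3)[of a] R \<kappa> by simp
  then have "E \<noteq> 0" using gradient_zero_imp_zero[OF v(1)] by (auto simp: E_def)
  then have E: "0 < E" "E \<le> 4 * pi" using C0_infinity_energy(2)[OF v(1)] v(2) by (auto simp: E_def)
  have ratio: "1 \<le> 4 * pi / E" using E by simp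
  note n = C0_infinity_normalize[OF v(1) E_def E(1)]
  show thesis
  proof (rule that[OF n])
    have "ennreal (\<kappa>^2 * (pi * (R / 2)^2)) = ennreal (\<kappa>^2) * emeasure lborel (ball a (R / 2))"
      using R by (subst emeasure_ball_plane) (auto simp: ennreal_mult[symmetric])
    also have "\<dots> = (\<integral>\<^sup>+x. ennreal (\<kappa>^2) * indicator (ball a (R / 2)) x \<partial>lborel)"
      by (rule nn_integral_cmult_indicator[symmetric]) simp
    also have "\<dots> \<le> (\<integral>\<^sup>+x\<in>\<Omega>. ennreal (exp (?X x) - 1) \<partial>lborel)"
    proof (rule nn_integral_mono)
      fix x
      have "\<kappa>^2 \<le> exp (?X x) - 1 \<and> x \<in> \<Omega>" if x: "x \<in> ball a (R / 2)"
      proof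
        have "ball a (R / 2) \<subseteq> cball a R" using R by (auto simp: mem_ball)
        then show "x \<in> \<Omega>" using x sub by blast
        have "\<kappa>^2 \<le> (v x)^2" using v(3)[OF x] \<kappa> by (intro power_mono) auto
        also have "\<dots> \<le> (4 * pi / E) * (v x)^2" using mult_right_mono[OF ratio, of "(v x)^2"] by simp
        also have "\<dots> = ?X x" using E by (simp add: power_mult_distrib power_divide)
        also have "\<dots> \<le> exp (?X x) - 1"
          using exp_ge_add_one_self[of "?X x"] by linarith
        finally show "\<kappa>^2 \<le> exp (?X x) - 1" .
      qed
      then show "ennreal (\<kappa>^2) * indicator (ball a (R / 2)) x \<le> ennreal (exp (?X x) - 1) * indicator \<Omega> x"
        by (cases "x \<in> ball a (R / 2)") (auto intro: ennreal_leI)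
    qed
    finally show "ennreal ((3 / 4 * exp (- (4 / 3)))^2 * (pi * (R / 2)^2))
      \<le> (\<integral>\<^sup>+x\<in>\<Omega>. ennreal (exp (?X x) - 1) \<partial>lborel)"
      by (simp add: \<kappa>_def)
  qed
qed

text \<open>The maximum of s^p exp (- s) is (p / e)^p, at s = p. For s \<ge> 1, passing from exp s
  to exp s - 1 costs at most the factor e. For s < 1 one uses s^p \<le> s \<le> exp s - 1 and that
  the constant e (p / e)^p is at least 1. The factor e is harmless: only its p-th root survives in
  the limit.\<close>

lemma powr_le_exp_minus_one:
  fixes s p :: real
  assumes s: "0 \<le> s" and p: "1 \<le> p"
  shows "s powr p \<le> exp 1 * (p / exp 1) powr p * (exp s - 1)"
proof (cases "s = 0")
  case False
  then have s0: "0 < s" using s by simp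
  have pe: "(p / exp 1) powr p = exp (p * (ln p - 1))"
    using p by (simp add: powr_def ln_div)
  show ?thesis
  proof (cases "1 \<le> s")
    case True
    have "ln (s / p) \<le> s / p - 1" using s0 p by (intro ln_le_minus_one) auto
    then have "p * ln (s / p) \<le> p * (s / p - 1)" using p by (intro mult_left_mono) auto
    then have "p * ln s \<le> p * (ln p - 1) + s" using s0 p by (simp add: ln_div algebra_simps)
    then have "s powr p \<le> (p / exp 1) powr p * exp s"
      unfolding pe using s0 by (simp add: powr_def flip: exp_add)
    also have "\<dots> \<le> (p / exp 1) powr p * (exp 1 * (exp s - 1))"
    proof (rule mult_left_mono)
      have e1: "2 \<le> exp (1 :: real)" using exp_ge_add_one_self[of 1] by simp
      have "exp 1 \<le> exp s" using True by simp
      also have "\<dots> \<le> (exp 1 - 1) * exp s" using e1 mult_right_mono[of 1 "exp 1 - 1" "exp s"] by simp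
      finally show "exp s \<le> exp 1 * (exp s - 1)" by (simp add: algebra_simps)
    qed simp
    finally show ?thesis by (simp add: mult_ac)
  next
    case le: False
    have "ln (1 / p) \<le> 1 / p - 1" using p by (intro ln_le_minus_one) auto
    then have "p * (1 - 1 / p) \<le> p * ln p" using p by (intro mult_left_mono) (auto simp: ln_div)
    then have "0 \<le> 1 + p * (ln p - 1)" using p by (simp add: algebra_simps)
    then have one: "1 \<le> exp 1 * (p / exp 1) powr p" by (simp add: pe flip: exp_add)
    have "s powr p \<le> s powr 1" using s0 le p by (intro powr_mono') auto
    also have "s powr 1 \<le> exp s - 1" using s0 exp_ge_add_one_self[of s] powr_one[of s] by linarith
    also have "\<dots> \<le> exp 1 * (p / exp 1) powr p * (exp s - 1)"
      using mult_right_mono[OF one, of "exp s - 1"] s0 by simp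
    finally show ?thesis .
  qed
qed simp

lemma Lp_norm_square:
  assumes "0 \<le> (LINT x:\<Omega>|lborel. norm (f x) powr q)"
  shows "(Lp_norm q \<Omega> f)^2 = (LINT x:\<Omega>|lborel. norm (f x) powr q) powr (2 / q)"
  using assms by (simp add: Lp_norm_def power2_eq_square flip: powr_add)

lemma Lp_norm_gradient_square:
  assumes u: "u \<in> C0_infinity \<Omega>"
  shows "(Lp_norm 2 \<Omega> (gradient u))^2 = dirichlet_energy \<Omega> u"
proof -
  have eq: "norm (gradient u x) powr 2 = (norm (gradient u x))^2" for x
    by (cases "gradient u x = 0") (auto simp: powr_numeral)
  show ?thesis
    using C0_infinity_energy(2)[OF u] by (subst Lp_norm_square) (simp_all add: eq)
qed

lemma integral_powr_pos:
  assumes u: "u \<in> C0_infinity \<Omega>" and q: "0 < q" and nz: "u \<noteq> (\<lambda>x. 0)"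
  shows "0 < (LINT x:\<Omega>|lborel. \<bar>u x\<bar> powr q)"
proof (rule ccontr)
  assume "\<not> ?thesis"
  then have "(\<integral>\<^sup>+x. ennreal (\<bar>u x\<bar> powr q) \<partial>lborel) = 0"
    using C0_infinity_powr_norm[OF u q] by simp
  moreover have [measurable]: "u \<in> borel_measurable borel"
    using C0_infinityD(3)[OF u] by (rule borel_measurable_continuous_onI)
  ultimately have "AE x in lborel. u x = 0" by (subst (asm) nn_integral_0_iff_AE) auto
  then have "AE y in lborel. gradient u y = 0 \<or> u y = 0" by eventually_elim simp
  then show False using AE_riesz_zero_imp_zero[OF u] nz by blast
qed

text \<open>Put p = q / 2 and apply \<open>powr_le_exp_minus_one\<close> to 4 pi u^2 / E, the
  exponent for the normalised function. After integration and a p-th root, the factor p / e gives 4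
  pi e / p = 8 pi e / q, and the constants e and \<open>C\<close> survive only as (e C)^(2 / q),
  which tends to 1.\<close>

lemma lambda_2_lower_bound:
  assumes C: "1 \<le> C"
    and mt: "\<And>u. u \<in> C0_infinity \<Omega> \<Longrightarrow> dirichlet_energy \<Omega> u = 1
      \<Longrightarrow> (\<integral>\<^sup>+x. ennreal (exp (4 * pi * (u x)^2) - 1) \<partial>lborel) \<le> ennreal C"
    and q: "2 \<le> q"
  shows "ereal (8 * pi * exp 1 / (exp 1 * C) powr (2 / q)) \<le> ereal q * lambda_2 q \<Omega>"
proof -
  define p where "p = q / 2"
  have p: "1 \<le> p" "2 / q = 1 / p" "q = 2 * p" using q by (auto simp: p_def)
  let ?c = "exp 1 * (p / exp 1) powr p"
  define c where "c = 8 * pi * exp 1 / ((exp 1 * C) powr (1 / p) * q)"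
  have "ereal c \<le> lambda_2 q \<Omega>"
    unfolding lambda_2_def
  proof (rule INF_greatest)
    fix u assume "u \<in> C0_infinity \<Omega> - {\<lambda>x. 0}"
    then have u: "u \<in> C0_infinity \<Omega>" and nz: "u \<noteq> (\<lambda>x. 0)" by auto
    define E where "E = dirichlet_energy \<Omega> u"
    let ?X = "\<lambda>x. 4 * pi * (1 / sqrt E * u x)^2"
    define B where "B = (LINT x:\<Omega>|lborel. \<bar>u x\<bar> powr q)"
    have "E \<noteq> 0" using gradient_zero_imp_zero[OF u] nz unfolding E_def by blast
    then have E: "0 < E" using C0_infinity_energy(2)[OF u] unfolding E_def by linarith
    have B: "0 < B" unfolding B_def by (rule integral_powr_pos[OF u _ nz]) (use q in simp)
    note n = C0_infinity_normalize[OF u E_def E]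
    have [measurable]: "u \<in> borel_measurable borel"
      using C0_infinityD(3)[OF u] by (rule borel_measurable_continuous_onI)
    have pt: "(4 * pi / E) powr p * \<bar>u x\<bar> powr q \<le> ?c * (exp (?X x) - 1)" for x
    proof -
      have "(4 * pi / E) powr p * \<bar>u x\<bar> powr q = (4 * pi / E) powr p * (\<bar>u x\<bar> powr 2) powr p"
        unfolding powr_powr by (simp only: p(3))
      also have "\<bar>u x\<bar> powr 2 = (u x)^2"
        by (cases "u x = 0") (simp_all add: powr_numeral)
      also have "(4 * pi / E) powr p * ((u x)^2) powr p = (4 * pi / E * (u x)^2) powr p"
        by (rule powr_mult[symmetric])
      also have "4 * pi / E * (u x)^2 = ?X x"
        using E by (simp add: power_mult_distrib power_divide)
      also have "\<dots> powr p \<le> ?c * (exp (?X x) - 1)"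
        by (rule powr_le_exp_minus_one) (use p in auto)
      finally show ?thesis .
    qed
    have "ennreal ((4 * pi / E) powr p * B) = ennreal ((4 * pi / E) powr p) * (\<integral>\<^sup>+x. ennreal (\<bar>u x\<bar> powr q) \<partial>lborel)"
      unfolding B_def using C0_infinity_powr_norm[OF u, of q] q by (simp add: ennreal_mult)
    also have "\<dots> = (\<integral>\<^sup>+x. ennreal ((4 * pi / E) powr p) * ennreal (\<bar>u x\<bar> powr q) \<partial>lborel)"
      by (rule nn_integral_cmult[symmetric]) measurable
    also have "\<dots> \<le> (\<integral>\<^sup>+x. ennreal (?c) * ennreal (exp (?X x) - 1) \<partial>lborel)"
    proof (rule nn_integral_mono)
      fix x
      show "ennreal ((4 * pi / E) powr p) * ennreal (\<bar>u x\<bar> powr q)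
        \<le> ennreal (?c) * ennreal (exp (?X x) - 1)"
        using ennreal_leI[OF pt[of x]] by (subst (1 2) ennreal_mult[symmetric]) auto
    qed
    also have "\<dots> = ennreal (?c) * (\<integral>\<^sup>+x. ennreal (exp (?X x) - 1) \<partial>lborel)"
      by (rule nn_integral_cmult) measurable
    also have "\<dots> \<le> ennreal (?c) * ennreal C"
      by (intro mult_left_mono mt n) simp
    also have "\<dots> = ennreal (?c * C)"
      using C by (subst ennreal_mult[symmetric]) auto
    finally have "(4 * pi / E) powr p * B \<le> ?c * C"
      using C by (subst (asm) ennreal_le_iff) auto
    then have "((4 * pi / E) powr p * B) powr (1 / p) \<le> (?c * C) powr (1 / p)"
      using p B by (intro powr_mono2) auto
    moreover have "((4 * pi / E) powr p * B) powr (1 / p) = 4 * pi / E * B powr (1 / p)"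
      using p B E by (simp add: powr_mult powr_powr)
    moreover have "(?c * C) powr (1 / p) = (exp 1 * C) powr (1 / p) * (p / exp 1)"
      using p C by (simp add: powr_mult powr_powr)
    ultimately have key: "4 * pi / E * B powr (1 / p) \<le> (exp 1 * C) powr (1 / p) * (p / exp 1)" by simp
    have X: "0 < (exp 1 * C) powr (1 / p)" using C by simp
    have "8 * pi * exp 1 * B powr (1 / p) \<le> E * ((exp 1 * C) powr (1 / p) * q)"
      using key E p by (simp add: field_simps)
    then have "c \<le> E / B powr (1 / p)"
      using X B q by (simp add: c_def field_simps)
    moreover have "(Lp_norm q \<Omega> u)^2 = B powr (1 / p)"
      using Lp_norm_square[of \<Omega> u q] B p by (simp add: B_def)
    ultimately show "ereal c \<le> ereal ((Lp_norm 2 \<Omega> (gradient u))^2 / (Lp_norm q \<Omega> u)^2)"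
      using Lp_norm_gradient_square[OF u] by (simp add: E_def)
  qed
  then have "ereal q * ereal c \<le> ereal q * lambda_2 q \<Omega>" using q by (intro ereal_mult_left_mono) auto
  moreover have "q * c = 8 * pi * exp 1 / (exp 1 * C) powr (2 / q)"
    using q by (simp add: c_def p(2))
  ultimately show ?thesis by simp
qed

text \<open>The scale \<open>r * exp (- (q / 4))\<close> makes the height of the logarithm about q /
  2, where the quotient of energy and squared norm is smallest. The terms ln 2 and 1 are the losses
  in height from smoothing and from the ramp; q \<ge> 4 keeps what remains positive.\<close>

lemma lambda_2_upper_bound:
  assumes r: "0 < r" and sub: "cball a r \<subseteq> \<Omega>" and q: "4 \<le> q"
  shows "ereal q * lambda_2 q \<Omega>
    \<le> ereal (q * (4 * pi * ln (exp (q / 2) + 1)) * exp 1 / ((q / 2 - ln 2 - 1)^2 * (pi * r^2) powr (2 / q)))"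
proof -
  define \<rho> where "\<rho> = r * exp (- (q / 4))"
  have \<rho>: "0 < \<rho>" using r by (simp add: \<rho>_def)
  have \<rho>2: "\<rho>^2 = r^2 * exp (- (q / 2))"
    by (simp add: \<rho>_def power_mult_distrib power2_eq_square flip: exp_add)
  have ratio: "(r^2 + \<rho>^2) / \<rho>^2 = exp (q / 2) + 1"
    unfolding \<rho>2 using r by (simp add: field_simps flip: exp_add)
  define b where "b = q / 2 - ln 2 - 1"
  have height: "ln (r^2 / (2 * \<rho>^2)) - 1 = b"
    unfolding \<rho>2 b_def using r by (simp add: ln_div ln_mult)
  have "ln 2 < (1 :: real)" using ln_2_less_1 .
  then have b: "0 < b" using q by (simp add: b_def)
  obtain u where u: "u \<in> C0_infinity \<Omega>" "dirichlet_energy \<Omega> u \<le> 4 * pi * ln (exp (q / 2) + 1)"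
    "\<And>x. x \<in> ball a \<rho> \<Longrightarrow> b \<le> u x"
    using logarithmic_test_function[OF r \<rho> sub] unfolding ratio height by blast
  define E where "E = dirichlet_energy \<Omega> u"
  define B where "B = (LINT x:\<Omega>|lborel. \<bar>u x\<bar> powr q)"
  have nz: "u \<noteq> (\<lambda>x. 0)" using u(3)[of a] \<rho> b by auto
  have B0: "0 < B" unfolding B_def by (rule integral_powr_pos[OF u(1) _ nz]) (use q in simp)
  have "ennreal (b powr q * (pi * \<rho>^2)) = ennreal (b powr q) * emeasure lborel (ball a \<rho>)"
    using \<rho> by (subst emeasure_ball_plane) (auto simp: ennreal_mult[symmetric])
  also have "\<dots> = (\<integral>\<^sup>+x. ennreal (b powr q) * indicator (ball a \<rho>) x \<partial>lborel)"
    by (rule nn_integral_cmult_indicator[symmetric]) simp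
  also have "\<dots> \<le> (\<integral>\<^sup>+x. ennreal (\<bar>u x\<bar> powr q) \<partial>lborel)"
  proof (rule nn_integral_mono)
    fix x
    have "b powr q \<le> \<bar>u x\<bar> powr q" if "x \<in> ball a \<rho>"
      using u(3)[OF that] b q by (intro powr_mono2) auto
    then show "ennreal (b powr q) * indicator (ball a \<rho>) x \<le> ennreal (\<bar>u x\<bar> powr q)"
      by (cases "x \<in> ball a \<rho>") (auto intro: ennreal_leI)
  qed
  also have "\<dots> = ennreal B" unfolding B_def by (rule C0_infinity_powr_norm(1)[OF u(1)]) (use q in simp)
  finally have "b powr q * (pi * \<rho>^2) \<le> B" using B0 by (subst (asm) ennreal_le_iff) auto
  then have "(b powr q * (pi * \<rho>^2)) powr (2 / q) \<le> B powr (2 / q)"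
    using q b by (intro powr_mono2) auto
  moreover have "(b powr q * (pi * \<rho>^2)) powr (2 / q) = b^2 * (pi * r^2) powr (2 / q) / exp 1"
  proof -
    have "b powr q * (pi * \<rho>^2) = b powr q * (pi * r^2) * exp (- (q / 2))" by (simp add: \<rho>2)
    also have "\<dots> powr (2 / q) = (b powr q) powr (2 / q) * (pi * r^2) powr (2 / q) * exp (- (q / 2)) powr (2 / q)"
      using b r by (simp add: powr_mult)
    also have "(b powr q) powr (2 / q) = b^2" using b q by (simp add: powr_powr powr_numeral)
    \<comment> \<open>The source of e in the limit: the area of the concentration disk under the
      power 2 / q.\<close>
    also have "exp (- (q / 2)) powr (2 / q) = 1 / exp 1"
      unfolding powr_def ln_exp using q by (simp add: exp_minus inverse_eq_divide)
    finally show ?thesis by simp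
  qed
  ultimately have le: "b^2 * (pi * r^2) powr (2 / q) / exp 1 \<le> B powr (2 / q)" by simp
  have pos: "0 < b^2 * (pi * r^2) powr (2 / q) / exp 1" using b r by simp
  have "lambda_2 q \<Omega> \<le> ereal ((Lp_norm 2 \<Omega> (gradient u))^2 / (Lp_norm q \<Omega> u)^2)"
    unfolding lambda_2_def by (rule INF_lower) (use u(1) nz in auto)
  also have "(Lp_norm 2 \<Omega> (gradient u))^2 = E"
    using Lp_norm_gradient_square[OF u(1)] by (simp add: E_def)
  also have "(Lp_norm q \<Omega> u)^2 = B powr (2 / q)"
    using Lp_norm_square[of \<Omega> u q] B0 by (simp add: B_def)
  also have "ereal (E / B powr (2 / q)) \<le> ereal (4 * pi * ln (exp (q / 2) + 1) / (b^2 * (pi * r^2) powr (2 / q) / exp 1))"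
    unfolding ereal_less_eq by (rule frac_le[OF _ _ pos le]) (use u(2) in \<open>auto simp: E_def add_pos_pos\<close>)
  finally have "ereal q * lambda_2 q \<Omega> \<le> ereal q * ereal (4 * pi * ln (exp (q / 2) + 1) / (b^2 * (pi * r^2) powr (2 / q) / exp 1))"
    using q by (intro ereal_mult_left_mono) auto
  then show ?thesis by (simp add: b_def mult_ac)
qed

theorem corollary3p8:
  fixes k :: nat and \<Omega> :: "(real ^ 2) set"
  assumes "k \<noteq> 0" and "open \<Omega>" and "multiply_connected k \<Omega>"
  shows "((SUP u\<in>{u \<in> C0_infinity \<Omega>. (LINT x:\<Omega>|lborel. (norm (gradient u x))\<^sup>2) = 1}.
            (\<integral>\<^sup>+x\<in>\<Omega>. ennreal (exp (4 * pi * (u x)\<^sup>2) - 1) \<partial>lborel)) < \<infinity>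
          \<longleftrightarrow> inradius \<Omega> < \<infinity>)
    \<and> (\<Omega> \<noteq> {} \<and> inradius \<Omega> < \<infinity> \<longrightarrow>
         ((\<lambda>q. ereal q * lambda_2 q \<Omega>) \<longlongrightarrow> ereal (8 * pi * exp 1)) at_top)"
proof (intro conjI iffI impI)
  let ?U = "{u \<in> C0_infinity \<Omega>. dirichlet_energy \<Omega> u = 1}"
  let ?I = "\<lambda>u. \<integral>\<^sup>+x\<in>\<Omega>. ennreal (exp (4 * pi * (u x)^2) - 1) \<partial>lborel"
  show "inradius \<Omega> < \<infinity>" if fin: "(SUP u\<in>?U. ?I u) < \<infinity>"
  proof (rule ccontr)
    assume "\<not> inradius \<Omega> < \<infinity>"
    then have inf: "inradius \<Omega> = \<infinity>" by (simp add: less_top[symmetric])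
    define S where "S = enn2real (SUP u\<in>?U. ?I u)"
    have S: "(SUP u\<in>?U. ?I u) = ennreal S" "0 \<le> S" using fin by (auto simp: S_def)
    define \<kappa> where "\<kappa> = (3 / 4 * exp (- (4 / 3) :: real))^2 * pi"
    have \<kappa>: "0 < \<kappa>" by (simp add: \<kappa>_def)
    \<comment> \<open>Chosen so that the lower bound for the integral on a disk of radius
      \<open>R\<close> is S + 1, beyond the supposed supremum \<open>S\<close>.\<close>
    define R where "R = 2 * sqrt ((S + 1) / \<kappa>)"
    have R: "0 < R" "\<kappa> * (R / 2)^2 = S + 1" using \<kappa> S by (auto simp: R_def)
    obtain a where "cball a R \<subseteq> \<Omega>" using infinite_inradius_cball[OF inf] .
    then obtain u where u: "u \<in> ?U" "ennreal ((3 / 4 * exp (- (4 / 3)))^2 * (pi * (R / 2)^2)) \<le> ?I u"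
      using exponential_integral_unbounded[OF _ R(1), of a \<Omega>] by auto
    have "(3 / 4 * exp (- (4 / 3)))^2 * (pi * (R / 2)^2) = S + 1" using R(2) by (simp add: \<kappa>_def mult_ac)
    then have "ennreal (S + 1) \<le> ?I u" using u(2) by simp
    also have "\<dots> \<le> ennreal S" unfolding S(1)[symmetric] using u(1) by (rule SUP_upper)
    finally show False using S(2) by (simp add: ennreal_le_iff)
  qed
  show "(SUP u\<in>?U. ?I u) < \<infinity>" if fin: "inradius \<Omega> < \<infinity>"
  proof -
    obtain C where C: "1 \<le> C"
      and mt: "\<And>u. u \<in> C0_infinity \<Omega> \<Longrightarrow> dirichlet_energy \<Omega> u = 1
        \<Longrightarrow> (\<integral>\<^sup>+x. ennreal (exp (4 * pi * (u x)^2) - 1) \<partial>lborel) \<le> ennreal C"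
      using moser_trudinger_finite_inradius[OF assms(3) fin] by blast
    have "(SUP u\<in>?U. ?I u) \<le> ennreal C"
    proof (rule SUP_least)
      fix u assume "u \<in> ?U"
      then have "(\<integral>\<^sup>+x. ennreal (exp (4 * pi * (u x)^2) - 1) \<partial>lborel) \<le> ennreal C" using mt by blast
      moreover have "?I u \<le> (\<integral>\<^sup>+x. ennreal (exp (4 * pi * (u x)^2) - 1) \<partial>lborel)"
        by (intro nn_integral_mono) (simp add: indicator_def)
      ultimately show "?I u \<le> ennreal C" by (rule order_trans[rotated])
    qed
    also have "ennreal C < \<infinity>" by simp
    finally show ?thesis .
  qed
  assume "\<Omega> \<noteq> {} \<and> inradius \<Omega> < \<infinity>"
  then have fin: "inradius \<Omega> < \<infinity>" and "\<Omega> \<noteq> {}" by auto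
  \<comment> \<open>A point of \<Omega> supplies the disk that carries the logarithms. On the empty
    domain no nonzero test function exists, and \<open>lambda_2\<close> is the infimum of the empty
    set, which is infinite.\<close>
  then obtain a where "a \<in> \<Omega>" by blast
  then obtain r where r: "0 < r" "cball a r \<subseteq> \<Omega>"
    using assms(2) open_contains_cball by blast
  obtain C where C: "1 \<le> C"
    and mt: "\<And>u. u \<in> C0_infinity \<Omega> \<Longrightarrow> dirichlet_energy \<Omega> u = 1
      \<Longrightarrow> (\<integral>\<^sup>+x. ennreal (exp (4 * pi * (u x)^2) - 1) \<partial>lborel) \<le> ennreal C"
    using moser_trudinger_finite_inradius[OF assms(3) fin] by blast
  define K where "K = pi * r^2"
  define D where "D = exp 1 * C"
  have KD: "0 < K" "0 < D" using r C by (auto simp: K_def D_def)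
  have low: "((\<lambda>q. 8 * pi * exp 1 / D powr (2 / q)) \<longlongrightarrow> 8 * pi * exp 1) at_top"
    using KD by real_asymp
  \<comment> \<open>The unevaluated limit shows the leading terms: the logarithm and the height are
    both about q / 2, which gives 2 pi e in the numerator and (1 / 2)^2 in the denominator.\<close>
  have "((\<lambda>q. q * (4 * pi * ln (exp (q / 2) + 1)) * exp 1 / ((q / 2 - ln 2 - 1)^2 * K powr (2 / q)))
    \<longlongrightarrow> 2 * pi * exp 1 * inverse ((1 / 2)^2)) at_top"
    using KD by real_asymp
  then have up: "((\<lambda>q. q * (4 * pi * ln (exp (q / 2) + 1)) * exp 1 / ((q / 2 - ln 2 - 1)^2 * K powr (2 / q)))
    \<longlongrightarrow> 8 * pi * exp 1) at_top"
    by (simp add: power2_eq_square mult.assoc)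
  show "((\<lambda>q. ereal q * lambda_2 q \<Omega>) \<longlongrightarrow> ereal (8 * pi * exp 1)) at_top"
  proof (rule tendsto_sandwich[OF _ _ tendsto_ereal[OF low] tendsto_ereal[OF up]])
    show "\<forall>\<^sub>F q in at_top. ereal (8 * pi * exp 1 / D powr (2 / q)) \<le> ereal q * lambda_2 q \<Omega>"
      using eventually_ge_at_top[of 2] unfolding D_def
      by eventually_elim (rule lambda_2_lower_bound[OF C mt])
    show "\<forall>\<^sub>F q in at_top. ereal q * lambda_2 q \<Omega>
      \<le> ereal (q * (4 * pi * ln (exp (q / 2) + 1)) * exp 1 / ((q / 2 - ln 2 - 1)^2 * K powr (2 / q)))"
      using eventually_ge_at_top[of 4] unfolding K_def
      by eventually_elim (rule lambda_2_upper_bound[OF r])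
  qed
qed

end
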